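(* The categories $\mathbf{DMV_{fp}^{c'}}$, $\mathbf{RMV_{fp}^{c'}}$, $\mathbf{MV_{fp}}$ and the opposite category of $\mathbf{RatPol}^{\mathbb Z}_{[0,1]}$ are equivalent.
   Context: A function $f:[0,1]^n\to[0,1]$ is a unital piecewise linear function with real (rational, integer) coefficients if it is continuous and there are finitely many $f_i(\mathbf x)=c_{i1}x_1+\dots+c_{in}x_n+b_i$ with real (rational, integer) $c_{ij},b_i$ such that for each $\mathbf x\in[0,1]^n$ there is $i$ with $f(\mathbf x)=f_i(\mathbf x)$. $RMV_n$, $DMV_n$, $MV_n$ denote the sets of such functions with real, rational, integer coefficients. With pointwise operations $f\oplus g=\min(1,f+g)$, $f^*=1-f$, constant $0$, and (for $RMV_n$) scalar multiplication by all $r\in[0,1]$, (for $DMV_n$) by all $r\in[0,1]\cap\mathbb Q$, these are the free Riesz MV-algebra, free DMV-algebra and free MV-algebra on the $n$ coordinate projections $\pi_1,\dots,\pi_n$. Here an MV-algebra is an algebra $(A,\oplus,{}^*,0)$ in the variety generated by $[0,1]$ with $\min(1,x+y)$, $1-x$, $0$; Riesz MV-algebras (DMV-algebras) are the algebras in the variety generated by $[0,1]$ (by $[0,1]\cap\mathbb Q$) with in addition the scalar multiplications by all reals (all rationals) in $[0,1]$. $\mathbf{MV_{fp}}$ is the category of finitely presented MV-algebras (those isomorphic to a quotient of some $MV_n$ by a principal ideal) and homomorphisms. An $m$-simplex in $\mathbb R^n$ is the convex hull of $m+1$ affinely independent points (its vertices); it is rational if its vertices have rational coordinates. A rational polyhedron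 is a finite (possibly empty) union of rational simplexes. $\mathbf{RatPol}^{\mathbb Z}_{[0,1]}$ is the category whose objects are the rational polyhedra $P\subseteq[0,1]^n$, $n\in\mathbb N$, and whose morphisms $P\to Q$ (with $P\subseteq[0,1]^n$, $Q\subseteq[0,1]^m$) are the $\mathbb Z$-maps, i.e. maps $z=(z_1,\dots,z_m):P\to Q$ where each $z_i$ is the restriction to $P$ of an element of $MV_n$. For $P\subseteq[0,1]^n$ write $DMV_n|_P=\{g|_P: g\in DMV_n\}$, and similarly $RMV_n|_P$, $MV_n|_P$. $\mathbf{DMV_{fp}^{c'}}$ is the category whose objects are the DMV-algebras $DMV_n|_P$, $P\subseteq[0,1]^n$ a rational polyhedron, and whose morphisms are the DMV-homomorphisms $\sigma:DMV_n|_P\to DMV_m|_Q$ such that $\sigma(\pi_i|_P)\in MV_m|_Q$ for $i=1,\dots,n$. $\mathbf{RMV_{fp}^{c'}}$ is the category whose objects are the Riesz MV-algebras $RMV_n|_P$, $P\subseteq[0,1]^n$ a rational polyhedron, and whose morphisms are the Riesz MV-homomorphisms $\sigma:RMV_n|_P\to RMV_m|_Q$ such that $\sigma(\pi_i|_P)\in MV_m|_Q$ for $i=1,\dots,n$. *)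

theory Defs
  imports "HOL-Analysis.Analysis" "HOL-Library.Function_Algebras"
begin

section \<open>Categories and equivalence of categories\<close>

text \<open>Hom-sets are indexed by objects and need not be disjoint, so composition and
  the action of a functor on morphisms take the objects involved as arguments:
  \<open>cat_comp C A B D g f\<close> is the composite of \<open>f : A \<rightarrow> B\<close> and \<open>g : B \<rightarrow> D\<close>.\<close>

record ('o, 'm) cat =
  cat_obj :: "'o set"
  cat_hom :: "'o \<Rightarrow> 'o \<Rightarrow> 'm set"
  cat_id :: "'o \<Rightarrow> 'm"
  cat_comp :: "'o \<Rightarrow> 'o \<Rightarrow> 'o \<Rightarrow> 'm \<Rightarrow> 'm \<Rightarrow> 'm"

definition is_category :: "('o, 'm) cat \<Rightarrow> bool" where
  "is_category C \<longleftrightarrow>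
     (\<forall>A\<in>cat_obj C. cat_id C A \<in> cat_hom C A A) \<and>
     (\<forall>A\<in>cat_obj C. \<forall>B\<in>cat_obj C. \<forall>D\<in>cat_obj C. \<forall>f\<in>cat_hom C A B. \<forall>g\<in>cat_hom C B D.
        cat_comp C A B D g f \<in> cat_hom C A D) \<and>
     (\<forall>A\<in>cat_obj C. \<forall>B\<in>cat_obj C. \<forall>f\<in>cat_hom C A B.
        cat_comp C A A B f (cat_id C A) = f \<and> cat_comp C A B B (cat_id C B) f = f) \<and>
     (\<forall>A\<in>cat_obj C. \<forall>B\<in>cat_obj C. \<forall>D\<in>cat_obj C. \<forall>E\<in>cat_obj C.
        \<forall>f\<in>cat_hom C A B. \<forall>g\<in>cat_hom C B D. \<forall>h\<in>cat_hom C D E.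
        cat_comp C A D E h (cat_comp C A B D g f) = cat_comp C A B E (cat_comp C B D E h g) f)"

definition op_cat :: "('o, 'm) cat \<Rightarrow> ('o, 'm) cat" where
  "op_cat C =
     \<lparr>cat_obj = cat_obj C,
      cat_hom = (\<lambda>A B. cat_hom C B A),
      cat_id = cat_id C,
      cat_comp = (\<lambda>A B D g f. cat_comp C D B A f g)\<rparr>"

definition cat_iso :: "('o, 'm) cat \<Rightarrow> 'o \<Rightarrow> 'o \<Rightarrow> 'm \<Rightarrow> bool" where
  "cat_iso C A B f \<longleftrightarrow> f \<in> cat_hom C A B \<and>
     (\<exists>g\<in>cat_hom C B A. cat_comp C A B A g f = cat_id C A \<and> cat_comp C B A B f g = cat_id C B)"

record ('o, 'm, 'p, 'k) fctr =
  f_obj :: "'o \<Rightarrow> 'p"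
  f_mor :: "'o \<Rightarrow> 'o \<Rightarrow> 'm \<Rightarrow> 'k"

definition is_functor ::
  "('o, 'm) cat \<Rightarrow> ('p, 'k) cat \<Rightarrow> ('o, 'm, 'p, 'k) fctr \<Rightarrow> bool" where
  "is_functor C D F \<longleftrightarrow>
     (\<forall>A\<in>cat_obj C. f_obj F A \<in> cat_obj D) \<and>
     (\<forall>A\<in>cat_obj C. \<forall>B\<in>cat_obj C. \<forall>f\<in>cat_hom C A B.
        f_mor F A B f \<in> cat_hom D (f_obj F A) (f_obj F B)) \<and>
     (\<forall>A\<in>cat_obj C. f_mor F A A (cat_id C A) = cat_id D (f_obj F A)) \<and>
     (\<forall>A\<in>cat_obj C. \<forall>B\<in>cat_obj C. \<forall>E\<in>cat_obj C. \<forall>f\<in>cat_hom C A B. \<forall>g\<in>cat_hom C B E.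
        f_mor F A E (cat_comp C A B E g f) =
        cat_comp D (f_obj F A) (f_obj F B) (f_obj F E) (f_mor F B E g) (f_mor F A B f))"

definition id_fctr :: "('o, 'm, 'o, 'm) fctr" where
  "id_fctr = \<lparr>f_obj = (\<lambda>A. A), f_mor = (\<lambda>A B f. f)\<rparr>"

definition comp_fctr ::
  "('p, 'k, 'q, 'l) fctr \<Rightarrow> ('o, 'm, 'p, 'k) fctr \<Rightarrow> ('o, 'm, 'q, 'l) fctr" where
  "comp_fctr G F =
     \<lparr>f_obj = (\<lambda>A. f_obj G (f_obj F A)),
      f_mor = (\<lambda>A B f. f_mor G (f_obj F A) (f_obj F B) (f_mor F A B f))\<rparr>"

definition naturally_isomorphic ::
  "('o, 'm) cat \<Rightarrow> ('p, 'k) cat \<Rightarrow> ('o, 'm, 'p, 'k) fctr \<Rightarrow> ('o, 'm, 'p, 'k) fctr \<Rightarrow> bool" where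
  "naturally_isomorphic C D F G \<longleftrightarrow>
     (\<exists>\<eta>. (\<forall>A\<in>cat_obj C. cat_iso D (f_obj F A) (f_obj G A) (\<eta> A)) \<and>
          (\<forall>A\<in>cat_obj C. \<forall>B\<in>cat_obj C. \<forall>f\<in>cat_hom C A B.
             cat_comp D (f_obj F A) (f_obj G A) (f_obj G B) (f_mor G A B f) (\<eta> A) =
             cat_comp D (f_obj F A) (f_obj F B) (f_obj G B) (\<eta> B) (f_mor F A B f)))"

definition equivalent_categories :: "('o, 'm) cat \<Rightarrow> ('p, 'k) cat \<Rightarrow> bool" where
  "equivalent_categories C D \<longleftrightarrow> is_category C \<and> is_category D \<and>
     (\<exists>F G. is_functor C D F \<and> is_functor D C G \<and>
            naturally_isomorphic C C id_fctr (comp_fctr G F) \<and>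
            naturally_isomorphic D D (comp_fctr F G) id_fctr)"


section \<open>MV-algebras\<close>

record 'a mv =
  mv_carrier :: "'a set"
  mv_plus :: "'a \<Rightarrow> 'a \<Rightarrow> 'a"
  mv_neg :: "'a \<Rightarrow> 'a"
  mv_zero :: "'a"

datatype mv_term = Var nat | Zero | Plus mv_term mv_term | Neg mv_term

primrec mv_eval :: "('a, 'z) mv_scheme \<Rightarrow> (nat \<Rightarrow> 'a) \<Rightarrow> mv_term \<Rightarrow> 'a" where
  "mv_eval A v (Var i) = v i"
| "mv_eval A v Zero = mv_zero A"
| "mv_eval A v (Plus s t) = mv_plus A (mv_eval A v s) (mv_eval A v t)"
| "mv_eval A v (Neg s) = mv_neg A (mv_eval A v s)"

definition standard_mv :: "real mv" where
  "standard_mv = \<lparr>mv_carrier = {0..1}, mv_plus = (\<lambda>x y. min 1 (x + y)),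
                  mv_neg = (\<lambda>x. 1 - x), mv_zero = 0\<rparr>"

definition satisfies :: "('a, 'z) mv_scheme \<Rightarrow> mv_term \<Rightarrow> mv_term \<Rightarrow> bool" where
  "satisfies A s t \<longleftrightarrow> (\<forall>v. range v \<subseteq> mv_carrier A \<longrightarrow> mv_eval A v s = mv_eval A v t)"

text \<open>The variety generated by \<open>[0,1]\<close> is the class of algebras satisfying all identities
  that hold in \<open>[0,1]\<close>.\<close>

definition mv_algebra :: "('a, 'z) mv_scheme \<Rightarrow> bool" where
  "mv_algebra A \<longleftrightarrow>
     mv_zero A \<in> mv_carrier A \<and>
     (\<forall>x\<in>mv_carrier A. mv_neg A x \<in> mv_carrier A) \<and>
     (\<forall>x\<in>mv_carrier A. \<forall>y\<in>mv_carrier A. mv_plus A x y \<in> mv_carrier A) \<and>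
     (\<forall>s t. satisfies standard_mv s t \<longrightarrow> satisfies A s t)"

text \<open>Homomorphisms are extensional, so that equality of homomorphisms is equality of HOL
  functions.\<close>

definition mv_hom :: "('a, 'y) mv_scheme \<Rightarrow> ('b, 'z) mv_scheme \<Rightarrow> ('a \<Rightarrow> 'b) set" where
  "mv_hom A B = {\<sigma> \<in> mv_carrier A \<rightarrow>\<^sub>E mv_carrier B.
     \<sigma> (mv_zero A) = mv_zero B \<and>
     (\<forall>x\<in>mv_carrier A. \<sigma> (mv_neg A x) = mv_neg B (\<sigma> x)) \<and>
     (\<forall>x\<in>mv_carrier A. \<forall>y\<in>mv_carrier A. \<sigma> (mv_plus A x y) = mv_plus B (\<sigma> x) (\<sigma> y))}"

definition mv_isomorphic :: "('a, 'y) mv_scheme \<Rightarrow> ('b, 'z) mv_scheme \<Rightarrow> bool" where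
  "mv_isomorphic A B \<longleftrightarrow> (\<exists>\<sigma>\<in>mv_hom A B. bij_betw \<sigma> (mv_carrier A) (mv_carrier B))"

definition mv_le :: "('a, 'z) mv_scheme \<Rightarrow> 'a \<Rightarrow> 'a \<Rightarrow> bool" where
  "mv_le A x y \<longleftrightarrow> mv_plus A (mv_neg A x) y = mv_neg A (mv_zero A)"

definition mv_ideal :: "('a, 'z) mv_scheme \<Rightarrow> 'a set \<Rightarrow> bool" where
  "mv_ideal A I \<longleftrightarrow> I \<subseteq> mv_carrier A \<and> mv_zero A \<in> I \<and>
     (\<forall>x\<in>I. \<forall>y\<in>I. mv_plus A x y \<in> I) \<and>
     (\<forall>x\<in>mv_carrier A. \<forall>y\<in>I. mv_le A x y \<longrightarrow> x \<in> I)"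

definition principal_mv_ideal :: "('a, 'z) mv_scheme \<Rightarrow> 'a \<Rightarrow> 'a set" where
  "principal_mv_ideal A a = \<Inter>{I. mv_ideal A I \<and> a \<in> I}"

definition mv_minus :: "('a, 'z) mv_scheme \<Rightarrow> 'a \<Rightarrow> 'a \<Rightarrow> 'a" where
  "mv_minus A x y = mv_neg A (mv_plus A (mv_neg A x) y)"

definition mv_dist :: "('a, 'z) mv_scheme \<Rightarrow> 'a \<Rightarrow> 'a \<Rightarrow> 'a" where
  "mv_dist A x y = mv_plus A (mv_minus A x y) (mv_minus A y x)"

definition mv_cong :: "('a, 'z) mv_scheme \<Rightarrow> 'a set \<Rightarrow> ('a \<times> 'a) set" where
  "mv_cong A I = {(x, y). x \<in> mv_carrier A \<and> y \<in> mv_carrier A \<and> mv_dist A x y \<in> I}"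

definition mv_quotient :: "('a, 'z) mv_scheme \<Rightarrow> 'a set \<Rightarrow> 'a set mv" where
  "mv_quotient A I =
     \<lparr>mv_carrier = mv_carrier A // mv_cong A I,
      mv_plus = (\<lambda>X Y. \<Union>x\<in>X. \<Union>y\<in>Y. mv_cong A I `` {mv_plus A x y}),
      mv_neg = (\<lambda>X. \<Union>x\<in>X. mv_cong A I `` {mv_neg A x}),
      mv_zero = mv_cong A I `` {mv_zero A}\<rparr>"


section \<open>Piecewise linear functions\<close>

text \<open>\<open>\<real>\<^sup>n\<close> is the set of \<open>x :: nat \<Rightarrow> real\<close> with \<open>x i = 0\<close> for all
  \<open>i \<ge> n\<close>, as in \<open>Euclidean_space n\<close> of \<open>HOL-Analysis\<close>; coordinates are
  numbered from \<open>0\<close>. The product topology on \<open>nat \<Rightarrow> real\<close> induces the usual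
  topology on it.\<close>

definition cube :: "nat \<Rightarrow> (nat \<Rightarrow> real) set" where
  "cube n = {x. (\<forall>i<n. 0 \<le> x i \<and> x i \<le> 1) \<and> (\<forall>i\<ge>n. x i = 0)}"

text \<open>\<open>pl_funs K n\<close>: unital piecewise linear functions on \<open>[0,1]\<^sup>n\<close> with
  coefficients in \<open>K\<close>; a pair \<open>(c, b)\<close> stands for
  \<open>x \<mapsto> c\<^sub>0 x\<^sub>0 + \<dots> + c\<^sub>n\<^sub>-\<^sub>1 x\<^sub>n\<^sub>-\<^sub>1 + b\<close>.\<close>

definition pl_funs :: "real set \<Rightarrow> nat \<Rightarrow> ((nat \<Rightarrow> real) \<Rightarrow> real) set" where
  "pl_funs K n = {f \<in> cube n \<rightarrow>\<^sub>E {0..1}. continuous_on (cube n) f \<and>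
     (\<exists>L :: ((nat \<Rightarrow> real) \<times> real) set. finite L \<and>
        (\<forall>(c, b)\<in>L. (\<forall>i<n. c i \<in> K) \<and> b \<in> K) \<and>
        (\<forall>x\<in>cube n. \<exists>(c, b)\<in>L. f x = (\<Sum>i<n. c i * x i) + b))}"

abbreviation "RMV \<equiv> pl_funs UNIV"
abbreviation "DMV \<equiv> pl_funs \<rat>"
abbreviation "MV \<equiv> pl_funs \<int>"

definition restrictions ::
  "('a \<Rightarrow> real) set \<Rightarrow> 'a set \<Rightarrow> ('a \<Rightarrow> real) set" (infixl "|\<^sub>r" 90) where
  "F |\<^sub>r P = (\<lambda>g. restrict g P) ` F"

definition coord_proj :: "(nat \<Rightarrow> real) set \<Rightarrow> nat \<Rightarrow> (nat \<Rightarrow> real) \<Rightarrow> real" where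
  "coord_proj P i = (\<lambda>x\<in>P. x i)"

definition function_mv :: "'a set \<Rightarrow> ('a \<Rightarrow> real) set \<Rightarrow> ('a \<Rightarrow> real) mv" where
  "function_mv P F =
     \<lparr>mv_carrier = F,
      mv_plus = (\<lambda>f g. \<lambda>x\<in>P. min 1 (f x + g x)),
      mv_neg = (\<lambda>f. \<lambda>x\<in>P. 1 - f x),
      mv_zero = (\<lambda>x\<in>P. 0)\<rparr>"

text \<open>MV-algebras with scalar multiplication. The set \<open>S\<close> of scalars that belong to the
  signature is \<open>{0..1}\<close> for Riesz MV-algebras and \<open>{0..1} \<inter> \<rat>\<close> for DMV-algebras;
  \<open>mv_scale\<close> is irrelevant for other scalars.\<close>

record 'a scalar_mv = "'a mv" + mv_scale :: "real \<Rightarrow> 'a \<Rightarrow> 'a"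

definition function_scalar_mv :: "'a set \<Rightarrow> ('a \<Rightarrow> real) set \<Rightarrow> ('a \<Rightarrow> real) scalar_mv" where
  "function_scalar_mv P F =
     mv.extend (function_mv P F) \<lparr>mv_scale = (\<lambda>r f. \<lambda>x\<in>P. r * f x)\<rparr>"

definition scalar_mv_hom :: "real set \<Rightarrow> 'a scalar_mv \<Rightarrow> 'b scalar_mv \<Rightarrow> ('a \<Rightarrow> 'b) set" where
  "scalar_mv_hom S A B = {\<sigma> \<in> mv_hom A B.
     \<forall>r\<in>S. \<forall>x\<in>mv_carrier A. \<sigma> (mv_scale A r x) = mv_scale B r (\<sigma> x)}"

abbreviation "riesz_mv_hom \<equiv> scalar_mv_hom {0..1}"
abbreviation "dmv_hom \<equiv> scalar_mv_hom ({0..1} \<inter> \<rat>)"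


section \<open>Rational polyhedra\<close>

instantiation "fun" :: (type, real_vector) real_vector
begin

definition scaleR_fun :: "real \<Rightarrow> ('a \<Rightarrow> 'b) \<Rightarrow> 'a \<Rightarrow> 'b" where
  "scaleR_fun r f = (\<lambda>x. r *\<^sub>R f x)"

instance
  by standard (simp_all add: scaleR_fun_def fun_eq_iff scaleR_add_right scaleR_add_left)

end

definition rational_simplex :: "nat \<Rightarrow> (nat \<Rightarrow> real) set \<Rightarrow> bool" where
  "rational_simplex n S \<longleftrightarrow>
     (\<exists>V. finite V \<and> V \<noteq> {} \<and> \<not> affine_dependent V \<and>
          (\<forall>v\<in>V. (\<forall>i<n. v i \<in> \<rat>) \<and> (\<forall>i\<ge>n. v i = 0)) \<and> S = convex hull V)"

definition rational_polyhedron :: "nat \<Rightarrow> (nat \<Rightarrow> real) set \<Rightarrow> bool" where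
  "rational_polyhedron n P \<longleftrightarrow> (\<exists>\<S>. finite \<S> \<and> (\<forall>S\<in>\<S>. rational_simplex n S) \<and> P = \<Union>\<S>)"

text \<open>A pair \<open>(n, P)\<close> is the rational polyhedron \<open>P\<close> as a subset of \<open>[0,1]\<^sup>n\<close>:
  with the present encoding of \<open>\<real>\<^sup>n\<close>, the set \<open>P\<close> does not determine \<open>n\<close>.\<close>

type_synonym polyhedron = "nat \<times> (nat \<Rightarrow> real) set"

definition unit_polyhedra :: "polyhedron set" where
  "unit_polyhedra = {(n, P). rational_polyhedron n P \<and> P \<subseteq> cube n}"

definition Z_maps :: "polyhedron \<Rightarrow> polyhedron \<Rightarrow> ((nat \<Rightarrow> real) \<Rightarrow> nat \<Rightarrow> real) set" where
  "Z_maps = (\<lambda>(n, P) (m, Q). {z \<in> P \<rightarrow>\<^sub>E Q. \<forall>i<m. (\<lambda>x\<in>P. z x i) \<in> MV n |\<^sub>r P})"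


section \<open>The four categories\<close>

definition RatPol :: "(polyhedron, (nat \<Rightarrow> real) \<Rightarrow> nat \<Rightarrow> real) cat" where
  "RatPol =
     \<lparr>cat_obj = unit_polyhedra,
      cat_hom = Z_maps,
      cat_id = (\<lambda>X. \<lambda>x\<in>snd X. x),
      cat_comp = (\<lambda>X Y Z g f. compose (snd X) g f)\<rparr>"

definition finitely_presented :: "'u mv \<Rightarrow> bool" where
  "finitely_presented A \<longleftrightarrow> mv_algebra A \<and>
     (\<exists>n. \<exists>a\<in>MV n.
        mv_isomorphic A
          (mv_quotient (function_mv (cube n) (MV n))
             (principal_mv_ideal (function_mv (cube n) (MV n)) a)))"

text \<open>The type \<open>'u\<close> is the universe in which the carriers live. Finitely presented
  MV-algebras are countable, so an infinite \<open>'u\<close> contains a copy of each of them.\<close>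

definition MV_fp :: "('u mv, 'u \<Rightarrow> 'u) cat" where
  "MV_fp =
     \<lparr>cat_obj = {A. finitely_presented A},
      cat_hom = mv_hom,
      cat_id = (\<lambda>A. \<lambda>x\<in>mv_carrier A. x),
      cat_comp = (\<lambda>A B D g f. compose (mv_carrier A) g f)\<rparr>"

definition DMV_alg :: "polyhedron \<Rightarrow> ((nat \<Rightarrow> real) \<Rightarrow> real) scalar_mv" where
  "DMV_alg = (\<lambda>(n, P). function_scalar_mv P (DMV n |\<^sub>r P))"

definition RMV_alg :: "polyhedron \<Rightarrow> ((nat \<Rightarrow> real) \<Rightarrow> real) scalar_mv" where
  "RMV_alg = (\<lambda>(n, P). function_scalar_mv P (RMV n |\<^sub>r P))"

definition integral_on_generators ::
  "polyhedron \<Rightarrow> polyhedron \<Rightarrow> (((nat \<Rightarrow> real) \<Rightarrow> real) \<Rightarrow> (nat \<Rightarrow> real) \<Rightarrow> real) \<Rightarrow> bool" where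
  "integral_on_generators =
     (\<lambda>(n, P) (m, Q) \<sigma>. \<forall>i<n. \<sigma> (coord_proj P i) \<in> MV m |\<^sub>r Q)"

text \<open>In the following two categories the condition on morphisms refers to polyhedra \<open>X\<close>,
  \<open>Y\<close> presenting the two algebras. It does not depend on their choice: an algebra determines
  the set \<open>P\<close>, and, if \<open>P\<close> lies in both \<open>cube n\<close> and \<open>cube n'\<close>, then
  \<open>MV n\<close> and \<open>MV n'\<close> have the same restrictions to \<open>P\<close> and the additional
  coordinates vanish on \<open>P\<close>.\<close>

definition DMV_fp_c' ::
  "(((nat \<Rightarrow> real) \<Rightarrow> real) scalar_mv, ((nat \<Rightarrow> real) \<Rightarrow> real) \<Rightarrow> (nat \<Rightarrow> real) \<Rightarrow> real) cat" where
  "DMV_fp_c' =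
     \<lparr>cat_obj = DMV_alg ` unit_polyhedra,
      cat_hom = (\<lambda>A B. {\<sigma> \<in> dmv_hom A B.
        \<exists>X\<in>unit_polyhedra. \<exists>Y\<in>unit_polyhedra.
          A = DMV_alg X \<and> B = DMV_alg Y \<and> integral_on_generators X Y \<sigma>}),
      cat_id = (\<lambda>A. \<lambda>f\<in>mv_carrier A. f),
      cat_comp = (\<lambda>A B D \<tau> \<sigma>. compose (mv_carrier A) \<tau> \<sigma>)\<rparr>"

definition RMV_fp_c' ::
  "(((nat \<Rightarrow> real) \<Rightarrow> real) scalar_mv, ((nat \<Rightarrow> real) \<Rightarrow> real) \<Rightarrow> (nat \<Rightarrow> real) \<Rightarrow> real) cat" where
  "RMV_fp_c' =
     \<lparr>cat_obj = RMV_alg ` unit_polyhedra,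
      cat_hom = (\<lambda>A B. {\<sigma> \<in> riesz_mv_hom A B.
        \<exists>X\<in>unit_polyhedra. \<exists>Y\<in>unit_polyhedra.
          A = RMV_alg X \<and> B = RMV_alg Y \<and> integral_on_generators X Y \<sigma>}),
      cat_id = (\<lambda>A. \<lambda>f\<in>mv_carrier A. f),
      cat_comp = (\<lambda>A B D \<tau> \<sigma>. compose (mv_carrier A) \<tau> \<sigma>)\<rparr>"

end

theory Submission
  imports Defs
begin

text \<open>
  A homomorphism from the function algebra of a compact set to \<open>[0,1]\<close> is evaluation at a point: by
  compactness its kernel has a common zero, and truncations of \<open>k f + m\<close> are terms in \<open>f\<close>, so
  vanishing of the kernel already forces equality of values. Hence a homomorphism of
  function algebras \<open>K\<^sub>n|\<^sub>P \<rightarrow> K\<^sub>m|\<^sub>Q\<close> that is integral on the generators is composition with a unique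
  integral map \<open>Q \<rightarrow> P\<close>, whatever the ring \<open>K\<close> of coefficients. It remains to identify the finitely
  presented MV-algebras with the algebras \<open>MV\<^sub>n|\<^sub>P\<close>. The cube is a finite union of rational polytopes
  on which two given piecewise linear functions are affine; looking at their vertices shows that the zero
  set of \<open>a\<close> is a rational polyhedron and that a function vanishing on it is at most a
  multiple of \<open>a\<close>, i.e. lies in the ideal of \<open>a\<close>. Conversely, elimination describes
  a rational simplex by finitely many integral inequalities, whose truncations add up to a function vanishing
  exactly there.
\<close>

section \<open>Equivalences of categories\<close>

text \<open>The definition of \<open>pl_funs\<close> provides finitely many affine forms but no
  decomposition of the cube. The bridge is a fact about segments: for any two points of the cube,
  some form is at least the function at the first point and at most the function at the second. It
  yields both the cells, on which the order of the forms is fixed, and a max-min formula, which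
  shows that \<open>MV n\<close> is countable. Countability lets every algebra
  \<open>MV n |\<^sub>r P\<close> be copied into the infinite type on which \<open>MV_fp\<close> is
  built.

  Integrality on generators is a genuine condition over the rationals and the reals: on the unit
  interval, composition with halving is an endomorphism of the DMV-algebra that comes from no
  integral map. Over the integers it holds automatically, which is why the homomorphisms of
  \<open>MV_fp\<close> carry no such condition.

  One set may lie in cubes of several dimensions, so distinct polyhedra can have equal function
  algebras, and the functor to function algebras is not injective on objects. The comparison
  therefore works with fully faithful, essentially surjective functors, all starting from
  \<open>op_cat RatPol\<close>.\<close>

lemma cat_idI: "is_category C \<Longrightarrow> A \<in> cat_obj C \<Longrightarrow> cat_id C A \<in> cat_hom C A A"
  by (simp add: is_category_def)

lemma cat_compI:
  "is_category C \<Longrightarrow> A \<in> cat_obj C \<Longrightarrow> B \<in> cat_obj C \<Longrightarrow> D \<in> cat_obj C \<Longrightarrow>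
   f \<in> cat_hom C A B \<Longrightarrow> g \<in> cat_hom C B D \<Longrightarrow> cat_comp C A B D g f \<in> cat_hom C A D"
  by (simp add: is_category_def)

lemma cat_comp_id_right:
  "is_category C \<Longrightarrow> A \<in> cat_obj C \<Longrightarrow> B \<in> cat_obj C \<Longrightarrow> f \<in> cat_hom C A B \<Longrightarrow>
   cat_comp C A A B f (cat_id C A) = f"
  by (simp add: is_category_def)

lemma cat_comp_id_left:
  "is_category C \<Longrightarrow> A \<in> cat_obj C \<Longrightarrow> B \<in> cat_obj C \<Longrightarrow> f \<in> cat_hom C A B \<Longrightarrow>
   cat_comp C A B B (cat_id C B) f = f"
  by (simp add: is_category_def)

lemma cat_comp_assoc:
  "is_category C \<Longrightarrow> A \<in> cat_obj C \<Longrightarrow> B \<in> cat_obj C \<Longrightarrow> D \<in> cat_obj C \<Longrightarrow> E \<in> cat_obj C \<Longrightarrow>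
   f \<in> cat_hom C A B \<Longrightarrow> g \<in> cat_hom C B D \<Longrightarrow> h \<in> cat_hom C D E \<Longrightarrow>
   cat_comp C A B E (cat_comp C B D E h g) f = cat_comp C A D E h (cat_comp C A B D g f)"
  by (simp add: is_category_def)

lemma functor_obj: "is_functor C D F \<Longrightarrow> A \<in> cat_obj C \<Longrightarrow> f_obj F A \<in> cat_obj D"
  by (simp add: is_functor_def)

lemma functor_mor:
  "is_functor C D F \<Longrightarrow> A \<in> cat_obj C \<Longrightarrow> B \<in> cat_obj C \<Longrightarrow> f \<in> cat_hom C A B \<Longrightarrow>
   f_mor F A B f \<in> cat_hom D (f_obj F A) (f_obj F B)"
  by (simp add: is_functor_def)

lemma functor_id:
  "is_functor C D F \<Longrightarrow> A \<in> cat_obj C \<Longrightarrow> f_mor F A A (cat_id C A) = cat_id D (f_obj F A)"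
  by (simp add: is_functor_def)

lemma functor_comp:
  "is_functor C D F \<Longrightarrow> A \<in> cat_obj C \<Longrightarrow> B \<in> cat_obj C \<Longrightarrow> E \<in> cat_obj C \<Longrightarrow>
   f \<in> cat_hom C A B \<Longrightarrow> g \<in> cat_hom C B E \<Longrightarrow>
   f_mor F A E (cat_comp C A B E g f) =
   cat_comp D (f_obj F A) (f_obj F B) (f_obj F E) (f_mor F B E g) (f_mor F A B f)"
  by (simp add: is_functor_def)

lemma cat_iso_id:
  assumes "is_category C" "A \<in> cat_obj C"
  shows "cat_iso C A A (cat_id C A)"
  using assms by (auto simp: cat_iso_def cat_idI cat_comp_id_left intro!: bexI[of _ "cat_id C A"])

text \<open>Fully faithful and essentially surjective. In this form an equivalence can be checked
  without exhibiting a quasi-inverse, and composites are easy; quasi-inverses and natural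
  isomorphisms are supplied once for all functors below.\<close>

definition equivalence_functor ::
  "('o, 'm) cat \<Rightarrow> ('p, 'k) cat \<Rightarrow> ('o, 'm, 'p, 'k) fctr \<Rightarrow> bool" where
  "equivalence_functor C D F \<longleftrightarrow> is_functor C D F \<and>
     (\<forall>A\<in>cat_obj C. \<forall>B\<in>cat_obj C.
        bij_betw (f_mor F A B) (cat_hom C A B) (cat_hom D (f_obj F A) (f_obj F B))) \<and>
     (\<forall>Y\<in>cat_obj D. \<exists>A\<in>cat_obj C. \<exists>e. cat_iso D (f_obj F A) Y e)"

lemma equivalence_functor_id:
  assumes "is_category C"
  shows "equivalence_functor C C id_fctr"
  using cat_iso_id[OF assms]
  by (auto simp: equivalence_functor_def id_fctr_def is_functor_def bij_betw_def)

lemma functor_comp_fctr: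
  assumes "is_functor C D F" "is_functor D E G"
  shows "is_functor C E (comp_fctr G F)"
  using assms unfolding is_functor_def comp_fctr_def by auto

lemma functor_cat_iso:
  assumes F: "is_functor C D F" and A: "A \<in> cat_obj C" "B \<in> cat_obj C" and "cat_iso C A B f"
  shows "cat_iso D (f_obj F A) (f_obj F B) (f_mor F A B f)"
proof -
  obtain g where f: "f \<in> cat_hom C A B" and g: "g \<in> cat_hom C B A"
    "cat_comp C A B A g f = cat_id C A" "cat_comp C B A B f g = cat_id C B"
    using assms(4) by (auto simp: cat_iso_def)
  show ?thesis
    unfolding cat_iso_def
    using functor_comp[OF F A(1,2,1) f g(1)] functor_comp[OF F A(2,1,2) g(1) f]
      functor_mor[OF F A f] functor_mor[OF F A(2,1) g(1)] functor_id[OF F A(1)] functor_id[OF F A(2)] g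
    by auto
qed

lemma cat_iso_trans:
  assumes C: "is_category C" and obj: "A \<in> cat_obj C" "B \<in> cat_obj C" "D \<in> cat_obj C"
    and "cat_iso C A B f" "cat_iso C B D g"
  shows "cat_iso C A D (cat_comp C A B D g f)"
proof -
  obtain f' where f: "f \<in> cat_hom C A B" "f' \<in> cat_hom C B A"
    "cat_comp C A B A f' f = cat_id C A" "cat_comp C B A B f f' = cat_id C B"
    using assms(5) by (auto simp: cat_iso_def)
  obtain g' where g: "g \<in> cat_hom C B D" "g' \<in> cat_hom C D B"
    "cat_comp C B D B g' g = cat_id C B" "cat_comp C D B D g g' = cat_id C D"
    using assms(6) by (auto simp: cat_iso_def)
  have gf: "cat_comp C A B D g f \<in> cat_hom C A D" and f'g': "cat_comp C D B A f' g' \<in> cat_hom C D A"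
    using C obj f g by (auto intro: cat_compI)
  have "cat_comp C A D A (cat_comp C D B A f' g') (cat_comp C A B D g f) =
    cat_comp C A B A f' (cat_comp C A D B g' (cat_comp C A B D g f))"
    using C obj f g gf by (intro cat_comp_assoc) auto
  also have "cat_comp C A D B g' (cat_comp C A B D g f) = f"
    using C obj f g cat_comp_assoc[OF C obj(1,2,3,2) f(1) g(1,2)] by (simp add: cat_comp_id_left)
  finally have 1: "cat_comp C A D A (cat_comp C D B A f' g') (cat_comp C A B D g f) = cat_id C A"
    using f by simp
  have "cat_comp C D A D (cat_comp C A B D g f) (cat_comp C D B A f' g') =
    cat_comp C D B D g (cat_comp C D A B f (cat_comp C D B A f' g'))"
    using C obj f g f'g' by (intro cat_comp_assoc) auto
  also have "cat_comp C D A B f (cat_comp C D B A f' g') = g'"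
    using C obj f g cat_comp_assoc[OF C obj(3,2,1,2) g(2) f(2,1)] by (simp add: cat_comp_id_left)
  finally have 2: "cat_comp C D A D (cat_comp C A B D g f) (cat_comp C D B A f' g') = cat_id C D"
    using g by simp
  show ?thesis
    unfolding cat_iso_def using gf f'g' 1 2 by auto
qed

lemma equivalence_functor_comp:
  assumes E: "is_category E" and F: "equivalence_functor C D F" and G: "equivalence_functor D E G"
  shows "equivalence_functor C E (comp_fctr G F)"
proof -
  have FF: "is_functor C D F" and GF: "is_functor D E G"
    using F G by (auto simp: equivalence_functor_def)
  show ?thesis
    unfolding equivalence_functor_def
  proof (intro conjI ballI)
    show "is_functor C E (comp_fctr G F)"
      using FF GF by (rule functor_comp_fctr)
    fix A B assume AB: "A \<in> cat_obj C" "B \<in> cat_obj C"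
    have "f_mor (comp_fctr G F) A B = f_mor G (f_obj F A) (f_obj F B) \<circ> f_mor F A B"
      by (auto simp: comp_fctr_def)
    moreover have "bij_betw (f_mor F A B) (cat_hom C A B) (cat_hom D (f_obj F A) (f_obj F B))"
      using F AB by (simp add: equivalence_functor_def)
    moreover have "bij_betw (f_mor G (f_obj F A) (f_obj F B)) (cat_hom D (f_obj F A) (f_obj F B))
       (cat_hom E (f_obj G (f_obj F A)) (f_obj G (f_obj F B)))"
      using G functor_obj[OF FF AB(1)] functor_obj[OF FF AB(2)] by (simp add: equivalence_functor_def)
    ultimately show "bij_betw (f_mor (comp_fctr G F) A B) (cat_hom C A B)
       (cat_hom E (f_obj (comp_fctr G F) A) (f_obj (comp_fctr G F) B))"
      by (simp add: comp_fctr_def bij_betw_trans)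
  next
    fix Y assume Y: "Y \<in> cat_obj E"
    obtain B e where B: "B \<in> cat_obj D" "cat_iso E (f_obj G B) Y e"
      using G Y by (auto simp: equivalence_functor_def)
    obtain A d where A: "A \<in> cat_obj C" "cat_iso D (f_obj F A) B d"
      using F B by (auto simp: equivalence_functor_def)
    have "cat_iso E (f_obj G (f_obj F A)) (f_obj G B) (f_mor G (f_obj F A) B d)"
      using functor_cat_iso[OF GF functor_obj[OF FF A(1)] B(1) A(2)] .
    from cat_iso_trans[OF E _ _ Y this B(2)]
    show "\<exists>A\<in>cat_obj C. \<exists>e. cat_iso E (f_obj (comp_fctr G F) A) Y e"
      using A(1) B(1) functor_obj[OF GF] functor_obj[OF FF A(1)]
      by (auto simp: comp_fctr_def)
  qed
qed

text \<open>Choose for each \<open>Y\<close> an object \<open>g Y\<close> with an isomorphism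
  \<open>e Y\<close> from its image to \<open>Y\<close>, conjugate morphisms by these isomorphisms
  and pull them back through the bijections on hom-sets. That \<open>G\<close> is again an
  \<open>equivalence_functor\<close> allows it to be composed with a further equivalence.\<close>

lemma equivalence_functor_quasi_inverse:
  assumes C: "is_category C" and D: "is_category D" and F: "equivalence_functor C D F"
  shows "\<exists>G. equivalence_functor D C G \<and>
    naturally_isomorphic C C id_fctr (comp_fctr G F) \<and>
    naturally_isomorphic D D (comp_fctr F G) id_fctr"
proof -
  have FF: "is_functor C D F"
    and bij: "\<And>A B. A \<in> cat_obj C \<Longrightarrow> B \<in> cat_obj C \<Longrightarrow>
        bij_betw (f_mor F A B) (cat_hom C A B) (cat_hom D (f_obj F A) (f_obj F B))"
    and es: "\<And>Y. Y \<in> cat_obj D \<Longrightarrow> \<exists>A\<in>cat_obj C. \<exists>e. cat_iso D (f_obj F A) Y e"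
    using F by (auto simp: equivalence_functor_def)
  define Fo where "Fo = f_obj F"
  define Fm where "Fm = f_mor F"
  note Fobj = functor_obj[OF FF, folded Fo_def] and Fmor = functor_mor[OF FF, folded Fo_def Fm_def]
    and Fid = functor_id[OF FF, folded Fo_def Fm_def] and Fcomp = functor_comp[OF FF, folded Fo_def Fm_def]
    and bij = bij[folded Fo_def Fm_def]
  have "\<forall>Y\<in>cat_obj D. \<exists>A e e'. A \<in> cat_obj C \<and> e \<in> cat_hom D (Fo A) Y \<and> e' \<in> cat_hom D Y (Fo A) \<and>
     cat_comp D (Fo A) Y (Fo A) e' e = cat_id D (Fo A) \<and> cat_comp D Y (Fo A) Y e e' = cat_id D Y"
    using es unfolding cat_iso_def Fo_def by blast
  then obtain g e e' where
    g: "\<And>Y. Y \<in> cat_obj D \<Longrightarrow> g Y \<in> cat_obj C" and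
    e: "\<And>Y. Y \<in> cat_obj D \<Longrightarrow> e Y \<in> cat_hom D (Fo (g Y)) Y" and
    e': "\<And>Y. Y \<in> cat_obj D \<Longrightarrow> e' Y \<in> cat_hom D Y (Fo (g Y))" and
    e'e: "\<And>Y. Y \<in> cat_obj D \<Longrightarrow> cat_comp D (Fo (g Y)) Y (Fo (g Y)) (e' Y) (e Y) = cat_id D (Fo (g Y))" and
    ee': "\<And>Y. Y \<in> cat_obj D \<Longrightarrow> cat_comp D Y (Fo (g Y)) Y (e Y) (e' Y) = cat_id D Y"
    by metis
  have Fg: "\<And>Y. Y \<in> cat_obj D \<Longrightarrow> Fo (g Y) \<in> cat_obj D"
    using g Fobj by auto
  note compI = cat_compI[OF D] and assoc = cat_comp_assoc[OF D]
    and idl = cat_comp_id_left[OF D] and idr = cat_comp_id_right[OF D]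
  have cancel_e'e: "cat_comp D A Y (Fo (g Y)) (e' Y) (cat_comp D A (Fo (g Y)) Y (e Y) h) = h"
    if "A \<in> cat_obj D" "Y \<in> cat_obj D" "h \<in> cat_hom D A (Fo (g Y))" for A Y h
    using that assoc[OF that(1) Fg[OF that(2)] that(2) Fg[OF that(2)] that(3) e[OF that(2)] e'[OF that(2)]]
    by (simp add: e'e idl Fg)
  have cancel_ee': "cat_comp D A (Fo (g Y)) Y (e Y) (cat_comp D A Y (Fo (g Y)) (e' Y) h) = h"
    if "A \<in> cat_obj D" "Y \<in> cat_obj D" "h \<in> cat_hom D A Y" for A Y h
    using that assoc[OF that(1) that(2) Fg[OF that(2)] that(2) that(3) e'[OF that(2)] e[OF that(2)]]
    by (simp add: ee' idl Fg)
  \<comment> \<open>\<open>T Y Y' h\<close> is \<open>h\<close> conjugated to a morphism between the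
    chosen images: \<open>e Y\<close>, then \<open>h\<close>, then \<open>e' Y'\<close>.\<close>
  define T where "T = (\<lambda>Y Y' h. cat_comp D (Fo (g Y)) Y (Fo (g Y')) (cat_comp D Y Y' (Fo (g Y')) (e' Y') h) (e Y))"
  have T: "T Y Y' h \<in> cat_hom D (Fo (g Y)) (Fo (g Y'))"
    if "Y \<in> cat_obj D" "Y' \<in> cat_obj D" "h \<in> cat_hom D Y Y'" for Y Y' h
    unfolding T_def using that by (intro compI) (auto simp: Fg e e')
  have eT: "cat_comp D (Fo (g Y)) (Fo (g Y')) Y' (e Y') (T Y Y' h) = cat_comp D (Fo (g Y)) Y Y' h (e Y)"
    if "Y \<in> cat_obj D" "Y' \<in> cat_obj D" "h \<in> cat_hom D Y Y'" for Y Y' h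
  proof -
    have "T Y Y' h = cat_comp D (Fo (g Y)) Y' (Fo (g Y')) (e' Y') (cat_comp D (Fo (g Y)) Y Y' h (e Y))"
      unfolding T_def using that by (intro assoc) (auto simp: Fg e e')
    then show ?thesis
      using that by (simp add: cancel_ee' Fg compI e)
  qed
  have Te': "cat_comp D Y (Fo (g Y)) (Fo (g Y')) (T Y Y' h) (e' Y) = cat_comp D Y Y' (Fo (g Y')) (e' Y') h"
    if "Y \<in> cat_obj D" "Y' \<in> cat_obj D" "h \<in> cat_hom D Y Y'" for Y Y' h
  proof -
    have "cat_comp D Y (Fo (g Y)) (Fo (g Y')) (T Y Y' h) (e' Y) =
       cat_comp D Y Y (Fo (g Y')) (cat_comp D Y Y' (Fo (g Y')) (e' Y') h) (cat_comp D Y (Fo (g Y)) Y (e Y) (e' Y))"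
      unfolding T_def using that by (intro assoc) (auto simp: Fg e e' intro: compI)
    then show ?thesis
      using that by (simp add: ee' idr Fg compI e')
  qed
  \<comment> \<open>\<open>e Y'\<close> cancels on the left, so \<open>T Y Y' h\<close> is the only
    morphism that makes the naturality square of \<open>e\<close> commute. Compatibility of
    \<open>G\<close> with identities and composition is read off from this uniqueness.\<close>
  have T_eqI: "k = T Y Y' h"
    if Y: "Y \<in> cat_obj D" "Y' \<in> cat_obj D" and h: "h \<in> cat_hom D Y Y'" and
      k: "k \<in> cat_hom D (Fo (g Y)) (Fo (g Y'))"
      "cat_comp D (Fo (g Y)) (Fo (g Y')) Y' (e Y') k = cat_comp D (Fo (g Y)) Y Y' h (e Y)" for Y Y' h k
    using cancel_e'e[OF Fg[OF Y(1)] Y(2) k(1)] cancel_e'e[OF Fg[OF Y(1)] Y(2) T[OF Y h]] eT[OF Y h] k(2) by simp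
  define Gm where "Gm = (\<lambda>Y Y' h. inv_into (cat_hom C (g Y) (g Y')) (Fm (g Y) (g Y')) (T Y Y' h))"
  have Gm: "Gm Y Y' h \<in> cat_hom C (g Y) (g Y')" and FGm: "Fm (g Y) (g Y') (Gm Y Y' h) = T Y Y' h"
    if "Y \<in> cat_obj D" "Y' \<in> cat_obj D" "h \<in> cat_hom D Y Y'" for Y Y' h
  proof -
    have "T Y Y' h \<in> Fm (g Y) (g Y') ` cat_hom C (g Y) (g Y')"
      using bij[of "g Y" "g Y'"] T[OF that] that g by (simp add: bij_betw_def)
    then show "Gm Y Y' h \<in> cat_hom C (g Y) (g Y')" "Fm (g Y) (g Y') (Gm Y Y' h) = T Y Y' h"
      unfolding Gm_def by (auto simp: inv_into_into f_inv_into_f)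
  qed
  have inj: "f = f'" if "A \<in> cat_obj C" "B \<in> cat_obj C" "f \<in> cat_hom C A B" "f' \<in> cat_hom C A B"
     "Fm A B f = Fm A B f'" for A B f f'
    using bij[OF that(1,2)] that by (auto simp: bij_betw_def dest: inj_onD)
  have surj: "\<exists>f\<in>cat_hom C A B. Fm A B f = k" if "A \<in> cat_obj C" "B \<in> cat_obj C"
     "k \<in> cat_hom D (Fo A) (Fo B)" for A B k
    using bij[OF that(1,2)] that(3) by (force simp: bij_betw_def)
  define G where "G = \<lparr>f_obj = g, f_mor = Gm\<rparr>"
  have Gid: "Gm Y Y (cat_id D Y) = cat_id C (g Y)" if Y: "Y \<in> cat_obj D" for Y
  proof (rule inj)
    show "Fm (g Y) (g Y) (Gm Y Y (cat_id D Y)) = Fm (g Y) (g Y) (cat_id C (g Y))"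
      unfolding FGm[OF Y Y cat_idI[OF D Y]] Fid[OF g[OF Y]]
      using Y by (intro T_eqI[symmetric]) (auto simp: cat_idI[OF D] Fg idl idr e)
  qed (use Y in \<open>auto simp: g Gm cat_idI[OF D] cat_idI[OF C]\<close>)
  have Gcomp: "Gm Y Y'' (cat_comp D Y Y' Y'' k h) = cat_comp C (g Y) (g Y') (g Y'') (Gm Y' Y'' k) (Gm Y Y' h)"
    if Y: "Y \<in> cat_obj D" "Y' \<in> cat_obj D" "Y'' \<in> cat_obj D" and h: "h \<in> cat_hom D Y Y'"
      and k: "k \<in> cat_hom D Y' Y''" for Y Y' Y'' h k
  proof (rule inj)
    have "cat_comp D (Fo (g Y)) (Fo (g Y'')) Y'' (e Y'')
       (cat_comp D (Fo (g Y)) (Fo (g Y')) (Fo (g Y'')) (T Y' Y'' k) (T Y Y' h)) =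
       cat_comp D (Fo (g Y)) (Fo (g Y')) Y'' (cat_comp D (Fo (g Y')) (Fo (g Y'')) Y'' (e Y'') (T Y' Y'' k)) (T Y Y' h)"
      using Y h k by (intro assoc[symmetric]) (auto simp: Fg T e)
    also have "\<dots> = cat_comp D (Fo (g Y)) (Fo (g Y')) Y'' (cat_comp D (Fo (g Y')) Y' Y'' k (e Y')) (T Y Y' h)"
      using Y k by (simp add: eT)
    also have "\<dots> = cat_comp D (Fo (g Y)) Y' Y'' k (cat_comp D (Fo (g Y)) (Fo (g Y')) Y' (e Y') (T Y Y' h))"
      using Y h k by (intro assoc) (auto simp: Fg T e)
    also have "\<dots> = cat_comp D (Fo (g Y)) Y' Y'' k (cat_comp D (Fo (g Y)) Y Y' h (e Y))"
      using Y h by (simp add: eT)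
    also have "\<dots> = cat_comp D (Fo (g Y)) Y Y'' (cat_comp D Y Y' Y'' k h) (e Y)"
      using Y h k by (intro assoc[symmetric]) (auto simp: Fg T e)
    finally have "cat_comp D (Fo (g Y)) (Fo (g Y')) (Fo (g Y'')) (T Y' Y'' k) (T Y Y' h) =
       T Y Y'' (cat_comp D Y Y' Y'' k h)"
      using Y h k by (intro T_eqI) (auto simp: Fg T e intro: compI)
    then show "Fm (g Y) (g Y'') (Gm Y Y'' (cat_comp D Y Y' Y'' k h)) =
      Fm (g Y) (g Y'') (cat_comp C (g Y) (g Y') (g Y'') (Gm Y' Y'' k) (Gm Y Y' h))"
      using Y h k by (simp add: FGm Fcomp g Gm compI)
  qed (use Y h k in \<open>auto simp: g intro!: Gm compI cat_compI[OF C]\<close>)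
  have GF: "is_functor D C G"
    unfolding is_functor_def G_def by (auto simp: g Gm Gid Gcomp)
  have Gbij: "bij_betw (Gm Y Y') (cat_hom D Y Y') (cat_hom C (g Y) (g Y'))"
    if Y: "Y \<in> cat_obj D" "Y' \<in> cat_obj D" for Y Y'
  proof (rule bij_betw_imageI)
    show "inj_on (Gm Y Y') (cat_hom D Y Y')"
    proof (rule inj_onI)
      fix h k assume hk: "h \<in> cat_hom D Y Y'" "k \<in> cat_hom D Y Y'" "Gm Y Y' h = Gm Y Y' k"
      then have "T Y Y' h = T Y Y' k"
        using FGm[OF Y] by metis
      then have "cat_comp D Y Y' (Fo (g Y')) (e' Y') h = cat_comp D Y Y' (Fo (g Y')) (e' Y') k"
        using Te'[OF Y] hk by metis
      then show "h = k"
        using cancel_ee'[OF Y] hk by metis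
    qed
    show "Gm Y Y' ` cat_hom D Y Y' = cat_hom C (g Y) (g Y')"
    proof (intro subset_antisym subsetI)
      fix f assume f: "f \<in> cat_hom C (g Y) (g Y')"
      let ?f = "Fm (g Y) (g Y') f"
      have Ff: "?f \<in> cat_hom D (Fo (g Y)) (Fo (g Y'))"
        using Fmor[OF g g f] Y by simp
      \<comment> \<open>The conjugation undone: \<open>e' Y\<close>, then the image of
        \<open>f\<close>, then \<open>e Y'\<close>.\<close>
      let ?h = "cat_comp D Y (Fo (g Y)) Y' (cat_comp D (Fo (g Y)) (Fo (g Y')) Y' (e Y') ?f) (e' Y)"
      have ef: "cat_comp D (Fo (g Y)) (Fo (g Y')) Y' (e Y') ?f \<in> cat_hom D (Fo (g Y)) Y'"
        using Y Ff by (auto intro!: compI e Fg)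
      have h: "?h \<in> cat_hom D Y Y'"
        using Y Ff by (auto intro!: compI e e' Fg)
      have "cat_comp D (Fo (g Y)) Y Y' ?h (e Y) = cat_comp D (Fo (g Y)) (Fo (g Y)) Y'
         (cat_comp D (Fo (g Y)) (Fo (g Y')) Y' (e Y') ?f) (cat_comp D (Fo (g Y)) Y (Fo (g Y)) (e' Y) (e Y))"
        using Y ef by (intro assoc) (auto intro!: e e' Fg)
      also have "\<dots> = cat_comp D (Fo (g Y)) (Fo (g Y')) Y' (e Y') ?f"
        using Y ef by (simp add: e'e idr Fg)
      finally have "?f = T Y Y' ?h"
        using Y h Ff by (intro T_eqI) auto
      then have "f = Gm Y Y' ?h"
        using f Y h by (intro inj[of "g Y" "g Y'"]) (auto simp: g Gm FGm)
      then show "f \<in> Gm Y Y' ` cat_hom D Y Y'"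
        using h by blast
    qed (use Y Gm in auto)
  qed
  \<comment> \<open>The unit at \<open>A\<close> is the preimage of \<open>e' (Fo A)\<close> under
    the functor, and its inverse is the preimage of \<open>e (Fo A)\<close>. The equations they have
    to satisfy hold after applying the functor, which is injective on hom-sets.\<close>
  have "\<forall>A\<in>cat_obj C. \<exists>f\<in>cat_hom C A (g (Fo A)). Fm A (g (Fo A)) f = e' (Fo A)"
    using surj g e' Fobj by auto
  then obtain \<eta> where \<eta>: "\<And>A. A \<in> cat_obj C \<Longrightarrow> \<eta> A \<in> cat_hom C A (g (Fo A))"
    "\<And>A. A \<in> cat_obj C \<Longrightarrow> Fm A (g (Fo A)) (\<eta> A) = e' (Fo A)"
    by metis
  have "\<forall>A\<in>cat_obj C. \<exists>f\<in>cat_hom C (g (Fo A)) A. Fm (g (Fo A)) A f = e (Fo A)"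
    using surj g e Fobj by auto
  then obtain \<theta> where \<theta>: "\<And>A. A \<in> cat_obj C \<Longrightarrow> \<theta> A \<in> cat_hom C (g (Fo A)) A"
    "\<And>A. A \<in> cat_obj C \<Longrightarrow> Fm (g (Fo A)) A (\<theta> A) = e (Fo A)"
    by metis
  have \<eta>\<theta>: "cat_comp C (g (Fo A)) A (g (Fo A)) (\<eta> A) (\<theta> A) = cat_id C (g (Fo A))"
    "cat_comp C A (g (Fo A)) A (\<theta> A) (\<eta> A) = cat_id C A" if A: "A \<in> cat_obj C" for A
  proof -
    show "cat_comp C (g (Fo A)) A (g (Fo A)) (\<eta> A) (\<theta> A) = cat_id C (g (Fo A))"
      by (rule inj[of "g (Fo A)" "g (Fo A)"])
        (use A in \<open>auto simp: g Fobj Fcomp \<eta> \<theta> Fid e'e intro: cat_compI[OF C] cat_idI[OF C]\<close>)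
    show "cat_comp C A (g (Fo A)) A (\<theta> A) (\<eta> A) = cat_id C A"
      by (rule inj[of A A])
        (use A in \<open>auto simp: g Fobj Fcomp \<eta> \<theta> Fid ee' intro: cat_compI[OF C] cat_idI[OF C]\<close>)
  qed
  have iso_\<eta>: "cat_iso C A (g (Fo A)) (\<eta> A)" and iso_\<theta>: "cat_iso C (g (Fo A)) A (\<theta> A)"
    if "A \<in> cat_obj C" for A
    unfolding cat_iso_def using that \<eta>(1) \<theta>(1) \<eta>\<theta> by blast+
  have "equivalence_functor D C G"
    unfolding equivalence_functor_def
  proof (intro conjI ballI)
    fix A assume "A \<in> cat_obj C"
    then show "\<exists>Y\<in>cat_obj D. \<exists>e. cat_iso C (f_obj G Y) A e"
      using iso_\<theta>[of A] Fobj[of A] by (auto simp: G_def)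
  qed (use GF Gbij in \<open>auto simp: G_def\<close>)
  moreover have "naturally_isomorphic C C id_fctr (comp_fctr G F)"
    unfolding naturally_isomorphic_def
  proof (intro exI[of _ \<eta>] conjI ballI)
    fix A assume "A \<in> cat_obj C"
    then show "cat_iso C (f_obj id_fctr A) (f_obj (comp_fctr G F) A) (\<eta> A)"
      using iso_\<eta> by (simp add: id_fctr_def comp_fctr_def G_def Fo_def)
  next
    fix A B f assume A: "A \<in> cat_obj C" and B: "B \<in> cat_obj C" and f: "f \<in> cat_hom C A B"
    have "cat_comp C A (g (Fo A)) (g (Fo B)) (Gm (Fo A) (Fo B) (Fm A B f)) (\<eta> A) =
       cat_comp C A B (g (Fo B)) (\<eta> B) f"
      by (rule inj[of A "g (Fo B)"])
        (use A B f in \<open>auto simp: g Fobj Fcomp \<eta> Gm Fmor FGm Te' intro!: cat_compI[OF C]\<close>)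
    then show "cat_comp C (f_obj id_fctr A) (f_obj (comp_fctr G F) A) (f_obj (comp_fctr G F) B)
         (f_mor (comp_fctr G F) A B f) (\<eta> A) =
        cat_comp C (f_obj id_fctr A) (f_obj id_fctr B) (f_obj (comp_fctr G F) B) (\<eta> B) (f_mor id_fctr A B f)"
      by (simp add: id_fctr_def comp_fctr_def G_def Fo_def Fm_def)
  qed
  moreover have "naturally_isomorphic D D (comp_fctr F G) id_fctr"
    unfolding naturally_isomorphic_def
  proof (intro exI[of _ e] conjI ballI)
    fix Y assume "Y \<in> cat_obj D"
    then show "cat_iso D (f_obj (comp_fctr F G) Y) (f_obj id_fctr Y) (e Y)"
      unfolding cat_iso_def using e[of Y] e'[of Y] ee'[of Y] e'e[of Y]
      by (auto simp: id_fctr_def comp_fctr_def G_def Fo_def intro!: bexI[of _ "e' Y"])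
  next
    fix Y Y' h assume "Y \<in> cat_obj D" "Y' \<in> cat_obj D" "h \<in> cat_hom D Y Y'"
    then show "cat_comp D (f_obj (comp_fctr F G) Y) (f_obj id_fctr Y) (f_obj id_fctr Y') (f_mor id_fctr Y Y' h) (e Y) =
       cat_comp D (f_obj (comp_fctr F G) Y) (f_obj (comp_fctr F G) Y') (f_obj id_fctr Y') (e Y') (f_mor (comp_fctr F G) Y Y' h)"
      using eT[of Y Y' h] FGm[of Y Y' h] by (simp add: id_fctr_def comp_fctr_def G_def Fo_def Fm_def)
  qed
  ultimately show ?thesis by blast
qed

text \<open>A quasi-inverse of \<open>F\<close> followed by \<open>H\<close> is an equivalence from
  \<open>C\<close> to \<open>D\<close>, and a second use of the quasi-inverse lemma provides the
  natural isomorphisms. So one source category with an equivalence to each of the others settles all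
  pairs.\<close>

lemma equivalent_categories_span:
  assumes E: "is_category E" and C: "is_category C" and D: "is_category D"
    and F: "equivalence_functor E C F" and H: "equivalence_functor E D H"
  shows "equivalent_categories C D"
proof -
  obtain G where G: "equivalence_functor C E G"
    using equivalence_functor_quasi_inverse[OF E C F] by blast
  have "equivalence_functor C D (comp_fctr H G)"
    using D G H by (rule equivalence_functor_comp)
  with equivalence_functor_quasi_inverse[OF C D this] show ?thesis
    unfolding equivalent_categories_def equivalence_functor_def using C D by blast
qed

lemma is_category_op:
  assumes "is_category C"
  shows "is_category (op_cat C)"
  using assms unfolding is_category_def op_cat_def by simp

section \<open>Piecewise linear functions\<close>

text \<open>As in \<open>pl_funs\<close>, a pair \<open>(c, b)\<close> stands for an affine form; only the coefficients
  below \<open>n\<close> matter.\<close>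

definition aff :: "nat \<Rightarrow> (nat \<Rightarrow> real) \<times> real \<Rightarrow> (nat \<Rightarrow> real) \<Rightarrow> real" where
  "aff n p x = (\<Sum>i<n. fst p i * x i) + snd p"

definition forms :: "real set \<Rightarrow> nat \<Rightarrow> ((nat \<Rightarrow> real) \<times> real) set" where
  "forms K n = {p. (\<forall>i<n. fst p i \<in> K) \<and> snd p \<in> K}"

definition pieces :: "real set \<Rightarrow> nat \<Rightarrow> ((nat \<Rightarrow> real) \<Rightarrow> real) \<Rightarrow> ((nat \<Rightarrow> real) \<times> real) set \<Rightarrow> bool" where
  "pieces K n f L \<longleftrightarrow> finite L \<and> L \<subseteq> forms K n \<and> (\<forall>x\<in>cube n. \<exists>p\<in>L. f x = aff n p x)"

lemma pl_funs_iff: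
  "f \<in> pl_funs K n \<longleftrightarrow> f \<in> cube n \<rightarrow>\<^sub>E {0..1} \<and> continuous_on (cube n) f \<and> (\<exists>L. pieces K n f L)"
proof -
  have "L \<subseteq> forms K n \<longleftrightarrow> (\<forall>(c, b)\<in>L. (\<forall>i<n. c i \<in> K) \<and> b \<in> K)" for L
    by (force simp: forms_def)
  moreover have "(\<exists>p\<in>L. f x = aff n p x) \<longleftrightarrow> (\<exists>(c, b)\<in>L. f x = (\<Sum>i<n. c i * x i) + b)" for L x
    by (simp add: aff_def case_prod_beta)
  ultimately show ?thesis
    unfolding pl_funs_def pieces_def by simp
qed

lemma piecesI:
  assumes "finite L" "L \<subseteq> forms K n" "\<And>x. x \<in> cube n \<Longrightarrow> \<exists>p\<in>L. f x = aff n p x"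
  shows "pieces K n f L"
  using assms by (auto simp: pieces_def)

lemma pl_funsE:
  assumes "f \<in> pl_funs K n"
  obtains L where "finite L" "L \<subseteq> forms K n" "\<And>x. x \<in> cube n \<Longrightarrow> \<exists>p\<in>L. f x = aff n p x"
    "continuous_on (cube n) f" "f \<in> cube n \<rightarrow>\<^sub>E {0..1}"
  using assms by (auto simp: pl_funs_iff pieces_def)

lemma pl_funs_bounds: "f \<in> pl_funs K n \<Longrightarrow> x \<in> cube n \<Longrightarrow> 0 \<le> f x \<and> f x \<le> 1"
  by (auto simp: pl_funs_iff PiE_iff)

lemma continuous_on_coord: "continuous_on S (\<lambda>x::nat \<Rightarrow> real. x i)"
  using continuous_on_product_coordinates by (rule continuous_on_subset) simp

lemma continuous_on_aff: "continuous_on S (aff n p)"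
  unfolding aff_def by (intro continuous_intros continuous_on_coord)

lemma aff_scale: "aff n (\<lambda>i. r * fst p i, r * snd p) x = r * aff n p x"
  by (simp add: aff_def sum_distrib_left algebra_simps)

lemma aff_add: "aff n (\<lambda>i. fst p i + fst q i, snd p + snd q) x = aff n p x + aff n q x"
  by (simp add: aff_def sum.distrib algebra_simps)

lemma aff_const: "aff n (\<lambda>i. 0, b) x = b"
  by (simp add: aff_def)

text \<open>Treats the three coefficient rings uniformly. Closure under negation follows, because
  \<open>-1\<close> lies in \<open>\<int>\<close>.\<close>

definition unital_subring :: "real set \<Rightarrow> bool" where
  "unital_subring K \<longleftrightarrow> \<int> \<subseteq> K \<and> (\<forall>x\<in>K. \<forall>y\<in>K. x + y \<in> K \<and> x * y \<in> K)"

lemma unital_subring_instances: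
  "unital_subring UNIV" "unital_subring \<rat>" "unital_subring \<int>"
  by (auto simp: unital_subring_def Ints_subset_Rats)

section \<open>Operations on piecewise linear functions over a coefficient ring\<close>

context
  fixes K :: "real set"
  assumes K: "unital_subring K"
begin

lemma K_int: "x \<in> \<int> \<Longrightarrow> x \<in> K"
  using K by (auto simp: unital_subring_def)

lemma K_closed: "x \<in> K \<Longrightarrow> y \<in> K \<Longrightarrow> x + y \<in> K" "x \<in> K \<Longrightarrow> y \<in> K \<Longrightarrow> x * y \<in> K"
  "0 \<in> K" "1 \<in> K" "x \<in> K \<Longrightarrow> - x \<in> K" "x \<in> K \<Longrightarrow> y \<in> K \<Longrightarrow> x - y \<in> K"
proof -
  show *: "x \<in> K \<Longrightarrow> y \<in> K \<Longrightarrow> x + y \<in> K" "x \<in> K \<Longrightarrow> y \<in> K \<Longrightarrow> x * y \<in> K" for x y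
    using K by (auto simp: unital_subring_def)
  show "0 \<in> K" "1 \<in> K"
    by (auto intro: K_int)
  show **: "x \<in> K \<Longrightarrow> - x \<in> K" for x
    using *(2)[of "-1" x] K_int[of "-1"] by simp
  show "x \<in> K \<Longrightarrow> y \<in> K \<Longrightarrow> x - y \<in> K"
    using *(1)[of x "-y"] ** by simp
qed

lemma K_sum: "(\<And>i. i \<in> I \<Longrightarrow> f i \<in> K) \<Longrightarrow> sum f I \<in> K"
  by (induction I rule: infinite_finite_induct) (auto intro: K_closed)

lemma pl_funs_mono_int: "MV n \<subseteq> pl_funs K n"
proof
  fix f :: "(nat \<Rightarrow> real) \<Rightarrow> real" assume "f \<in> MV n"
  moreover have "forms \<int> n \<subseteq> forms K n"
    using K_int by (auto simp: forms_def)
  ultimately show "f \<in> pl_funs K n"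
    unfolding pl_funs_iff pieces_def by blast
qed

lemma pl_funs_neg:
  assumes "f \<in> pl_funs K n"
  shows "(\<lambda>x\<in>cube n. 1 - f x) \<in> pl_funs K n"
proof -
  obtain L where L: "finite L" "L \<subseteq> forms K n" "\<And>x. x \<in> cube n \<Longrightarrow> \<exists>p\<in>L. f x = aff n p x"
    "continuous_on (cube n) f" "f \<in> cube n \<rightarrow>\<^sub>E {0..1}"
    using pl_funsE[OF assms] by blast
  let ?n = "\<lambda>p. (\<lambda>i. - fst p i, 1 - snd p)"
  have n: "aff n (?n p) x = 1 - aff n p x" for p :: "(nat \<Rightarrow> real) \<times> real" and x
    by (simp add: aff_def sum_negf)
  have "pieces K n (\<lambda>x\<in>cube n. 1 - f x) (?n ` L)"
  proof (rule piecesI)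
    show "?n ` L \<subseteq> forms K n"
      using L(2) by (auto simp: forms_def K_closed)
    show "\<exists>p\<in>?n ` L. (\<lambda>x\<in>cube n. 1 - f x) x = aff n p x" if "x \<in> cube n" for x
      using L(3)[OF that] that by (auto simp: n)
  qed (use L in auto)
  moreover have "continuous_on (cube n) (\<lambda>x\<in>cube n. 1 - f x)"
    using L(4) by (auto intro!: continuous_intros cong: continuous_on_cong)
  ultimately show ?thesis
    using L(5) by (auto simp: pl_funs_iff PiE_iff)
qed

lemma pl_funs_plus:
  assumes "f \<in> pl_funs K n" "g \<in> pl_funs K n"
  shows "(\<lambda>x\<in>cube n. min 1 (f x + g x)) \<in> pl_funs K n"
proof -
  obtain L where L: "finite L" "L \<subseteq> forms K n" "\<And>x. x \<in> cube n \<Longrightarrow> \<exists>p\<in>L. f x = aff n p x"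
    "continuous_on (cube n) f" "f \<in> cube n \<rightarrow>\<^sub>E {0..1}"
    using pl_funsE[OF assms(1)] by blast
  obtain M where M: "finite M" "M \<subseteq> forms K n" "\<And>x. x \<in> cube n \<Longrightarrow> \<exists>p\<in>M. g x = aff n p x"
    "continuous_on (cube n) g" "g \<in> cube n \<rightarrow>\<^sub>E {0..1}"
    using pl_funsE[OF assms(2)] by blast
  let ?N = "insert (\<lambda>i. 0, 1) ((\<lambda>(p, q). (\<lambda>i. fst p i + fst q i, snd p + snd q)) ` (L \<times> M))"
  have "pieces K n (\<lambda>x\<in>cube n. min 1 (f x + g x)) ?N"
  proof (rule piecesI)
    show "?N \<subseteq> forms K n"
      using L(2) M(2) by (auto simp: forms_def K_closed subset_iff)
    fix x assume x: "x \<in> cube n"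
    obtain p q where pq: "p \<in> L" "f x = aff n p x" "q \<in> M" "g x = aff n q x"
      using L(3)[OF x] M(3)[OF x] by blast
    show "\<exists>r\<in>?N. (\<lambda>x\<in>cube n. min 1 (f x + g x)) x = aff n r x"
    proof (cases "f x + g x \<le> 1")
      case True
      then have "(\<lambda>x\<in>cube n. min 1 (f x + g x)) x = aff n (\<lambda>i. fst p i + fst q i, snd p + snd q) x"
        using x pq by (simp add: aff_add)
      then show ?thesis
        using pq by (intro bexI[of _ "(\<lambda>i. fst p i + fst q i, snd p + snd q)"]) auto
    next
      case False
      then show ?thesis
        using x by (intro bexI[of _ "(\<lambda>i. 0, 1)"]) (auto simp: aff_const)
    qed
  qed (use L M in auto)
  moreover have "continuous_on (cube n) (\<lambda>x\<in>cube n. min 1 (f x + g x))"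
    using L(4) M(4) by (auto intro!: continuous_intros cong: continuous_on_cong)
  ultimately show ?thesis
    using L(5) M(5) by (auto simp: pl_funs_iff PiE_iff)
qed

lemma pl_funs_min:
  assumes "f \<in> pl_funs K n" "g \<in> pl_funs K n"
  shows "(\<lambda>x\<in>cube n. min (f x) (g x)) \<in> pl_funs K n"
proof -
  obtain L where L: "finite L" "L \<subseteq> forms K n" "\<And>x. x \<in> cube n \<Longrightarrow> \<exists>p\<in>L. f x = aff n p x"
    "continuous_on (cube n) f" "f \<in> cube n \<rightarrow>\<^sub>E {0..1}"
    using pl_funsE[OF assms(1)] by blast
  obtain M where M: "finite M" "M \<subseteq> forms K n" "\<And>x. x \<in> cube n \<Longrightarrow> \<exists>p\<in>M. g x = aff n p x"
    "continuous_on (cube n) g" "g \<in> cube n \<rightarrow>\<^sub>E {0..1}"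
    using pl_funsE[OF assms(2)] by blast
  have "pieces K n (\<lambda>x\<in>cube n. min (f x) (g x)) (L \<union> M)"
  proof (rule piecesI)
    fix x assume x: "x \<in> cube n"
    show "\<exists>r\<in>L \<union> M. (\<lambda>x\<in>cube n. min (f x) (g x)) x = aff n r x"
      using L(3)[OF x] M(3)[OF x] x by (auto simp: min_def)
  qed (use L M in auto)
  moreover have "continuous_on (cube n) (\<lambda>x\<in>cube n. min (f x) (g x))"
    using L(4) M(4) by (auto intro!: continuous_intros cong: continuous_on_cong)
  ultimately show ?thesis
    using L(5) M(5) by (auto simp: pl_funs_iff PiE_iff)
qed

text \<open>Truncated affine forms are the building blocks: constants and coordinates are special
  cases, and their zero sets are the half-spaces of the cube.\<close>

lemma pl_funs_clip:
  assumes "p \<in> forms K n"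
  shows "(\<lambda>x\<in>cube n. max 0 (min 1 (aff n p x))) \<in> pl_funs K n"
proof -
  have "pieces K n (\<lambda>x\<in>cube n. max 0 (min 1 (aff n p x))) {p, (\<lambda>i. 0, 0), (\<lambda>i. 0, 1)}"
  proof (rule piecesI)
    show "{p, (\<lambda>i. 0, 0), (\<lambda>i. 0, 1)} \<subseteq> forms K n"
      using assms by (auto simp: forms_def K_closed)
  qed (auto simp: aff_const max_def min_def)
  moreover have "continuous_on (cube n) (\<lambda>x\<in>cube n. max 0 (min 1 (aff n p x)))"
    by (auto intro!: continuous_intros continuous_on_aff cong: continuous_on_cong)
  ultimately show ?thesis
    by (auto simp: pl_funs_iff PiE_iff)
qed

lemma pl_funs_scale:
  assumes "f \<in> pl_funs K n" "r \<in> K" "0 \<le> r" "r \<le> 1"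
  shows "(\<lambda>x\<in>cube n. r * f x) \<in> pl_funs K n"
proof -
  obtain L where L: "finite L" "L \<subseteq> forms K n" "\<And>x. x \<in> cube n \<Longrightarrow> \<exists>p\<in>L. f x = aff n p x"
    "continuous_on (cube n) f" "f \<in> cube n \<rightarrow>\<^sub>E {0..1}"
    using pl_funsE[OF assms(1)] by blast
  have "pieces K n (\<lambda>x\<in>cube n. r * f x) ((\<lambda>p. (\<lambda>i. r * fst p i, r * snd p)) ` L)"
  proof (rule piecesI)
    show "(\<lambda>p. (\<lambda>i. r * fst p i, r * snd p)) ` L \<subseteq> forms K n"
      using L(2) assms by (auto simp: forms_def K_closed)
    show "\<exists>p\<in>(\<lambda>p. (\<lambda>i. r * fst p i, r * snd p)) ` L. (\<lambda>x\<in>cube n. r * f x) x = aff n p x" if "x \<in> cube n" for x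
      using L(3)[OF that] that by (auto simp: aff_scale)
  qed (use L in auto)
  moreover have "continuous_on (cube n) (\<lambda>x\<in>cube n. r * f x)"
    using L(4) by (auto intro!: continuous_intros cong: continuous_on_cong)
  ultimately show ?thesis
    using L(5) assms by (auto simp: pl_funs_iff PiE_iff mult_le_one)
qed

lemma pl_funs_const:
  assumes "b \<in> K" "0 \<le> b" "b \<le> 1"
  shows "(\<lambda>x\<in>cube n. b) \<in> pl_funs K n"
proof -
  have "(\<lambda>i. 0, b) \<in> forms K n"
    using assms by (simp add: forms_def K_closed)
  from pl_funs_clip[OF this] show ?thesis
    using assms by (simp add: aff_const)
qed

lemma pl_funs_coord:
  assumes "i < n"
  shows "(\<lambda>x\<in>cube n. x i) \<in> pl_funs K n"
proof -
  let ?p = "(\<lambda>j. if j = i then 1 else 0, 0) :: (nat \<Rightarrow> real) \<times> real"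
  have "?p \<in> forms K n"
    by (simp add: forms_def K_closed)
  moreover have "aff n ?p x = x i" for x
    using assms by (simp add: aff_def if_distrib[of "\<lambda>t. t * _"] cong: if_cong)
  then have "(\<lambda>x\<in>cube n. max 0 (min 1 (aff n ?p x))) = (\<lambda>x\<in>cube n. x i)"
    using assms by (auto simp: cube_def max_def min_def fun_eq_iff)
  ultimately show ?thesis
    using pl_funs_clip by metis
qed

lemma pl_funs_compose:
  assumes g: "g \<in> pl_funs K m" and z: "\<And>i. i < m \<Longrightarrow> h i \<in> pl_funs K n"
  shows "(\<lambda>x\<in>cube n. g (\<lambda>i. if i < m then h i x else 0)) \<in> pl_funs K n"
proof -
  let ?z = "\<lambda>x i. if i < m then h i x else 0"
  obtain L where L: "finite L" "L \<subseteq> forms K m" "\<And>x. x \<in> cube m \<Longrightarrow> \<exists>p\<in>L. g x = aff m p x"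
    "continuous_on (cube m) g" "g \<in> cube m \<rightarrow>\<^sub>E {0..1}"
    using pl_funsE[OF g] by blast
  have zc: "?z x \<in> cube m" if "x \<in> cube n" for x
    using pl_funs_bounds[OF z that] by (auto simp: cube_def)
  have "\<forall>i\<in>{..<m}. \<exists>M. pieces K n (h i) M"
    using z by (auto simp: pl_funs_iff)
  then obtain M where M: "\<And>i. i < m \<Longrightarrow> pieces K n (h i) (M i)"
    by (metis lessThan_iff)
  \<comment> \<open>The form that results from substituting the forms \<open>t i\<close> for the
    variables of \<open>p\<close>. A piece of the composite is thus a piece of \<open>g\<close>
    together with one piece of each \<open>h i\<close>, which leaves finitely many.\<close>
  let ?c = "\<lambda>(p, t). (\<lambda>j. \<Sum>i<m. fst p i * fst (t i) j, (\<Sum>i<m. fst p i * snd (t i)) + snd p)"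
  let ?N = "?c ` (L \<times> PiE {..<m} M)"
  have c: "aff n (?c (p, t)) x = aff m p y" if "\<And>i. i < m \<Longrightarrow> y i = aff n (t i) x" for p t x y
  proof -
    have "aff m p y = (\<Sum>i<m. fst p i * ((\<Sum>j<n. fst (t i) j * x j) + snd (t i))) + snd p"
      by (simp add: aff_def that)
    also have "\<dots> = (\<Sum>i<m. \<Sum>j<n. fst p i * fst (t i) j * x j) + (\<Sum>i<m. fst p i * snd (t i)) + snd p"
      by (simp add: distrib_left sum.distrib sum_distrib_left mult.assoc)
    also have "(\<Sum>i<m. \<Sum>j<n. fst p i * fst (t i) j * x j) = (\<Sum>j<n. \<Sum>i<m. fst p i * fst (t i) j * x j)"
      by (rule sum.swap)
    finally show ?thesis
      by (simp add: aff_def sum_distrib_right)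
  qed
  have "pieces K n (\<lambda>x\<in>cube n. g (?z x)) ?N"
  proof (rule piecesI)
    show "finite ?N"
      using L(1) M by (intro finite_imageI finite_cartesian_product finite_PiE) (auto simp: pieces_def)
    show "?N \<subseteq> forms K n"
    proof
      fix q assume "q \<in> ?N"
      then obtain p t where q: "q = ?c (p, t)" "p \<in> L" "t \<in> PiE {..<m} M"
        by blast
      have "t i \<in> forms K n" if "i < m" for i
      proof -
        have "t i \<in> M i"
          using q(3) that by auto
        then show ?thesis
          using M[OF that] by (auto simp: pieces_def)
      qed
      moreover have "p \<in> forms K m"
        using q L by auto
      ultimately show "q \<in> forms K n"
        unfolding q(1) forms_def by (auto intro!: K_closed K_sum)
    qed
    fix x assume x: "x \<in> cube n"
    obtain p where p: "p \<in> L" "g (?z x) = aff m p (?z x)"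
      using L(3)[OF zc[OF x]] by blast
    have "\<forall>i\<in>{..<m}. \<exists>q. q \<in> M i \<and> h i x = aff n q x"
      using M x by (simp add: pieces_def Bex_def)
    from bchoice[OF this] obtain t where t: "\<And>i. i < m \<Longrightarrow> t i \<in> M i \<and> h i x = aff n (t i) x"
      by auto
    have "g (?z x) = aff n (?c (p, restrict t {..<m})) x"
      unfolding p(2) using t by (intro c[symmetric]) auto
    moreover have "?c (p, restrict t {..<m}) \<in> ?N"
      using p t by (intro imageI) auto
    ultimately show "\<exists>q\<in>?N. (\<lambda>x\<in>cube n. g (?z x)) x = aff n q x"
      unfolding restrict_apply'[OF x] by (rule bexI)
  qed
  moreover have "continuous_on (cube n) (\<lambda>x\<in>cube n. g (?z x))"
  proof -
    have "continuous_on (cube n) (\<lambda>x. ?z x i)" for i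
      using z[of i] by (cases "i < m") (auto simp: pl_funs_iff)
    then have "continuous_on (cube n) ?z"
      by (rule continuous_on_coordinatewise_then_product)
    then have "continuous_on (cube n) (\<lambda>x. g (?z x))"
      by (rule continuous_on_compose2[OF L(4)]) (use zc in auto)
    then show ?thesis
      by (simp cong: continuous_on_cong)
  qed
  ultimately show ?thesis
    using L(5) zc by (auto simp: pl_funs_iff PiE_iff)
qed

end

subsection \<open>Affine pieces along segments\<close>

lemma cube_segment:
  assumes "x \<in> cube n" "y \<in> cube n" "0 \<le> t" "t \<le> 1"
  shows "(\<lambda>i. (1 - t) * x i + t * y i) \<in> cube n"
proof -
  have "(1 - t) * x i + t * y i \<le> 1" if "i < n" for i
    using that assms convex_bound_le[of "x i" 1 "y i" "1 - t" t] by (auto simp: cube_def)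
  then show ?thesis
    using assms by (auto simp: cube_def)
qed

lemma aff_segment: "aff n p (\<lambda>i. (1 - t) * x i + t * y i) = (1 - t) * aff n p x + t * aff n p y"
  unfolding aff_def by (simp add: sum_distrib_left algebra_simps sum.distrib sum_subtractf)

lemma compact_closed_subset_real: "closed S \<Longrightarrow> S \<subseteq> {a..b::real} \<Longrightarrow> compact S"
  using closed_Int_compact[of S "{a..b}"] by (simp add: Int_absorb2)

text \<open>Induction on the number of pieces: take a piece active at \<open>a\<close> and the last point \<open>t\<close>
  where it is active; beyond \<open>t\<close> the remaining pieces suffice.\<close>

lemma affine_piece_two_points_real:
  fixes h :: "real \<Rightarrow> real" and L :: "(real \<times> real) set"
  assumes "finite L" "a \<le> b" "continuous_on {a..b} h"
    and "\<And>t. t \<in> {a..b} \<Longrightarrow> \<exists>l\<in>L. h t = fst l * t + snd l"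
  shows "\<exists>l\<in>L. h a \<le> fst l * a + snd l \<and> fst l * b + snd l \<le> h b"
  using assms
proof (induction "card L" arbitrary: L a)
  case 0
  then show ?case by force
next
  case (Suc k)
  obtain l where l: "l \<in> L" "h a = fst l * a + snd l"
    using Suc.prems(2) Suc.prems(4)[of a] by auto
  let ?T = "{t \<in> {a..b}. h t = fst l * t + snd l}"
  have "closed ({a..b} \<inter> (\<lambda>t. h t - (fst l * t + snd l)) -` {0})"
    by (intro continuous_closed_preimage continuous_intros Suc.prems)
  moreover have "{a..b} \<inter> (\<lambda>t. h t - (fst l * t + snd l)) -` {0} = ?T"
    by auto
  ultimately have "closed ?T"
    by metis
  then have "compact ?T"
    by (rule compact_closed_subset_real[of _ a b]) auto
  moreover have "?T \<noteq> {}"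
    using l Suc.prems(2) by auto
  ultimately have "\<exists>t\<in>?T. \<forall>s\<in>?T. s \<le> t"
    by (rule compact_attains_sup)
  then obtain t where t1: "t \<in> ?T" and t2: "\<forall>s\<in>?T. s \<le> t"
    by (rule bexE)
  note t = t1 bspec[OF t2]
  show ?case
  proof (cases "fst l * b + snd l \<le> h b")
    case True
    then show ?thesis using l by auto
  next
    case False
    then have "t < b"
      using t by (cases "t = b") auto
    have active: "\<exists>l'\<in>L - {l}. h s = fst l' * s + snd l'" if "s \<in> {t<..b}" for s
    proof -
      have "h s \<noteq> fst l * s + snd l"
        using t(2)[of s] t(1) that by auto
      then show ?thesis
        using Suc.prems(4)[of s] that t(1) by fastforce
    qed
    \<comment> \<open>At \<open>t\<close> itself \<open>l\<close> is active. But the points where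
      some other piece is active form a closed set that contains \<open>{t<..b}\<close>, hence also
      \<open>t\<close>.\<close>
    have "\<exists>l'\<in>L - {l}. h s = fst l' * s + snd l'" if s: "s \<in> {t..b}" for s
    proof (rule ccontr)
      let ?U = "\<Union>l'\<in>L - {l}. {s \<in> {t..b}. h s = fst l' * s + snd l'}"
      assume "\<not> ?thesis"
      then have "s \<notin> ?U" by blast
      have "continuous_on {t..b} h"
        using Suc.prems(3) by (rule continuous_on_subset) (use t(1) in auto)
      then have "closed ({t..b} \<inter> (\<lambda>s. h s - (fst l' * s + snd l')) -` {0})" for l' :: "real \<times> real"
        by (intro continuous_closed_preimage continuous_intros)
      moreover have "{t..b} \<inter> (\<lambda>s. h s - (fst l' * s + snd l')) -` {0} = {s \<in> {t..b}. h s = fst l' * s + snd l'}"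
        for l' :: "real \<times> real"
        by auto
      ultimately have "closed {s \<in> {t..b}. h s = fst l' * s + snd l'}" for l' :: "real \<times> real"
        by metis
      then have "closed ?U"
        using Suc.prems(1) by (intro closed_UN) auto
      moreover have "{t<..b} \<subseteq> ?U"
        using active by fastforce
      ultimately have "closure {t<..b} \<subseteq> ?U"
        by (simp add: closure_minimal)
      then have "s \<in> ?U"
        using s \<open>t < b\<close> by auto
      with \<open>s \<notin> ?U\<close> show False by simp
    qed
    moreover have "card (L - {l}) = k"
      using Suc.hyps(2) Suc.prems(1) l by simp
    moreover have "continuous_on {t..b} h"
      using Suc.prems(3) by (rule continuous_on_subset) (use t(1) in auto)
    ultimately obtain l' where l': "l' \<in> L" "h t \<le> fst l' * t + snd l'" "fst l' * b + snd l' \<le> h b"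
      using Suc.hyps(1)[of "L - {l}" t] Suc.prems(1) \<open>t < b\<close> by auto
    \<comment> \<open>The difference of \<open>l'\<close> and \<open>l\<close> is nonnegative at
      \<open>t\<close> and negative at \<open>b\<close>, so it is decreasing and nonnegative at
      \<open>a\<close> as well, where \<open>l\<close> agrees with \<open>h\<close>.\<close>
    have 1: "0 \<le> (fst l' - fst l) * t + (snd l' - snd l)" "(fst l' - fst l) * b + (snd l' - snd l) < 0"
      using l' t(1) False by (auto simp: algebra_simps)
    have "(fst l' - fst l) * (b - t) < 0"
      using 1 by (simp add: algebra_simps)
    then have "fst l' - fst l < 0"
      using \<open>t < b\<close> by (simp add: mult_less_0_iff)
    then have "(fst l' - fst l) * a \<ge> (fst l' - fst l) * t"
      using t(1) by (intro mult_left_mono_neg) auto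
    then have "h a \<le> fst l' * a + snd l'"
      using 1 l by (simp add: algebra_simps)
    then show ?thesis using l' by auto
  qed
qed

text \<open>Along the segment from \<open>x\<close> to \<open>y\<close> each form is an affine
  function of the parameter, so the one-dimensional case applies. This is where continuity turns
  into order information; the cells and the max-min formula both rest on it.\<close>

lemma affine_piece_two_points:
  assumes "continuous_on (cube n) f" "finite L" "\<And>x. x \<in> cube n \<Longrightarrow> \<exists>p\<in>L. f x = aff n p x"
    and x: "x \<in> cube n" and y: "y \<in> cube n"
  shows "\<exists>p\<in>L. f x \<le> aff n p x \<and> aff n p y \<le> f y"
proof -
  let ?s = "\<lambda>t i. (1 - t) * x i + t * y i"
  let ?l = "\<lambda>p. (aff n p y - aff n p x, aff n p x)"
  have s: "?s t \<in> cube n" if "t \<in> {0..1}" for t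
    using cube_segment[OF x y] that by auto
  have l: "aff n p (?s t) = fst (?l p) * t + snd (?l p)" for p t
    unfolding aff_segment by (simp add: algebra_simps)
  have "continuous_on {0..1::real} ?s"
    by (intro continuous_on_coordinatewise_then_product continuous_intros)
  then have "continuous_on {0..1} (\<lambda>t. f (?s t))"
    by (rule continuous_on_compose2[OF assms(1)]) (use s in auto)
  then have "\<exists>l\<in>?l ` L. f (?s 0) \<le> fst l * 0 + snd l \<and> fst l * 1 + snd l \<le> f (?s 1)"
  proof (rule affine_piece_two_points_real[rotated 2])
    show "\<exists>l\<in>?l ` L. f (?s t) = fst l * t + snd l" if "t \<in> {0..1}" for t
      using assms(3)[OF s[OF that]] by (auto simp: l)
  qed (use assms in auto)
  then show ?thesis
    by auto
qed

text \<open>A piece \<open>q\<close> with \<open>f x \<le> q x\<close> and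
  \<open>q y \<le> f y\<close> lies above \<open>p\<close> at \<open>x\<close>, hence at
  \<open>y\<close>, which gives \<open>p y \<le> f y\<close>. The segment run backwards gives a
  piece below \<open>p\<close> that shows the other inequality.\<close>

lemma affine_on_order_cell:
  assumes "continuous_on (cube n) f" "finite L" "\<And>x. x \<in> cube n \<Longrightarrow> \<exists>p\<in>L. f x = aff n p x"
    and x: "x \<in> cube n" and y: "y \<in> cube n" and p: "p \<in> L" "f x = aff n p x"
    and xy: "\<And>p q. p \<in> L \<Longrightarrow> q \<in> L \<Longrightarrow> aff n p x \<le> aff n q x \<Longrightarrow> aff n p y \<le> aff n q y"
  shows "f y = aff n p y"
proof -
  obtain q where "q \<in> L" "f x \<le> aff n q x" "aff n q y \<le> f y"
    using affine_piece_two_points[OF assms(1-3) x y] by blast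
  moreover obtain r where "r \<in> L" "f y \<le> aff n r y" "aff n r x \<le> f x"
    using affine_piece_two_points[OF assms(1-3) y x] by blast
  ultimately show ?thesis
    using xy[of p q] xy[of r p] p by force
qed

text \<open>A piecewise linear function is the maximum over \<open>y\<close> of the minimum of the pieces
  that are at least \<open>f y\<close> at \<open>y\<close>.\<close>

lemma max_min_representation:
  assumes "continuous_on (cube n) f" "finite L" "\<And>x. x \<in> cube n \<Longrightarrow> \<exists>p\<in>L. f x = aff n p x"
  shows "\<exists>\<S>. finite \<S> \<and> \<S> \<subseteq> Pow L \<and> (\<forall>x\<in>cube n. f x = Max ((\<lambda>S. Min ((\<lambda>p. aff n p x) ` S)) ` \<S>))"
proof -
  let ?S = "\<lambda>y. {p \<in> L. f y \<le> aff n p y}"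
  let ?\<S> = "?S ` cube n"
  have fin: "finite ?\<S>"
    by (rule finite_subset[of _ "Pow L"]) (use assms(2) in auto)
  have "f x = Max ((\<lambda>S. Min ((\<lambda>p. aff n p x) ` S)) ` ?\<S>)" if x: "x \<in> cube n" for x
  proof (rule Max_eqI[symmetric])
    show "finite ((\<lambda>S. Min ((\<lambda>p. aff n p x) ` S)) ` ?\<S>)"
      using fin by simp
    show "b \<le> f x" if "b \<in> (\<lambda>S. Min ((\<lambda>p. aff n p x) ` S)) ` ?\<S>" for b
    proof -
      have "b \<in> (\<lambda>y. Min ((\<lambda>p. aff n p x) ` ?S y)) ` cube n"
        using that by (simp only: image_image)
      then obtain y where y: "b = Min ((\<lambda>p. aff n p x) ` ?S y)" "y \<in> cube n"
        by (rule imageE)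
      \<comment> \<open>This piece belongs to the set attached to \<open>y\<close>, so the minimum
        over that set is at most its value at \<open>x\<close>. Equality is attained by the set
        attached to \<open>x\<close> itself, which contains an active piece.\<close>
      obtain p where p: "p \<in> L" "f y \<le> aff n p y" "aff n p x \<le> f x"
        using affine_piece_two_points[OF assms y(2) x] by blast
      have "b \<le> aff n p x"
        unfolding y(1) by (rule Min_le) (use assms(2) p in auto)
      with p show ?thesis by simp
    qed
    obtain p where p: "p \<in> L" "f x = aff n p x"
      using assms(3)[OF x] by blast
    have "f x = Min ((\<lambda>p. aff n p x) ` ?S x)"
      by (rule Min_eqI[symmetric]) (use assms(2) p in auto)
    then show "f x \<in> (\<lambda>S. Min ((\<lambda>p. aff n p x) ` S)) ` ?\<S>"
      by (rule image_eqI) (rule imageI[OF x])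
  qed
  then have "\<forall>x\<in>cube n. f x = Max ((\<lambda>S. Min ((\<lambda>p. aff n p x) ` S)) ` ?\<S>)"
    by (rule ballI)
  moreover have "?\<S> \<subseteq> Pow L"
    by blast
  ultimately show ?thesis
    using fin by (intro exI[of _ ?\<S>] conjI)
qed

text \<open>The set of pieces alone does not determine \<open>f\<close>, but the max-min formula
  does so from a finite family of finite sets of integral forms, and there are only countably many
  of these.\<close>

lemma countable_MV: "countable (MV n)"
proof -
  \<comment> \<open>\<open>forms \<int> n\<close> leaves the coefficients from \<open>n\<close> on
    arbitrary and is therefore uncountable; setting them to \<open>0\<close> makes the forms
    countable without changing \<open>aff n\<close>.\<close>
  let ?c = "\<lambda>c i. if i < n then c i else (0::real)"
  define \<F> where "\<F> = (\<lambda>p. (?c (fst p), snd p)) ` forms \<int> n"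
  have "\<F> \<subseteq> (\<lambda>(xs, b). (\<lambda>i. if i < n then xs ! i else 0, b)) ` (lists \<int> \<times> \<int>)"
  proof
    fix q assume "q \<in> \<F>"
    then obtain p where p: "p \<in> forms \<int> n" "q = (?c (fst p), snd p)"
      by (auto simp: \<F>_def)
    have "q = (\<lambda>(xs, b). (\<lambda>i. if i < n then xs ! i else 0, b)) (map (fst p) [0..<n], snd p)"
      by (auto simp: p fun_eq_iff)
    moreover have "map (fst p) [0..<n] \<in> lists \<int>" "snd p \<in> \<int>"
      using p by (auto simp: forms_def)
    ultimately show "q \<in> (\<lambda>(xs, b). (\<lambda>i. if i < n then xs ! i else 0, b)) ` (lists \<int> \<times> \<int>)"
      by blast
  qed
  moreover have "countable (\<int> :: real set)"
    by (auto simp: Ints_def)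
  then have "countable ((\<lambda>(xs, b). (\<lambda>i. if i < n then xs ! i else 0 :: real, b :: real)) ` (lists \<int> \<times> \<int>))"
    by (intro countable_image countable_SIGMA countable_lists)
  ultimately have \<F>: "countable \<F>"
    by (rule countable_subset)
  let ?Fin = "{S. finite S \<and> S \<subseteq> {T. finite T \<and> T \<subseteq> \<F>}}"
  have "MV n \<subseteq> (\<lambda>\<S>. \<lambda>x\<in>cube n. Max ((\<lambda>S. Min ((\<lambda>p. aff n p x) ` S)) ` \<S>)) ` ?Fin"
  proof
    fix f :: "(nat \<Rightarrow> real) \<Rightarrow> real" assume f: "f \<in> MV n"
    obtain L where L: "finite L" "L \<subseteq> forms \<int> n" "\<And>x. x \<in> cube n \<Longrightarrow> \<exists>p\<in>L. f x = aff n p x"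
      "continuous_on (cube n) f" "f \<in> cube n \<rightarrow>\<^sub>E {0..1}"
      using pl_funsE[OF f] by blast
    let ?L = "(\<lambda>p. (?c (fst p), snd p)) ` L"
    have fin: "finite ?L"
      using L(1) by simp
    have active: "\<exists>p\<in>?L. f x = aff n p x" if "x \<in> cube n" for x
      using L(3)[OF that] by (auto simp: aff_def)
    obtain \<S> where \<S>0: "finite \<S> \<and> \<S> \<subseteq> Pow ?L \<and>
      (\<forall>x\<in>cube n. f x = Max ((\<lambda>S. Min ((\<lambda>p. aff n p x) ` S)) ` \<S>))"
      using max_min_representation[OF L(4) fin active] by (rule exE)
    then have \<S>: "finite \<S>" "\<S> \<subseteq> Pow ?L"
      "\<And>x. x \<in> cube n \<Longrightarrow> f x = Max ((\<lambda>S. Min ((\<lambda>p. aff n p x) ` S)) ` \<S>)"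
      by simp_all
    have "f = (\<lambda>x\<in>cube n. Max ((\<lambda>S. Min ((\<lambda>p. aff n p x) ` S)) ` \<S>))"
      (is "f = ?g")
    proof (rule extensionalityI[of _ "cube n"])
      show "f \<in> extensional (cube n)"
        using L(5) by (simp add: PiE_iff)
      show "f x = ?g x" if "x \<in> cube n" for x
        using \<S>(3)[OF that] that by simp
    qed simp
    moreover have "\<S> \<in> ?Fin"
    proof -
      have "finite ?L" "?L \<subseteq> \<F>"
        using L(1,2) unfolding \<F>_def by auto
      then have "Pow ?L \<subseteq> {T. finite T \<and> T \<subseteq> \<F>}"
        by (intro subsetI) (simp add: finite_subset[of _ ?L] order_trans[of _ ?L])
      with \<S>(2) have "\<S> \<subseteq> {T. finite T \<and> T \<subseteq> \<F>}"
        by (rule order_trans)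
      then show ?thesis
        using \<S>(1) by simp
    qed
    ultimately show "f \<in> (\<lambda>\<S>. \<lambda>x\<in>cube n. Max ((\<lambda>S. Min ((\<lambda>p. aff n p x) ` S)) ` \<S>)) ` ?Fin"
      by blast
  qed
  moreover have "countable ?Fin"
    by (intro countable_Collect_finite_subset \<F>)
  ultimately show ?thesis
    by (rule countable_subset[OF _ countable_image])
qed

section \<open>Rational polytopes\<close>

text \<open>Generators of a rational polytope. They may be affinely dependent or absent, so that the
  hulls of such sets are closed under intersection with rational half-spaces.\<close>

definition rat_pts :: "nat \<Rightarrow> (nat \<Rightarrow> real) set \<Rightarrow> bool" where
  "rat_pts n V \<longleftrightarrow> finite V \<and> (\<forall>v\<in>V. (\<forall>i<n. v i \<in> \<rat>) \<and> (\<forall>i\<ge>n. v i = 0))"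

lemma sum_fun_apply: "(\<Sum>a\<in>A. f a) x = (\<Sum>a\<in>A. f a x)" for f :: "'a \<Rightarrow> 'b \<Rightarrow> real"
  by (induction A rule: infinite_finite_induct) auto

lemma aff_sum:
  assumes "sum u I = 1"
  shows "aff n p (\<lambda>i. \<Sum>v\<in>I. u v * y v i) = (\<Sum>v\<in>I. u v * aff n p (y v))"
proof -
  have "(\<Sum>v\<in>I. u v * aff n p (y v)) = (\<Sum>v\<in>I. \<Sum>i<n. u v * (fst p i * y v i)) + (\<Sum>v\<in>I. u v) * snd p"
    by (simp add: aff_def distrib_left sum.distrib sum_distrib_left sum_distrib_right)
  also have "(\<Sum>v\<in>I. \<Sum>i<n. u v * (fst p i * y v i)) = (\<Sum>i<n. \<Sum>v\<in>I. u v * (fst p i * y v i))"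
    by (rule sum.swap)
  finally show ?thesis
    by (simp add: aff_def assms sum_distrib_left mult.left_commute)
qed

lemma hull_iff:
  fixes V :: "(nat \<Rightarrow> real) set"
  assumes "finite V"
  shows "x \<in> convex hull V \<longleftrightarrow>
    (\<exists>u. (\<forall>v\<in>V. 0 \<le> u v) \<and> sum u V = 1 \<and> x = (\<lambda>i. \<Sum>v\<in>V. u v * v i))"
  unfolding convex_hull_finite[OF assms] by (auto simp: fun_eq_iff sum_fun_apply scaleR_fun_def)

lemma hull_sum:
  fixes y :: "'i \<Rightarrow> nat \<Rightarrow> real"
  assumes "finite I" "sum a I = 1" "\<And>i. i \<in> I \<Longrightarrow> 0 \<le> a i" "\<And>i. i \<in> I \<Longrightarrow> y i \<in> convex hull W"
  shows "(\<lambda>j. \<Sum>i\<in>I. a i * y i j) \<in> convex hull W"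
proof -
  have "(\<Sum>i\<in>I. a i *\<^sub>R y i) \<in> convex hull W"
    using assms by (intro convex_sum convex_convex_hull)
  moreover have "(\<Sum>i\<in>I. a i *\<^sub>R y i) = (\<lambda>j. \<Sum>i\<in>I. a i * y i j)"
    by (simp add: fun_eq_iff sum_fun_apply scaleR_fun_def)
  ultimately show ?thesis by simp
qed

lemma convex_aff_le: "convex {x. aff n p x \<le> 0}"
proof (rule convexI)
  fix x y and u v :: real
  assume *: "x \<in> {x. aff n p x \<le> 0}" "y \<in> {x. aff n p x \<le> 0}" "0 \<le> u" "0 \<le> v" "u + v = 1"
  have u: "u = 1 - v"
    using *(5) by simp
  have "aff n p (u *\<^sub>R x + v *\<^sub>R y) = u * aff n p x + v * aff n p y"
    unfolding u aff_segment[symmetric] by (simp add: scaleR_fun_def plus_fun_def)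
  also have "\<dots> \<le> 0"
    using * by (simp add: mult_nonneg_nonpos add_nonpos_nonpos)
  finally show "u *\<^sub>R x + v *\<^sub>R y \<in> {x. aff n p x \<le> 0}"
    by simp
qed

lemma hull_zero_above:
  assumes "rat_pts n V" "x \<in> convex hull V" "i \<ge> n"
  shows "x i = 0"
proof -
  obtain u where "x = (\<lambda>i. \<Sum>v\<in>V. u v * v i)"
    using assms(1,2) hull_iff[of V x] by (auto simp: rat_pts_def)
  then show ?thesis
    using assms(1,3) by (auto simp: rat_pts_def intro: sum.neutral)
qed

text \<open>The slice is generated by the generators in the half-space (\<open>N\<close>) and the
  points where segments from \<open>N\<close> to the remaining generators (\<open>Q\<close>) cross
  the bounding hyperplane. These points are rational because \<open>l\<close> takes rational values
  on \<open>V\<close>.\<close>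

lemma hull_Int_halfspace:
  assumes V: "rat_pts n V" and p: "p \<in> forms \<rat> n"
  shows "\<exists>W. rat_pts n W \<and> convex hull V \<inter> {x. aff n p x \<le> 0} = convex hull W"
proof -
  define l where "l = aff n p"
  define N where "N = {v \<in> V. l v \<le> 0}"
  define Q where "Q = {v \<in> V. l v > 0}"
  \<comment> \<open>The zero of \<open>l\<close> on the segment from \<open>v\<close> to
    \<open>w\<close>, when \<open>l v \<le> 0 < l w\<close>.\<close>
  define pt where "pt = (\<lambda>v w i. (l w * v i - l v * w i) / (l w - l v))"
  define W where "W = N \<union> (\<lambda>(v, w). pt v w) ` (N \<times> Q)"
  have fin: "finite V" "finite N" "finite Q"
    using V by (auto simp: rat_pts_def N_def Q_def)
  have VNQ: "V = N \<union> Q" "N \<inter> Q = {}"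
    by (auto simp: N_def Q_def)
  have l_rat: "l v \<in> \<rat>" if "v \<in> V" for v
    unfolding l_def aff_def using that V p
    by (auto simp: rat_pts_def forms_def intro!: Rats_add K_sum[OF unital_subring_instances(2)])
  have "rat_pts n W"
    unfolding rat_pts_def
  proof (intro conjI ballI)
    show "finite W"
      using fin by (auto simp: W_def)
    fix w assume "w \<in> W"
    then consider "w \<in> N" | v v' where "v \<in> N" "v' \<in> Q" "w = pt v v'"
      by (auto simp: W_def)
    then have "(\<forall>i<n. w i \<in> \<rat>) \<and> (\<forall>i\<ge>n. w i = 0)"
    proof cases
      case 1
      then show ?thesis using V by (auto simp: rat_pts_def N_def)
    next
      case 2
      then have "v \<in> V" "v' \<in> V"
        by (auto simp: N_def Q_def)
      then have "\<forall>i<n. v i \<in> \<rat> \<and> v' i \<in> \<rat>" "\<forall>i\<ge>n. v i = 0 \<and> v' i = 0" "l v \<in> \<rat>" "l v' \<in> \<rat>"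
        using V l_rat by (auto simp: rat_pts_def)
      then show ?thesis
        by (simp add: 2 pt_def)
    qed
    then show "\<forall>i<n. w i \<in> \<rat>" "\<forall>i\<ge>n. w i = 0"
      by auto
  qed
  moreover have "convex hull W \<subseteq> convex hull V \<inter> {x. l x \<le> 0}"
  proof (rule hull_minimal)
    show "convex (convex hull V \<inter> {x. l x \<le> 0})"
      unfolding l_def by (intro convex_Int convex_convex_hull convex_aff_le)
    show "W \<subseteq> convex hull V \<inter> {x. l x \<le> 0}"
    proof
      fix w assume "w \<in> W"
      then consider "w \<in> N" | v v' where "v \<in> N" "v' \<in> Q" "w = pt v v'"
        by (auto simp: W_def)
      then show "w \<in> convex hull V \<inter> {x. l x \<le> 0}"
      proof cases
        case 1
        then show ?thesis by (auto simp: N_def hull_inc)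
      next
        case 2
        then have v: "v \<in> convex hull V" "v' \<in> convex hull V" "l v \<le> 0" "0 < l v'"
          by (auto simp: N_def Q_def hull_inc)
        define t where "t = - l v / (l v' - l v)"
        have t: "0 \<le> t" "t \<le> 1" "1 - t = l v' / (l v' - l v)"
          using v(3,4) by (auto simp: t_def field_simps)
        have w: "w = (\<lambda>i. (1 - t) * v i + t * v' i)"
          unfolding 2 t(3) by (simp add: pt_def t_def fun_eq_iff diff_divide_distrib)
        also have "\<dots> = (1 - t) *\<^sub>R v + t *\<^sub>R v'"
          by (simp add: fun_eq_iff scaleR_fun_def)
        also have "\<dots> \<in> convex hull V"
          using t v by (intro convexD[OF convex_convex_hull]) auto
        finally have "w \<in> convex hull V" .
        moreover have "l w = 0"
          unfolding w l_def aff_segment unfolding l_def[symmetric] t(3) using v(3,4) by (simp add: t_def field_simps)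
        ultimately show ?thesis by simp
      qed
    qed
  qed
  moreover have "convex hull V \<inter> {x. l x \<le> 0} \<subseteq> convex hull W"
  proof
    fix x assume x: "x \<in> convex hull V \<inter> {x. l x \<le> 0}"
    then obtain u where u: "\<And>v. v \<in> V \<Longrightarrow> 0 \<le> u v" "sum u V = 1" "x = (\<lambda>i. \<Sum>v\<in>V. u v * v i)"
      using hull_iff[OF fin(1)] by auto
    define A where "A = (\<Sum>v\<in>N. u v * (- l v))"
    define B where "B = (\<Sum>w\<in>Q. u w * l w)"
    have split: "(\<Sum>v\<in>V. h v) = (\<Sum>v\<in>N. h v) + (\<Sum>w\<in>Q. h w)" for h :: "(nat \<Rightarrow> real) \<Rightarrow> real"
      unfolding VNQ(1) by (rule sum.union_disjoint[OF fin(2,3) VNQ(2)])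
    have "l x = B - A"
      using aff_sum[OF u(2), of n p "\<lambda>v. v"] split[of "\<lambda>v. u v * l v"]
      by (simp add: u(3) A_def B_def sum_negf l_def)
    then have "B \<le> A"
      using x by simp
    have Q0: "0 \<le> u w * l w" if "w \<in> Q" for w
      using that u(1) by (auto simp: Q_def)
    have "0 \<le> B"
      unfolding B_def using Q0 by (rule sum_nonneg)
    show "x \<in> convex hull W"
    proof (cases "A = 0")
      case True
      with \<open>B \<le> A\<close> \<open>0 \<le> B\<close> have "B = 0" by simp
      then have "u w * l w = 0" if "w \<in> Q" for w
        using that Q0 fin(3) unfolding B_def by (simp add: sum_nonneg_eq_0_iff)
      then have uQ: "u w = 0" if "w \<in> Q" for w
        using that by (fastforce simp: Q_def)
      have "x = (\<lambda>i. \<Sum>v\<in>N. u v * v i)"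
        by (simp add: u(3) split uQ)
      also have "\<dots> \<in> convex hull W"
      proof (rule hull_sum)
        show "sum u N = 1"
          using u(2) by (simp add: split uQ)
        show "v \<in> convex hull W" if "v \<in> N" for v
          using that by (intro hull_inc) (simp add: W_def)
      qed (use fin u in \<open>auto simp: N_def\<close>)
      finally show ?thesis .
    next
      case False
      with \<open>B \<le> A\<close> \<open>0 \<le> B\<close> have A: "A > 0" by simp
      \<comment> \<open>The mass on \<open>Q\<close> is moved to crossing points by pairing each
        \<open>w\<close> with all \<open>v\<close> in proportion to \<open>u v * (- l v)\<close>.
        Since these numbers add up to \<open>A\<close>, the pairs use up exactly \<open>u w\<close>
        of each \<open>w\<close>; since the numbers \<open>u w * l w\<close> add up to
        \<open>B\<close>, they use the fraction \<open>B / A\<close> of each \<open>v\<close>, and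
        \<open>1 - B / A\<close> remains.\<close>
      define a where "a = case_sum (\<lambda>v. u v * (1 - B / A)) (\<lambda>(v, w). u v * u w * (l w - l v) / A)"
      define y where "y = case_sum (\<lambda>v. v) (\<lambda>(v, w). pt v w)"
      have cross: "(\<Sum>(v, w)\<in>N \<times> Q. u v * u w * (l w * h v - l v * h w) / A) =
          (\<Sum>v\<in>N. u v * h v) * (B / A) + (\<Sum>w\<in>Q. u w * h w)" for h :: "(nat \<Rightarrow> real) \<Rightarrow> real"
      proof -
        have "(\<Sum>(v, w)\<in>N \<times> Q. u v * u w * (l w * h v - l v * h w) / A) =
          (\<Sum>v\<in>N. \<Sum>w\<in>Q. (u v * h v) * (u w * l w) / A + (u v * (- l v)) * (u w * h w) / A)"
          by (simp add: sum.cartesian_product algebra_simps add_divide_distrib diff_divide_distrib)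
        also have "\<dots> = (\<Sum>v\<in>N. u v * h v) * B / A + A * (\<Sum>w\<in>Q. u w * h w) / A"
          by (simp only: sum.distrib A_def B_def sum_product sum_divide_distrib)
        finally show ?thesis
          using A by simp
      qed
      have "x = (\<lambda>j. \<Sum>i\<in>N <+> N \<times> Q. a i * y i j)"
      proof
        fix j
        have "(\<Sum>i\<in>N <+> N \<times> Q. a i * y i j) =
          (\<Sum>v\<in>N. u v * (1 - B / A) * v j) + (\<Sum>(v, w)\<in>N \<times> Q. u v * u w * (l w - l v) / A * pt v w j)"
          using fin by (simp add: sum.Plus a_def y_def split_beta)
        also have "(\<Sum>(v, w)\<in>N \<times> Q. u v * u w * (l w - l v) / A * pt v w j) =
          (\<Sum>(v, w)\<in>N \<times> Q. u v * u w * (l w * v j - l v * w j) / A)"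
        proof (intro sum.cong refl, clarify)
          fix v w assume "v \<in> N" "w \<in> Q"
          then have "l w - l v \<noteq> 0"
            by (auto simp: N_def Q_def)
          then show "u v * u w * (l w - l v) / A * pt v w j = u v * u w * (l w * v j - l v * w j) / A"
            by (simp add: pt_def)
        qed
        also have "\<dots> = (\<Sum>v\<in>N. u v * v j) * (B / A) + (\<Sum>w\<in>Q. u w * w j)"
          by (rule cross)
        also have "(\<Sum>v\<in>N. u v * (1 - B / A) * v j) = (\<Sum>v\<in>N. u v * v j) * (1 - B / A)"
          unfolding sum_distrib_right by (simp add: mult.commute mult.left_commute)
        finally show "x j = (\<Sum>i\<in>N <+> N \<times> Q. a i * y i j)"
          by (simp add: u(3) split algebra_simps)
      qed
      also have "\<dots> \<in> convex hull W"
      proof (rule hull_sum)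
        show "finite (N <+> N \<times> Q)"
          using fin by simp
        have "sum a (N <+> N \<times> Q) = (\<Sum>v\<in>N. u v * (1 - B / A)) + (\<Sum>(v, w)\<in>N \<times> Q. u v * u w * (l w - l v) / A)"
          using fin by (simp add: sum.Plus a_def split_beta)
        also have "\<dots> = (\<Sum>v\<in>N. u v) * (1 - B / A) + ((\<Sum>v\<in>N. u v) * (B / A) + (\<Sum>w\<in>Q. u w))"
          using cross[of "\<lambda>_. 1"] by (simp add: sum_distrib_right)
        also have "\<dots> = 1"
          using u(2) by (simp add: split algebra_simps)
        finally show "sum a (N <+> N \<times> Q) = 1" .
        fix i assume i: "i \<in> N <+> N \<times> Q"
        have "0 \<le> 1 - B / A"
          using A \<open>B \<le> A\<close> by simp
        then show "0 \<le> a i"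
          using i A u(1) by (auto simp: a_def N_def Q_def intro!: mult_nonneg_nonneg divide_nonneg_pos)
        show "y i \<in> convex hull W"
          using i by (intro hull_inc) (auto simp: y_def W_def)
      qed
      finally show ?thesis .
    qed
  qed
  ultimately show ?thesis
    unfolding l_def by blast
qed

lemma hull_Int_halfspaces:
  assumes "finite C" "C \<subseteq> forms \<rat> n" "rat_pts n V"
  shows "\<exists>W. rat_pts n W \<and> convex hull V \<inter> {x. \<forall>p\<in>C. aff n p x \<le> 0} = convex hull W"
  using assms
proof (induction C)
  case empty
  then show ?case by auto
next
  case (insert p C)
  then obtain W where W: "rat_pts n W" "convex hull V \<inter> {x. \<forall>p\<in>C. aff n p x \<le> 0} = convex hull W"
    by auto
  obtain W' where W': "rat_pts n W'" "convex hull W \<inter> {x. aff n p x \<le> 0} = convex hull W'"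
    using hull_Int_halfspace[OF W(1), of p] insert.prems by auto
  have "convex hull V \<inter> {x. \<forall>p\<in>insert p C. aff n p x \<le> 0} = convex hull W'"
    unfolding W'(2)[symmetric] W(2)[symmetric] by auto
  with W'(1) show ?case by blast
qed

text \<open>The coordinates of a point of the cube add up to at most \<open>n\<close>, so the
  simplex with vertices \<open>0\<close> and \<open>n\<close> times the unit vectors contains the
  cube. It is the bounded start from which half-spaces are cut off.\<close>

lemma cube_subset_hull: "\<exists>V. rat_pts n V \<and> cube n \<subseteq> convex hull V"
proof -
  define y where "y = (\<lambda>i j. if j = i \<and> i < n then real n else 0)"
  have "rat_pts n (y ` {..n})"
    by (auto simp: rat_pts_def y_def)
  moreover have "cube n \<subseteq> convex hull (y ` {..n})"
  proof
    fix x assume x: "x \<in> cube n"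
    define a where "a = (\<lambda>i. if i < n then x i / n else 1 - (\<Sum>j<n. x j / n))"
    have le: "(\<Sum>j<n. x j / n) \<le> 1"
    proof -
      have "(\<Sum>j<n. x j / n) \<le> (\<Sum>j<n. 1 / n)"
        using x by (intro sum_mono divide_right_mono) (auto simp: cube_def)
      then show ?thesis by (cases "n = 0") auto
    qed
    have split: "(\<Sum>i\<le>n. h i) = (\<Sum>i<n. h i) + h n" for h :: "nat \<Rightarrow> real"
      by (simp add: lessThan_Suc_atMost[symmetric])
    have "x = (\<lambda>j. \<Sum>i\<le>n. a i * y i j)"
    proof
      fix j
      have "(\<Sum>i<n. a i * y i j) = (\<Sum>i<n. if i = j then x i else 0)"
        by (intro sum.cong) (auto simp: a_def y_def)
      also have "\<dots> = x j"
        using x by (auto simp: cube_def)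
      finally show "x j = (\<Sum>i\<le>n. a i * y i j)"
        by (simp add: split y_def)
    qed
    also have "\<dots> \<in> convex hull (y ` {..n})"
    proof (rule hull_sum)
      show "sum a {..n} = 1"
        by (simp add: split a_def)
      show "0 \<le> a i" if "i \<in> {..n}" for i
        using x le by (auto simp: a_def cube_def)
      show "y i \<in> convex hull (y ` {..n})" if "i \<in> {..n}" for i
        using that by (intro hull_inc) auto
    qed simp
    finally show "x \<in> convex hull (y ` {..n})" .
  qed
  ultimately show ?thesis by blast
qed

text \<open>The cube itself is cut out of the enclosing simplex by the half-spaces
  \<open>lo i\<close> and \<open>hi i\<close>, so these are simply added to the constraints in
  \<open>C\<close>.\<close>

lemma cube_polytope_eq_hull:
  assumes "finite C" "C \<subseteq> forms \<rat> n"
  shows "\<exists>V. rat_pts n V \<and> {x \<in> cube n. \<forall>p\<in>C. aff n p x \<le> 0} = convex hull V"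
proof -
  obtain V where V: "rat_pts n V" "cube n \<subseteq> convex hull V"
    using cube_subset_hull by blast
  define lo hi :: "nat \<Rightarrow> (nat \<Rightarrow> real) \<times> real"
    where "lo = (\<lambda>i. (\<lambda>j. if j = i then -1 else 0 :: real, 0 :: real))"
    and "hi = (\<lambda>i. (\<lambda>j. if j = i then 1 else 0 :: real, -1 :: real))"
  have lohi: "aff n (lo i) x = - x i" "aff n (hi i) x = x i - 1" if "i < n" for i x
    using that by (auto simp: lo_def hi_def aff_def if_distrib[of "\<lambda>t. t * _"] cong: if_cong)
  let ?C = "C \<union> (lo ` {..<n} \<union> hi ` {..<n})"
  have "?C \<subseteq> forms \<rat> n"
    using assms(2) by (auto simp: forms_def lo_def hi_def)
  then obtain W where W: "rat_pts n W" "convex hull V \<inter> {x. \<forall>p\<in>?C. aff n p x \<le> 0} = convex hull W"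
    using hull_Int_halfspaces[OF _ _ V(1), of ?C] assms(1) by auto
  have box: "(\<forall>p\<in>lo ` {..<n} \<union> hi ` {..<n}. aff n p x \<le> 0) \<longleftrightarrow> (\<forall>i<n. 0 \<le> x i \<and> x i \<le> 1)" for x
    by (auto simp: ball_Un lohi)
  have "x \<in> convex hull V \<inter> {x. \<forall>p\<in>?C. aff n p x \<le> 0} \<longleftrightarrow> x \<in> {x \<in> cube n. \<forall>p\<in>C. aff n p x \<le> 0}" for x
  proof -
    have "x \<in> cube n \<longleftrightarrow> x \<in> convex hull V \<and> (\<forall>i<n. 0 \<le> x i \<and> x i \<le> 1)"
    proof
      assume "x \<in> cube n"
      then show "x \<in> convex hull V \<and> (\<forall>i<n. 0 \<le> x i \<and> x i \<le> 1)"
        using subsetD[OF V(2)] by (simp add: cube_def)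
    next
      assume "x \<in> convex hull V \<and> (\<forall>i<n. 0 \<le> x i \<and> x i \<le> 1)"
      then show "x \<in> cube n"
        using hull_zero_above[OF V(1)] by (simp add: cube_def)
    qed
    then show ?thesis
      unfolding ball_Un[of C] mem_Collect_eq Int_iff box by blast
  qed
  then have "{x \<in> cube n. \<forall>p\<in>C. aff n p x \<le> 0} = convex hull V \<inter> {x. \<forall>p\<in>?C. aff n p x \<le> 0}"
    by (intro set_eqI) (rule sym)
  with W show ?thesis
    by metis
qed

subsection \<open>Linearity cells\<close>

text \<open>\<open>\<V>\<close> collects sets of generators, not the cells themselves. The last
  clause speaks of all continuous functions with pieces in \<open>L\<close>, so that one
  decomposition can serve two functions at once.\<close>

definition linearity_cells :: "nat \<Rightarrow> ((nat \<Rightarrow> real) \<times> real) set \<Rightarrow> (nat \<Rightarrow> real) set set \<Rightarrow> bool" where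
  "linearity_cells n L \<V> \<longleftrightarrow> finite \<V> \<and> cube n = (\<Union>V\<in>\<V>. convex hull V) \<and> (\<forall>V\<in>\<V>. rat_pts n V) \<and>
    (\<forall>V\<in>\<V>. \<forall>f. continuous_on (cube n) f \<longrightarrow> (\<forall>x\<in>cube n. \<exists>p\<in>L. f x = aff n p x) \<longrightarrow>
       (\<exists>p. \<forall>y\<in>convex hull V. f y = aff n p y))"

lemma linearity_cellsD:
  assumes "linearity_cells n L \<V>"
  shows "finite \<V>" "cube n = (\<Union>V\<in>\<V>. convex hull V)" "V \<in> \<V> \<Longrightarrow> rat_pts n V"
  using assms by (simp_all add: linearity_cells_def)

lemma linearity_cells_affine:
  assumes "linearity_cells n L \<V>" "V \<in> \<V>" "continuous_on (cube n) f"
    "\<And>x. x \<in> cube n \<Longrightarrow> \<exists>p\<in>L. f x = aff n p x"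
  shows "\<exists>p. \<forall>y\<in>convex hull V. f y = aff n p y"
  using assms by (simp add: linearity_cells_def)

lemma ex_linearity_cells:
  assumes L: "finite L" "L \<subseteq> forms \<rat> n"
  shows "\<exists>\<V>. linearity_cells n L \<V>"
proof -
  \<comment> \<open>\<open>R x\<close> is the preorder of the forms by their values at
    \<open>x\<close>. A cell consists of the points that preserve such a preorder, and a finite
    \<open>L\<close> admits finitely many preorders.\<close>
  define R where "R = (\<lambda>x. {(p, q) \<in> L \<times> L. aff n p x \<le> aff n q x})"
  define cell where "cell = (\<lambda>R. {y \<in> cube n. \<forall>(p, q)\<in>R. aff n p y \<le> aff n q y})"
  have "\<exists>V. rat_pts n V \<and> cell (R x) = convex hull V" for x
  proof -
    let ?d = "\<lambda>(p, q). (\<lambda>i. fst p i - fst q i, snd p - snd q)"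
    have d: "aff n (\<lambda>i. a i - a' i, b - b') y = aff n (a, b) y - aff n (a', b') y" for a b a' b' y
      by (simp add: aff_def algebra_simps sum_subtractf)
    have "R x \<subseteq> L \<times> L"
      by (auto simp: R_def)
    then have "finite (R x)"
      by (rule finite_subset) (simp add: L(1))
    then have "finite (?d ` R x)"
      by simp
    moreover have "?d ` R x \<subseteq> forms \<rat> n"
    proof (intro image_subsetI, clarify)
      fix c b c' b' assume "((c, b), (c', b')) \<in> R x"
      then have "(c, b) \<in> forms \<rat> n" "(c', b') \<in> forms \<rat> n"
        using L(2) by (auto simp: R_def)
      then show "(\<lambda>i. fst (c, b) i - fst (c', b') i, snd (c, b) - snd (c', b')) \<in> forms \<rat> n"
        by (auto simp: forms_def)
    qed
    ultimately have "\<exists>V. rat_pts n V \<and> {y \<in> cube n. \<forall>r\<in>?d ` R x. aff n r y \<le> 0} = convex hull V"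
      by (rule cube_polytope_eq_hull)
    moreover have "{y \<in> cube n. \<forall>r\<in>?d ` R x. aff n r y \<le> 0} = cell (R x)"
      unfolding cell_def ball_simps(9) by (intro Collect_cong conj_cong refl ball_cong) (clarsimp simp: d)
    ultimately show ?thesis by simp
  qed
  then obtain V where V: "\<And>x. rat_pts n (V x)" "\<And>x. cell (R x) = convex hull (V x)"
    by metis
  \<comment> \<open>The generators are chosen once for each preorder, not for each point
    \<open>x\<close>; this keeps the family finite.\<close>
  let ?\<V> = "(\<lambda>r. SOME W. rat_pts n W \<and> cell r = convex hull W) ` (R ` cube n)"
  have "R ` cube n \<subseteq> Pow (L \<times> L)"
    by (auto simp: R_def)
  then have "finite (R ` cube n)"
    by (rule finite_subset) (simp add: L(1))
  then have "finite ?\<V>"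
    by simp
  have some: "rat_pts n (SOME W. rat_pts n W \<and> cell (R x) = convex hull W)"
     "convex hull (SOME W. rat_pts n W \<and> cell (R x) = convex hull W) = cell (R x)" for x
    using someI[of "\<lambda>W. rat_pts n W \<and> cell (R x) = convex hull W" "V x"] V[of x] by auto
  have "cube n = (\<Union>x\<in>cube n. cell (R x))"
    by (auto simp: cell_def R_def)
  then have "cube n = (\<Union>W\<in>?\<V>. convex hull W)"
    by (simp add: image_image some)
  moreover have "rat_pts n W" if "W \<in> ?\<V>" for W
    using that some(1) by (elim imageE) simp
  moreover have "\<exists>p. \<forall>y\<in>convex hull W. f y = aff n p y"
    if W: "W \<in> ?\<V>" and f: "continuous_on (cube n) f" "\<forall>x\<in>cube n. \<exists>p\<in>L. f x = aff n p x" for W f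
  proof -
    obtain x where x: "x \<in> cube n" "convex hull W = cell (R x)"
      using W some(2) by (elim imageE) simp
    obtain p where p: "p \<in> L" "f x = aff n p x"
      using bspec[OF f(2) x(1)] by (rule bexE)
    have "f y = aff n p y" if y: "y \<in> cell (R x)" for y
    proof (rule affine_on_order_cell[OF f(1) L(1) bspec[OF f(2)] x(1) _ p])
      show "aff n p y \<le> aff n q y" if "p \<in> L" "q \<in> L" "aff n p x \<le> aff n q x" for p q
        using y that bspec[of "R x" "\<lambda>(p, q). aff n p y \<le> aff n q y" "(p, q)"] by (simp add: cell_def R_def)
      show "y \<in> cube n"
        using y by (simp add: cell_def)
    qed
    then show ?thesis
      using x(2) by (intro exI[of _ p]) simp
  qed
  ultimately have "linearity_cells n L ?\<V>"
    using \<open>finite ?\<V>\<close> unfolding linearity_cells_def by (intro conjI ballI allI impI)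
  then show ?thesis
    by (rule exI)
qed

lemma affine_hull_sum:
  assumes "finite V" "\<And>y. y \<in> convex hull V \<Longrightarrow> f y = aff n p y"
    and "sum u V = 1" "(\<lambda>i. \<Sum>v\<in>V. u v * v i) \<in> convex hull V"
  shows "f (\<lambda>i. \<Sum>v\<in>V. u v * v i) = (\<Sum>v\<in>V. u v * f v)"
proof -
  have "f (\<lambda>i. \<Sum>v\<in>V. u v * v i) = (\<Sum>v\<in>V. u v * aff n p v)"
    using assms(2)[OF assms(4)] aff_sum[OF assms(3), of n p "\<lambda>v. v"] by simp
  also have "\<dots> = (\<Sum>v\<in>V. u v * f v)"
    by (intro sum.cong refl) (simp add: assms(2) hull_inc)
  finally show ?thesis .
qed

subsection \<open>Caratheodory's theorem in arbitrary real vector spaces\<close>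

text \<open>An affine dependence among the generators allows weight to be shifted without moving
  \<open>x\<close> until some weight reaches \<open>0\<close>; that generator is dropped, and the
  number of generators decreases.\<close>

lemma convex_hull_affine_independent_subset:
  fixes V :: "'a::real_vector set"
  assumes "finite V" "x \<in> convex hull V"
  shows "\<exists>W\<subseteq>V. \<not> affine_dependent W \<and> W \<noteq> {} \<and> x \<in> convex hull W"
  using assms
proof (induction "card V" arbitrary: V rule: less_induct)
  case less
  show ?case
  proof (cases "affine_dependent V")
    case False
    moreover have "V \<noteq> {}"
      using less.prems(2) by auto
    ultimately show ?thesis
      using less.prems(2) by blast
  next
    case True
    then obtain c where c: "sum c V = 0" "\<exists>v\<in>V. c v \<noteq> 0" "(\<Sum>v\<in>V. c v *\<^sub>R v) = 0"
      using affine_dependent_explicit_finite[OF less.prems(1)] by blast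
    obtain u where u: "\<And>v. v \<in> V \<Longrightarrow> 0 \<le> u v" "sum u V = 1" "(\<Sum>v\<in>V. u v *\<^sub>R v) = x"
      using less.prems(2) unfolding convex_hull_finite[OF less.prems(1)] by auto
    have "\<exists>v\<in>V. 0 < c v"
    proof (rule ccontr)
      assume "\<not> ?thesis"
      then have "\<forall>v\<in>V. - c v = 0"
        using c(1) less.prems(1) sum_nonneg_eq_0_iff[of V "\<lambda>v. - c v"] by (force simp: sum_negf)
      with c(2) show False by simp
    qed
    then have "{v \<in> V. 0 < c v} \<noteq> {}" "finite {v \<in> V. 0 < c v}"
      using less.prems(1) by auto
    \<comment> \<open>The minimal ratio \<open>u w / c w\<close> is the largest multiple of
      \<open>c\<close> that can be subtracted from \<open>u\<close> without making a weight
      negative, and it makes the weight of \<open>w\<close> vanish.\<close>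
    then obtain w where w: "w \<in> V" "0 < c w" "\<And>v. v \<in> V \<Longrightarrow> 0 < c v \<Longrightarrow> u w / c w \<le> u v / c v"
      using arg_min_if_finite[of "{v \<in> V. 0 < c v}" "\<lambda>v. u v / c v"] by (metis (mono_tags, lifting) linorder_not_le mem_Collect_eq)
    define t where "t = u w / c w"
    define a where "a = (\<lambda>v. u v - t * c v)"
    have "0 \<le> t"
      using w u(1) by (simp add: t_def)
    have a0: "0 \<le> a v" if "v \<in> V" for v
    proof (cases "0 < c v")
      case True
      then show ?thesis
        using w(3)[OF that] by (simp add: a_def t_def[symmetric] pos_le_divide_eq)
    next
      case False
      then have "t * c v \<le> 0"
        using \<open>0 \<le> t\<close> by (simp add: mult_nonneg_nonpos)
      then show ?thesis
        using u(1)[OF that] by (simp add: a_def)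
    qed
    have aw: "a w = 0"
      using w by (simp add: a_def t_def)
    have "sum a V = 1"
      using u(2) c(1) by (simp add: a_def sum_subtractf sum_distrib_left[symmetric])
    then have a1: "sum a (V - {w}) = 1"
      using less.prems(1) w(1) aw by (simp add: sum_diff1)
    have "(\<Sum>v\<in>V. a v *\<^sub>R v) = x"
      using u(3) c(3) by (simp add: a_def scaleR_left_diff_distrib sum_subtractf scaleR_sum_right[symmetric] flip: scaleR_scaleR)
    then have a2: "(\<Sum>v\<in>V - {w}. a v *\<^sub>R v) = x"
      using less.prems(1) w(1) aw by (simp add: sum_diff1)
    have "x \<in> convex hull (V - {w})"
      using less.prems(1) a0 a1 a2 by (subst convex_hull_finite) auto
    moreover have "card (V - {w}) < card V"
      using less.prems(1) w(1) by (meson card_Diff1_less)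
    ultimately show ?thesis
      using less.hyps[of "V - {w}"] less.prems(1) by blast
  qed
qed

subsection \<open>Zero sets are rational polyhedra\<close>

text \<open>By Caratheodory's theorem a polytope is the union of the simplexes spanned by affinely
  independent sets of its generators. These may overlap, so no triangulation has to be
  found.\<close>

lemma rational_polyhedron_hull:
  assumes "rat_pts n V"
  shows "rational_polyhedron n (convex hull V)"
proof -
  let ?\<W> = "{W. W \<subseteq> V \<and> \<not> affine_dependent W \<and> W \<noteq> {}}"
  have fin: "finite V"
    using assms by (simp add: rat_pts_def)
  have "rational_simplex n (convex hull W)" if "W \<in> ?\<W>" for W
    unfolding rational_simplex_def
    using that assms fin by (intro exI[of _ W]) (auto simp: rat_pts_def intro: finite_subset)
  moreover have "finite ((\<lambda>W. convex hull W) ` ?\<W>)"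
    by (intro finite_imageI finite_subset[of ?\<W> "Pow V"]) (use fin in auto)
  moreover have "convex hull V = \<Union>((\<lambda>W. convex hull W) ` ?\<W>)"
  proof (intro subset_antisym subsetI)
    fix x assume "x \<in> convex hull V"
    then show "x \<in> \<Union>((\<lambda>W. convex hull W) ` ?\<W>)"
      using convex_hull_affine_independent_subset[OF fin] by blast
  next
    fix x assume "x \<in> \<Union>((\<lambda>W. convex hull W) ` ?\<W>)"
    then show "x \<in> convex hull V"
      using hull_mono by blast
  qed
  ultimately show ?thesis
    unfolding rational_polyhedron_def by (intro exI[of _ "(\<lambda>W. convex hull W) ` ?\<W>"]) blast
qed

lemma rational_polyhedron_UN:
  assumes "finite I" "\<And>i. i \<in> I \<Longrightarrow> rational_polyhedron n (P i)"
  shows "rational_polyhedron n (\<Union>i\<in>I. P i)"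
proof -
  obtain \<S> where \<S>: "\<And>i. i \<in> I \<Longrightarrow> finite (\<S> i) \<and> (\<forall>S\<in>\<S> i. rational_simplex n S) \<and> P i = \<Union>(\<S> i)"
    using assms(2) unfolding rational_polyhedron_def by metis
  show ?thesis
    unfolding rational_polyhedron_def
    by (rule exI[of _ "\<Union>i\<in>I. \<S> i"]) (use assms(1) \<S> in auto)
qed

text \<open>On a cell \<open>a\<close> is affine and nonnegative, so a convex combination of
  generators is a zero only if all its weight sits on generators where \<open>a\<close> vanishes.
  The zeros in the cell are the hull of these generators.\<close>

lemma rational_polyhedron_zero_set:
  assumes "a \<in> pl_funs \<rat> n"
  shows "rational_polyhedron n {x \<in> cube n. a x = 0}"
proof -
  obtain L where L: "finite L" "L \<subseteq> forms \<rat> n" "\<And>x. x \<in> cube n \<Longrightarrow> \<exists>p\<in>L. a x = aff n p x"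
    "continuous_on (cube n) a" "a \<in> cube n \<rightarrow>\<^sub>E {0..1}"
    using pl_funsE[OF assms] by blast
  obtain \<V> where cells: "linearity_cells n L \<V>"
    using ex_linearity_cells[OF L(1,2)] by blast
  note \<V> = linearity_cellsD[OF cells] and aff = linearity_cells_affine[OF cells]
  have "{x \<in> cube n. a x = 0} = (\<Union>V\<in>\<V>. convex hull {v \<in> V. a v = 0})"
  proof (intro subset_antisym subsetI)
    fix x assume x: "x \<in> {x \<in> cube n. a x = 0}"
    then obtain V where V: "V \<in> \<V>" "x \<in> convex hull V"
      using \<V>(2) by blast
    have fin: "finite V"
      using \<V>(3)[OF V(1)] by (simp add: rat_pts_def)
    obtain u where u: "\<And>v. v \<in> V \<Longrightarrow> 0 \<le> u v" "sum u V = 1" "x = (\<lambda>i. \<Sum>v\<in>V. u v * v i)"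
      using V(2) hull_iff[OF fin] by auto
    obtain p where p: "\<And>y. y \<in> convex hull V \<Longrightarrow> a y = aff n p y"
      using aff[OF V(1) L(4,3)] by blast
    have "v \<in> cube n" if "v \<in> V" for v
      using \<V>(2) V(1) that hull_inc[of v V] by blast
    then have nonneg: "0 \<le> u v * a v" if "v \<in> V" for v
      using that u(1) pl_funs_bounds[OF assms] by simp
    have "(\<Sum>v\<in>V. u v * a v) = 0"
      using affine_hull_sum[OF fin p u(2)] V(2) x u(3) by simp
    then have zero: "u v * a v = 0" if "v \<in> V" for v
      using that nonneg fin by (simp add: sum_nonneg_eq_0_iff)
    have "sum u {v \<in> V. a v = 0} = sum u V"
      using zero fin by (intro sum.mono_neutral_left) auto
    moreover have "(\<Sum>v\<in>{v \<in> V. a v = 0}. u v * v i) = (\<Sum>v\<in>V. u v * v i)" for i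
      using zero fin by (intro sum.mono_neutral_left) auto
    ultimately have "x \<in> convex hull {v \<in> V. a v = 0}"
      using u fin by (subst hull_iff) (auto intro!: exI[of _ u])
    with V(1) show "x \<in> (\<Union>V\<in>\<V>. convex hull {v \<in> V. a v = 0})"
      by blast
  next
    fix x assume "x \<in> (\<Union>V\<in>\<V>. convex hull {v \<in> V. a v = 0})"
    then obtain V where V: "V \<in> \<V>" "x \<in> convex hull {v \<in> V. a v = 0}"
      by blast
    have fin: "finite {v \<in> V. a v = 0}"
      using \<V>(3)[OF V(1)] by (simp add: rat_pts_def)
    have sub: "convex hull {v \<in> V. a v = 0} \<subseteq> convex hull V"
      by (rule hull_mono) auto
    obtain u where u: "\<And>v. v \<in> {v \<in> V. a v = 0} \<Longrightarrow> 0 \<le> u v" "sum u {v \<in> V. a v = 0} = 1"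
      "x = (\<lambda>i. \<Sum>v\<in>{v \<in> V. a v = 0}. u v * v i)"
      using V(2) hull_iff[OF fin] by auto
    obtain p where p: "\<And>y. y \<in> convex hull V \<Longrightarrow> a y = aff n p y"
      using aff[OF V(1) L(4,3)] by blast
    have "a x = (\<Sum>v\<in>{v \<in> V. a v = 0}. u v * a v)"
      unfolding u(3) by (rule affine_hull_sum[OF fin _ u(2), where p = p]) (use p sub V(2) u(3) in auto)
    then have "a x = 0"
      by simp
    moreover have "x \<in> cube n"
      using V sub \<V>(2) by blast
    ultimately show "x \<in> {x \<in> cube n. a x = 0}"
      by simp
  qed
  moreover have "rat_pts n {v \<in> V. a v = 0}" if "V \<in> \<V>" for V
    using \<V>(3)[OF that] by (auto simp: rat_pts_def)
  ultimately show ?thesis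
    using \<V>(1) by (simp add: rational_polyhedron_UN rational_polyhedron_hull)
qed

text \<open>Both functions are affine on common cells, so the inequality need only be checked at the
  finitely many generators. There either \<open>a\<close> and hence \<open>f\<close> vanish, or
  \<open>a\<close> is positive and a large multiple dominates \<open>f\<close>.\<close>

lemma zero_set_subset_imp_le_multiple:
  assumes f: "f \<in> pl_funs \<rat> n" and a: "a \<in> pl_funs \<rat> n"
    and sub: "\<And>x. x \<in> cube n \<Longrightarrow> a x = 0 \<Longrightarrow> f x = 0"
  shows "\<exists>k::nat. \<forall>x\<in>cube n. f x \<le> k * a x"
proof -
  obtain L where L: "finite L" "L \<subseteq> forms \<rat> n" "\<And>x. x \<in> cube n \<Longrightarrow> \<exists>p\<in>L. f x = aff n p x"
    "continuous_on (cube n) f" "f \<in> cube n \<rightarrow>\<^sub>E {0..1}"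
    using pl_funsE[OF f] by blast
  obtain M where M: "finite M" "M \<subseteq> forms \<rat> n" "\<And>x. x \<in> cube n \<Longrightarrow> \<exists>p\<in>M. a x = aff n p x"
    "continuous_on (cube n) a" "a \<in> cube n \<rightarrow>\<^sub>E {0..1}"
    using pl_funsE[OF a] by blast
  \<comment> \<open>With the union of the two sets of pieces, one family of cells is good for both
    \<open>f\<close> and \<open>a\<close>.\<close>
  have LM: "finite (L \<union> M)" "L \<union> M \<subseteq> forms \<rat> n"
    "\<And>x. x \<in> cube n \<Longrightarrow> \<exists>p\<in>L \<union> M. f x = aff n p x" "\<And>x. x \<in> cube n \<Longrightarrow> \<exists>p\<in>L \<union> M. a x = aff n p x"
    using L(1-3) M(1-3) by (simp_all add: bex_Un)
  obtain \<V> where cells: "linearity_cells n (L \<union> M) \<V>"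
    using ex_linearity_cells[OF LM(1,2)] by blast
  note \<V> = linearity_cellsD[OF cells] and aff = linearity_cells_affine[OF cells]
  have fin: "finite (\<Union>\<V>)"
    using \<V>(1,3) by (auto simp: rat_pts_def)
  have vc: "v \<in> cube n" if "V \<in> \<V>" "v \<in> V" for v V
    using \<V>(2) that hull_inc[of v V] by blast
  have "\<exists>k::nat. f v \<le> k * a v" if "v \<in> \<Union>\<V>" for v
  proof (cases "a v = 0")
    case True
    then show ?thesis
      using sub vc that by auto
  next
    case False
    then have "0 < a v"
      using pl_funs_bounds[OF a, of v] vc that by force
    then show ?thesis
      using reals_Archimedean3[of "a v"] by (meson less_imp_le)
  qed
  then obtain k :: "(nat \<Rightarrow> real) \<Rightarrow> nat" where k: "\<And>v. v \<in> \<Union>\<V> \<Longrightarrow> f v \<le> k v * a v"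
    by metis
  define N where "N = sum k (\<Union>\<V>)"
  have N: "f v \<le> N * a v" if v: "v \<in> \<Union>\<V>" for v
  proof -
    have "real (k v) \<le> real N"
      unfolding N_def using member_le_sum[OF v, of k] fin by (simp del: of_nat_sum)
    then have "k v * a v \<le> N * a v"
      using pl_funs_bounds[OF a, of v] vc v by (intro mult_right_mono) auto
    with k[OF v] show ?thesis by simp
  qed
  have "f x \<le> N * a x" if x: "x \<in> cube n" for x
  proof -
    obtain V where V: "V \<in> \<V>" "x \<in> convex hull V"
      using \<V>(2) x by blast
    have finV: "finite V"
      using \<V>(3)[OF V(1)] by (simp add: rat_pts_def)
    obtain u where u: "\<And>v. v \<in> V \<Longrightarrow> 0 \<le> u v" "sum u V = 1" "x = (\<lambda>i. \<Sum>v\<in>V. u v * v i)"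
      using V(2) hull_iff[OF finV] by auto
    obtain p where p: "\<And>y. y \<in> convex hull V \<Longrightarrow> f y = aff n p y"
      using aff[OF V(1) L(4) LM(3)] by blast
    obtain q where q: "\<And>y. y \<in> convex hull V \<Longrightarrow> a y = aff n q y"
      using aff[OF V(1) M(4) LM(4)] by blast
    have "f x = (\<Sum>v\<in>V. u v * f v)" "a x = (\<Sum>v\<in>V. u v * a v)"
      using affine_hull_sum[OF finV p u(2)] affine_hull_sum[OF finV q u(2)] V(2) u(3) by auto
    moreover have "(\<Sum>v\<in>V. u v * f v) \<le> (\<Sum>v\<in>V. u v * (N * a v))"
      using u(1) N V(1) by (intro sum_mono mult_left_mono) auto
    ultimately show ?thesis
      by (simp add: sum_distrib_left mult.left_commute)
  qed
  then show ?thesis by blast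
qed

section \<open>Rational polyhedra are zero sets\<close>

text \<open>\<open>haff n p\<close> is \<open>aff n p\<close> homogenized by a coordinate \<open>s\<close>, and \<open>in_cone n V s x\<close> says that
  \<open>(x, s)\<close> lies in the cone generated by the points \<open>(v, 1)\<close> with \<open>v \<in> V\<close>.\<close>

definition haff :: "nat \<Rightarrow> (nat \<Rightarrow> real) \<times> real \<Rightarrow> real \<Rightarrow> (nat \<Rightarrow> real) \<Rightarrow> real" where
  "haff n p s x = (\<Sum>i<n. fst p i * x i) + snd p * s"

definition in_cone :: "nat \<Rightarrow> (nat \<Rightarrow> real) set \<Rightarrow> real \<Rightarrow> (nat \<Rightarrow> real) \<Rightarrow> bool" where
  "in_cone n V s x \<longleftrightarrow> (\<exists>u. (\<forall>v\<in>V. 0 \<le> u v) \<and> s = sum u V \<and> (\<forall>i<n. x i = (\<Sum>v\<in>V. u v * v i)))"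

text \<open>Splits off the coefficient \<open>t\<close> of the new generator, the variable that the
  elimination below removes.\<close>

lemma in_cone_insert:
  assumes "finite V" "v \<notin> V"
  shows "in_cone n (insert v V) s x \<longleftrightarrow> (\<exists>t\<ge>0. in_cone n V (s - t) (\<lambda>i. x i - t * v i))"
proof
  assume "in_cone n (insert v V) s x"
  then obtain u where "\<forall>w\<in>insert v V. 0 \<le> u w" "s = sum u (insert v V)"
    "\<forall>i<n. x i = (\<Sum>w\<in>insert v V. u w * w i)"
    by (auto simp: in_cone_def)
  then show "\<exists>t\<ge>0. in_cone n V (s - t) (\<lambda>i. x i - t * v i)"
    using assms unfolding in_cone_def by (intro exI[of _ "u v"]) (auto intro!: exI[of _ u])
next
  assume "\<exists>t\<ge>0. in_cone n V (s - t) (\<lambda>i. x i - t * v i)"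
  then obtain t u where t: "0 \<le> t" and u: "\<forall>w\<in>V. 0 \<le> u w" "s - t = sum u V"
    "\<forall>i<n. x i - t * v i = (\<Sum>w\<in>V. u w * w i)"
    by (auto simp: in_cone_def)
  have "sum (u(v := t)) V = sum u V" "(\<Sum>w\<in>V. (u(v := t)) w * w i) = (\<Sum>w\<in>V. u w * w i)" for i
    using assms by (auto intro!: sum.cong)
  then have "s = sum (u(v := t)) (insert v V)" "\<forall>i<n. x i = (\<Sum>w\<in>insert v V. (u(v := t)) w * w i)"
    using assms u by (auto simp: algebra_simps)
  moreover have "\<forall>w\<in>insert v V. 0 \<le> (u(v := t)) w"
    using t u(1) by auto
  ultimately show "in_cone n (insert v V) s x"
    unfolding in_cone_def by (intro exI[of _ "u(v := t)"]) blast
qed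

lemma haff_translate: "haff n p (s - t) (\<lambda>i. x i - t * v i) = haff n p s x - t * aff n p v"
  by (simp add: haff_def aff_def algebra_simps sum_subtractf sum_distrib_left)

text \<open>Induction on \<open>V\<close>, eliminating the coefficient \<open>t\<close> of the new generator
  as in the Fourier--Motzkin method.\<close>

lemma cone_eq_halfspaces:
  assumes "rat_pts n V"
  shows "\<exists>C. finite C \<and> C \<subseteq> forms \<rat> n \<and> (\<forall>s x. in_cone n V s x \<longleftrightarrow> (\<forall>p\<in>C. haff n p s x \<le> 0))"
proof -
  have "finite V" "\<forall>v\<in>V. \<forall>i<n. v i \<in> \<rat>"
    using assms by (auto simp: rat_pts_def)
  then show ?thesis
  proof (induction V)
    case empty
    define e :: "real \<Rightarrow> nat \<Rightarrow> (nat \<Rightarrow> real) \<times> real" where "e = (\<lambda>a i. (\<lambda>j. if j = i then a else 0, 0))"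
    \<comment> \<open>The cone over the empty set is the origin; pairs of opposite inequalities
      force \<open>s\<close> and the coordinates below \<open>n\<close> to vanish.\<close>
    define C :: "((nat \<Rightarrow> real) \<times> real) set" where "C = e 1 ` {..<n} \<union> e (-1) ` {..<n} \<union> {(\<lambda>i. 0, 1), (\<lambda>i. 0, -1)}"
    have e: "haff n (e a i) s x = a * x i" if "i < n" for a i s x
      using that by (simp add: haff_def e_def if_distrib[of "\<lambda>t. t * _"] cong: if_cong)
    have c: "haff n (\<lambda>i. 0, a) s x = a * s" for a s x
      by (simp add: haff_def)
    have "in_cone n {} s x \<longleftrightarrow> (\<forall>p\<in>C. haff n p s x \<le> 0)" for s x
    proof -
      have eq0: "a = 0 \<longleftrightarrow> a \<le> 0 \<and> 0 \<le> a" for a :: real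
        by auto
      have "(\<forall>p\<in>C. haff n p s x \<le> 0) \<longleftrightarrow> (\<forall>i<n. x i = 0) \<and> s = 0"
        unfolding eq0 by (auto simp: C_def ball_Un e c)
      then show ?thesis
        by (auto simp: in_cone_def)
    qed
    moreover have "finite C" "C \<subseteq> forms \<rat> n"
      by (auto simp: C_def forms_def e_def)
    ultimately show ?case
      by blast
  next
    case (insert v V)
    obtain C where C: "finite C" "C \<subseteq> forms \<rat> n" "\<And>s x. in_cone n V s x \<longleftrightarrow> (\<forall>p\<in>C. haff n p s x \<le> 0)"
      using insert.IH insert.prems by auto
    define l where "l = (\<lambda>p. aff n p v)"
    define comb where "comb = (\<lambda>(p, q). (\<lambda>i. l p * fst q i - l q * fst p i, l p * snd q - l q * snd p))"
    define P where "P = {p \<in> C. l p > 0}"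
    define Q where "Q = {q \<in> C. l q < 0}"
    \<comment> \<open>The constraint \<open>h p \<le> t * l p\<close> bounds \<open>t\<close> from
      below if \<open>l p > 0\<close> and from above if \<open>l p < 0\<close>. A combination
      \<open>comb\<close> compares a lower with an upper bound. The forms with
      \<open>l p < 0\<close> are also kept themselves, since \<open>t\<close> has to be nonnegative,
      and those with \<open>l p = 0\<close> do not involve \<open>t\<close>.\<close>
    define C' where "C' = {p \<in> C. l p \<le> 0} \<union> comb ` (P \<times> Q)"
    have comb: "haff n (comb (p, q)) s x = l p * haff n q s x - l q * haff n p s x" for p q s x
      by (simp add: comb_def haff_def algebra_simps sum_subtractf sum_distrib_left)
    have "in_cone n (insert v V) s x \<longleftrightarrow> (\<forall>p\<in>C'. haff n p s x \<le> 0)" for s x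
    proof -
      let ?h = "\<lambda>p. haff n p s x"
      have "in_cone n (insert v V) s x \<longleftrightarrow> (\<exists>t\<ge>0. \<forall>p\<in>C. ?h p \<le> t * l p)"
        by (simp add: in_cone_insert[OF insert.hyps] C(3) haff_translate l_def)
      also have "\<dots> \<longleftrightarrow> (\<forall>p\<in>C'. ?h p \<le> 0)"
      proof
        assume "\<exists>t\<ge>0. \<forall>p\<in>C. ?h p \<le> t * l p"
        then obtain t where t: "0 \<le> t" "\<And>p. p \<in> C \<Longrightarrow> ?h p \<le> t * l p"
          by blast
        show "\<forall>p\<in>C'. ?h p \<le> 0"
        proof
          fix r assume "r \<in> C'"
          then consider "r \<in> C" "l r \<le> 0" | p q where "p \<in> P" "q \<in> Q" "r = comb (p, q)"
            by (auto simp: C'_def)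
          then show "?h r \<le> 0"
          proof cases
            case 1
            then show ?thesis
              using t(2)[of r] mult_nonneg_nonpos[OF t(1), of "l r"] by linarith
          next
            case 2
            then have "l p * ?h q \<le> l p * (t * l q)" "l q * ?h p \<ge> l q * (t * l p)"
              using t(2)[of p] t(2)[of q] by (auto simp: P_def Q_def intro: mult_left_mono mult_left_mono_neg)
            then show ?thesis
              unfolding 2(3) comb by (simp add: algebra_simps)
          qed
        qed
      next
        assume *: "\<forall>p\<in>C'. ?h p \<le> 0"
        \<comment> \<open>The largest lower bound for the coefficient, with \<open>0\<close> among
          the lower bounds. The forms in \<open>C'\<close> say that it does not exceed any upper
          bound.\<close>
        define t where "t = Max (insert 0 ((\<lambda>p. ?h p / l p) ` P))"
        have fin: "finite (insert 0 ((\<lambda>p. ?h p / l p) ` P))"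
          using C(1) by (simp add: P_def)
        have t0: "0 \<le> t"
          unfolding t_def using fin by (rule Max_ge) simp
        have "?h p \<le> t * l p" if p: "p \<in> C" for p
        proof -
          consider "l p > 0" | "l p = 0" | "l p < 0"
            by linarith
          then show ?thesis
          proof cases
            case 1
            then have "?h p / l p \<le> t"
              unfolding t_def using fin p by (intro Max_ge) (auto simp: P_def)
            with 1 show ?thesis
              by (simp add: pos_divide_le_eq)
          next
            case 2
            then show ?thesis
              using * p by (simp add: C'_def)
          next
            case 3
            have "t \<le> ?h p / l p"
              unfolding t_def
            proof (rule Max.boundedI)
              fix a assume "a \<in> insert 0 ((\<lambda>p. ?h p / l p) ` P)"
              then consider "a = 0" | r where "r \<in> P" "a = ?h r / l r"
                by auto
              then show "a \<le> ?h p / l p"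
              proof cases
                case 1
                then show ?thesis
                  using * p 3 by (simp add: C'_def divide_nonpos_neg)
              next
                case 2
                then have "comb (r, p) \<in> C'" "0 < l r"
                  using p 3 by (auto simp: C'_def P_def Q_def)
                then have "l r * ?h p - l p * ?h r \<le> 0"
                  using * comb[of r p s x] by auto
                then show ?thesis
                  unfolding 2(2) using \<open>0 < l r\<close> 3 by (simp add: field_simps)
              qed
            qed (use fin in auto)
            with 3 show ?thesis
              by (simp add: neg_le_divide_eq)
          qed
        qed
        with t0 show "\<exists>t\<ge>0. \<forall>p\<in>C. ?h p \<le> t * l p"
          by blast
      qed
      finally show ?thesis .
    qed
    moreover have "finite C'"
      using C(1) by (simp add: C'_def P_def Q_def)
    moreover have "C' \<subseteq> forms \<rat> n"
    proof -
      have l: "l p \<in> \<rat>" if "p \<in> C" for p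
        unfolding l_def aff_def using that C(2) insert.prems
        by (auto simp: forms_def intro!: Rats_add K_sum[OF unital_subring_instances(2)])
      have "comb (p, q) \<in> forms \<rat> n" if "p \<in> C" "q \<in> C" for p q
        using l[OF that(1)] l[OF that(2)] subsetD[OF C(2) that(1)] subsetD[OF C(2) that(2)]
        by (simp add: forms_def comb_def)
      then show ?thesis
        using C(2) by (auto simp: C'_def P_def Q_def)
    qed
    ultimately show ?case
      by blast
  qed
qed

section \<open>Clearing denominators, and the lattice of zero sets\<close>

lemma common_denominator:
  assumes "finite A" "A \<subseteq> (\<rat> :: real set)"
  shows "\<exists>d::nat. d > 0 \<and> (\<forall>a\<in>A. real d * a \<in> \<int>)"
  using assms
proof (induction A)
  case empty
  then show ?case by auto
next
  case (insert a A)
  then obtain d :: nat where d: "0 < d" "\<And>b. b \<in> A \<Longrightarrow> real d * b \<in> \<int>"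
    by auto
  obtain k m :: int where km: "0 < m" "a = of_int k / of_int m"
    using insert.prems by (auto elim: Rats_cases')
  have "real (d * nat m) * b \<in> \<int>" if "b \<in> A" for b
  proof -
    have "real (d * nat m) * b = of_int m * (real d * b)"
      using km(1) by simp
    then show ?thesis
      using Ints_mult[OF Ints_of_int d(2)[OF that]] by metis
  qed
  moreover have "real (d * nat m) * a = of_int (int d * k)"
    using km by simp
  then have "real (d * nat m) * a \<in> \<int>"
    by (metis Ints_of_int)
  ultimately show ?case
    using d(1) km(1) by (intro exI[of _ "d * nat m"]) auto
qed

text \<open>A positive multiple defines the same half-space; this is how polyhedra with rational
  vertices become zero sets of functions with integer coefficients.\<close>

lemma rational_form_multiple:
  assumes "p \<in> forms \<rat> n"
  shows "\<exists>q\<in>forms \<int> n. \<forall>x. aff n q x \<le> 0 \<longleftrightarrow> aff n p x \<le> 0"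
proof -
  have "finite (insert (snd p) (fst p ` {..<n}))" "insert (snd p) (fst p ` {..<n}) \<subseteq> \<rat>"
    using assms by (auto simp: forms_def)
  from common_denominator[OF this] obtain d :: nat
    where d: "0 < d" "\<forall>a\<in>insert (snd p) (fst p ` {..<n}). real d * a \<in> \<int>"
    by (elim exE conjE)
  show ?thesis
  proof (intro bexI allI)
    show "(\<lambda>i. d * fst p i, d * snd p) \<in> forms \<int> n"
      using d(2) by (auto simp: forms_def)
    show "aff n (\<lambda>i. d * fst p i, d * snd p) x \<le> 0 \<longleftrightarrow> aff n p x \<le> 0" for x
      using d(1) by (simp add: aff_scale mult_le_0_iff)
  qed
qed

text \<open>The sum of two functions vanishes on the intersection of their zero sets and the minimum
  on the union, so this family is a lattice; it turns out to consist of the rational polyhedra in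
  the cube.\<close>

definition zero_sets :: "nat \<Rightarrow> (nat \<Rightarrow> real) set set" where
  "zero_sets n = {Z. \<exists>a\<in>MV n. Z = {x \<in> cube n. a x = 0}}"

lemma zero_sets_halfspace:
  assumes "p \<in> forms \<int> n"
  shows "{x \<in> cube n. aff n p x \<le> 0} \<in> zero_sets n"
proof -
  have "max 0 (min 1 t) = 0 \<longleftrightarrow> t \<le> 0" for t :: real
    by auto
  then have "{x \<in> cube n. aff n p x \<le> 0} = {x \<in> cube n. (\<lambda>x\<in>cube n. max 0 (min 1 (aff n p x))) x = 0}"
    by (intro Collect_cong conj_cong refl) simp
  with pl_funs_clip[OF unital_subring_instances(3) assms] show ?thesis
    unfolding zero_sets_def by blast
qed

lemma zero_sets_cube: "cube n \<in> zero_sets n" and zero_sets_empty: "{} \<in> zero_sets n"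
proof -
  have "(\<lambda>x\<in>cube n. 0) \<in> MV n" "(\<lambda>x\<in>cube n. 1) \<in> MV n"
    by (auto intro!: pl_funs_const unital_subring_instances)
  moreover have "cube n = {x \<in> cube n. (\<lambda>x\<in>cube n. 0 :: real) x = 0}"
    "{} = {x \<in> cube n. (\<lambda>x\<in>cube n. 1 :: real) x = 0}"
    by auto
  ultimately show "cube n \<in> zero_sets n" "{} \<in> zero_sets n"
    unfolding zero_sets_def by blast+
qed

lemma zero_sets_Int:
  assumes "Y \<in> zero_sets n" "Z \<in> zero_sets n"
  shows "Y \<inter> Z \<in> zero_sets n"
proof -
  obtain a b where ab: "a \<in> MV n" "Y = {x \<in> cube n. a x = 0}" "b \<in> MV n" "Z = {x \<in> cube n. b x = 0}"
    using assms by (auto simp: zero_sets_def)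
  have "min 1 (a x + b x) = 0 \<longleftrightarrow> a x = 0 \<and> b x = 0" if "x \<in> cube n" for x
    using pl_funs_bounds[OF ab(1) that] pl_funs_bounds[OF ab(3) that] by (auto simp: min_def)
  then have "Y \<inter> Z = {x \<in> cube n. (\<lambda>x\<in>cube n. min 1 (a x + b x)) x = 0}"
    by (auto simp: ab)
  with pl_funs_plus[OF unital_subring_instances(3) ab(1,3)] show ?thesis
    unfolding zero_sets_def by blast
qed

lemma zero_sets_Un:
  assumes "Y \<in> zero_sets n" "Z \<in> zero_sets n"
  shows "Y \<union> Z \<in> zero_sets n"
proof -
  obtain a b where ab: "a \<in> MV n" "Y = {x \<in> cube n. a x = 0}" "b \<in> MV n" "Z = {x \<in> cube n. b x = 0}"
    using assms by (auto simp: zero_sets_def)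
  have "min (a x) (b x) = 0 \<longleftrightarrow> a x = 0 \<or> b x = 0" if "x \<in> cube n" for x
    using pl_funs_bounds[OF ab(1) that] pl_funs_bounds[OF ab(3) that] by (auto simp: min_def)
  then have "Y \<union> Z = {x \<in> cube n. (\<lambda>x\<in>cube n. min (a x) (b x)) x = 0}"
    by (auto simp: ab)
  with pl_funs_min[OF unital_subring_instances(3) ab(1,3)] show ?thesis
    unfolding zero_sets_def by blast
qed

lemma zero_sets_polytope:
  assumes "finite C" "C \<subseteq> forms \<rat> n"
  shows "{x \<in> cube n. \<forall>p\<in>C. aff n p x \<le> 0} \<in> zero_sets n"
  using assms
proof (induction C)
  case empty
  then show ?case by (simp add: zero_sets_cube)
next
  case (insert p C)
  obtain q where q: "q \<in> forms \<int> n" "\<And>x. aff n q x \<le> 0 \<longleftrightarrow> aff n p x \<le> 0"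
    using rational_form_multiple insert.prems by (metis insert_subset)
  have "{x \<in> cube n. \<forall>p\<in>insert p C. aff n p x \<le> 0} =
    {x \<in> cube n. aff n q x \<le> 0} \<inter> {x \<in> cube n. \<forall>p\<in>C. aff n p x \<le> 0}"
    by (auto simp: q(2))
  with insert zero_sets_halfspace[OF q(1)] show ?case
    by (simp add: zero_sets_Int)
qed

lemma zero_sets_Union:
  assumes "finite \<S>" "\<And>S. S \<in> \<S> \<Longrightarrow> S \<in> zero_sets n"
  shows "\<Union>\<S> \<in> zero_sets n"
  using assms by (induction \<S>) (auto intro: zero_sets_empty zero_sets_Un)

text \<open>The hull is the slice \<open>s = 1\<close> of the cone over \<open>V\<close>, where
  \<open>haff\<close> becomes \<open>aff\<close>; the half-spaces that describe the cone therefore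
  describe the hull within the cube.\<close>

lemma zero_sets_hull:
  assumes V: "rat_pts n V" and sub: "convex hull V \<subseteq> cube n"
  shows "convex hull V \<in> zero_sets n"
proof -
  obtain C where C: "finite C" "C \<subseteq> forms \<rat> n" "\<And>s x. in_cone n V s x \<longleftrightarrow> (\<forall>p\<in>C. haff n p s x \<le> 0)"
    using cone_eq_halfspaces[OF V] by blast
  have fin: "finite V"
    using V by (simp add: rat_pts_def)
  have "x \<in> convex hull V \<longleftrightarrow> (\<forall>p\<in>C. aff n p x \<le> 0)" if x: "x \<in> cube n" for x
  proof -
    \<comment> \<open>\<open>in_cone\<close> only looks at the coordinates below \<open>n\<close>;
      all others vanish on both sides.\<close>
    have out: "(\<Sum>v\<in>V. u v * v i) = 0" "x i = 0" if "i \<ge> n" for i and u :: "(nat \<Rightarrow> real) \<Rightarrow> real"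
      using that V x by (auto simp: rat_pts_def cube_def intro: sum.neutral)
    have "x \<in> convex hull V \<longleftrightarrow> in_cone n V 1 x"
      unfolding hull_iff[OF fin] in_cone_def
    proof (intro ex_cong1 conj_cong refl)
      fix u show "x = (\<lambda>i. \<Sum>v\<in>V. u v * v i) \<longleftrightarrow> (\<forall>i<n. x i = (\<Sum>v\<in>V. u v * v i))"
        using out by (metis (no_types, lifting) ext not_le)
    qed auto
    also have "\<dots> \<longleftrightarrow> (\<forall>p\<in>C. aff n p x \<le> 0)"
      unfolding C(3) by (simp add: haff_def aff_def)
    finally show ?thesis .
  qed
  then have "convex hull V = {x \<in> cube n. \<forall>p\<in>C. aff n p x \<le> 0}"
    using sub by blast
  with zero_sets_polytope[OF C(1,2)] show ?thesis
    by simp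
qed

lemma rational_polyhedron_in_zero_sets:
  assumes "rational_polyhedron n P" "P \<subseteq> cube n"
  shows "P \<in> zero_sets n"
proof -
  obtain \<S> where \<S>: "finite \<S>" "\<And>S. S \<in> \<S> \<Longrightarrow> rational_simplex n S" "P = \<Union>\<S>"
    using assms(1) by (auto simp: rational_polyhedron_def)
  have "S \<in> zero_sets n" if S: "S \<in> \<S>" for S
  proof -
    obtain V where "rat_pts n V" "S = convex hull V"
      using \<S>(2)[OF S] by (auto simp: rational_simplex_def rat_pts_def)
    then show ?thesis
      using zero_sets_hull S \<S>(3) assms(2) by blast
  qed
  then show ?thesis
    using zero_sets_Union[OF \<S>(1)] \<S>(3) by simp
qed

lemma zero_sets_eq_rational_polyhedra:
  "P \<in> zero_sets n \<longleftrightarrow> rational_polyhedron n P \<and> P \<subseteq> cube n"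
  using rational_polyhedron_in_zero_sets rational_polyhedron_zero_set
    pl_funs_mono_int[OF unital_subring_instances(2)]
  by (fastforce simp: zero_sets_def)

section \<open>Compactness of the cube and of zero sets\<close>

lemma compact_cube: "compact (cube n)"
proof -
  have "cube n = PiE UNIV (\<lambda>i. if i < n then {0..1} else {0})"
    by (auto simp: cube_def PiE_iff split: if_splits)
  moreover have "compactin (product_topology (\<lambda>i. euclidean) UNIV) (PiE UNIV (\<lambda>i::nat. if i < n then {0..1::real} else {0}))"
    by (subst compactin_PiE) auto
  ultimately show ?thesis
    by (simp add: euclidean_product_topology)
qed

lemma compact_zero_set:
  assumes "P \<in> zero_sets n"
  shows "compact P"
proof -
  obtain a where a: "a \<in> MV n" "P = {x \<in> cube n. a x = 0}"
    using assms by (auto simp: zero_sets_def)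
  have "closed (cube n)"
    by (rule compact_imp_closed[OF compact_cube])
  moreover have "continuous_on (cube n) a"
    using a by (simp add: pl_funs_iff)
  ultimately have "closed (cube n \<inter> a -` {0})"
    by (intro continuous_closed_preimage) auto
  moreover have "cube n \<inter> a -` {0} = P"
    using a by auto
  ultimately have "compact (cube n \<inter> P)"
    using compact_Int_closed[OF compact_cube, of P n] by simp
  moreover have "cube n \<inter> P = P"
    using a by auto
  ultimately show ?thesis by simp
qed

section \<open>Duality between polyhedra and function algebras\<close>

definition rfuns :: "real set \<Rightarrow> polyhedron \<Rightarrow> ((nat \<Rightarrow> real) \<Rightarrow> real) set" where
  "rfuns K X = pl_funs K (fst X) |\<^sub>r snd X"

text \<open>One construction for all coefficient rings. Over \<open>\<int>\<close> it stands for the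
  MV-algebra of integral functions and is compared by \<open>mv_hom\<close>.\<close>

definition falg :: "real set \<Rightarrow> polyhedron \<Rightarrow> ((nat \<Rightarrow> real) \<Rightarrow> real) scalar_mv" where
  "falg K X = function_scalar_mv (snd X) (rfuns K X)"

lemma falg_simps [simp]:
  "mv_carrier (falg K X) = rfuns K X"
  "mv_plus (falg K X) = (\<lambda>f g. \<lambda>x\<in>snd X. min 1 (f x + g x))"
  "mv_neg (falg K X) = (\<lambda>f. \<lambda>x\<in>snd X. 1 - f x)"
  "mv_zero (falg K X) = (\<lambda>x\<in>snd X. 0)"
  "mv_scale (falg K X) = (\<lambda>r f. \<lambda>x\<in>snd X. r * f x)"
  by (simp_all add: falg_def function_scalar_mv_def function_mv_def mv.extend_def)

lemma unit_polyhedra_cube: "X \<in> unit_polyhedra \<Longrightarrow> snd X \<subseteq> cube (fst X)"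
  by (auto simp: unit_polyhedra_def)

lemma unit_polyhedra_iff: "X \<in> unit_polyhedra \<longleftrightarrow> snd X \<in> zero_sets (fst X)"
  by (auto simp: unit_polyhedra_def zero_sets_eq_rational_polyhedra split_beta)

lemma Z_maps_iff:
  "z \<in> Z_maps Y X \<longleftrightarrow> z \<in> snd Y \<rightarrow>\<^sub>E snd X \<and> (\<forall>i<fst X. (\<lambda>y\<in>snd Y. z y i) \<in> rfuns \<int> Y)"
  by (simp add: Z_maps_def rfuns_def split_beta)

lemma integral_on_generators_iff:
  "integral_on_generators X Y \<sigma> \<longleftrightarrow> (\<forall>i<fst X. \<sigma> (coord_proj (snd X) i) \<in> rfuns \<int> Y)"
  by (simp add: integral_on_generators_def rfuns_def split_beta)

lemma rfuns_extensional: "f \<in> rfuns K X \<Longrightarrow> f \<in> extensional (snd X)"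
  by (auto simp: rfuns_def restrictions_def)

lemma rfuns_eqI:
  assumes "f \<in> rfuns K X" "g \<in> rfuns K' X" "\<And>x. x \<in> snd X \<Longrightarrow> f x = g x"
  shows "f = g"
  using assms by (meson extensionalityI rfuns_extensional)

lemma rfuns_restrict: "g \<in> pl_funs K (fst X) \<Longrightarrow> restrict g (snd X) \<in> rfuns K X"
  by (simp add: rfuns_def restrictions_def)

lemma rfunsE:
  assumes "f \<in> rfuns K X"
  obtains g where "g \<in> pl_funs K (fst X)" "f = restrict g (snd X)"
  using assms by (auto simp: rfuns_def restrictions_def)

context
  fixes X :: polyhedron
  assumes X: "X \<in> unit_polyhedra"
begin

lemma rfuns_bounds: "f \<in> rfuns K X \<Longrightarrow> x \<in> snd X \<Longrightarrow> 0 \<le> f x \<and> f x \<le> 1"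
  using unit_polyhedra_cube[OF X] by (auto elim!: rfunsE dest: pl_funs_bounds)

lemma rfuns_continuous: "f \<in> rfuns K X \<Longrightarrow> continuous_on (snd X) f"
  using unit_polyhedra_cube[OF X]
  by (auto elim!: rfunsE simp: pl_funs_iff cong: continuous_on_cong intro: continuous_on_subset)

context
  fixes K :: "real set"
  assumes K: "unital_subring K"
begin

lemma rfuns_plus:
  assumes "f \<in> rfuns K X" "g \<in> rfuns K X"
  shows "(\<lambda>x\<in>snd X. min 1 (f x + g x)) \<in> rfuns K X"
proof -
  obtain f' g' where "f' \<in> pl_funs K (fst X)" "f = restrict f' (snd X)"
    "g' \<in> pl_funs K (fst X)" "g = restrict g' (snd X)"
    using assms by (metis rfunsE)
  moreover from this have "(\<lambda>x\<in>snd X. min 1 (f x + g x)) =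
      restrict (\<lambda>x\<in>cube (fst X). min 1 (f' x + g' x)) (snd X)"
    using unit_polyhedra_cube[OF X] by (auto simp: fun_eq_iff)
  ultimately show ?thesis
    by (simp only: rfuns_restrict pl_funs_plus[OF K])
qed

lemma rfuns_neg:
  assumes "f \<in> rfuns K X"
  shows "(\<lambda>x\<in>snd X. 1 - f x) \<in> rfuns K X"
proof -
  obtain f' where "f' \<in> pl_funs K (fst X)" "f = restrict f' (snd X)"
    using assms by (metis rfunsE)
  moreover from this have "(\<lambda>x\<in>snd X. 1 - f x) = restrict (\<lambda>x\<in>cube (fst X). 1 - f' x) (snd X)"
    using unit_polyhedra_cube[OF X] by (auto simp: fun_eq_iff)
  ultimately show ?thesis
    by (simp only: rfuns_restrict pl_funs_neg[OF K])
qed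

lemma rfuns_scale:
  assumes "f \<in> rfuns K X" "r \<in> K" "0 \<le> r" "r \<le> 1"
  shows "(\<lambda>x\<in>snd X. r * f x) \<in> rfuns K X"
proof -
  obtain f' where "f' \<in> pl_funs K (fst X)" "f = restrict f' (snd X)"
    using assms by (metis rfunsE)
  moreover from this have "(\<lambda>x\<in>snd X. r * f x) = restrict (\<lambda>x\<in>cube (fst X). r * f' x) (snd X)"
    using unit_polyhedra_cube[OF X] by (auto simp: fun_eq_iff)
  ultimately show ?thesis
    using assms by (simp only: rfuns_restrict pl_funs_scale[OF K])
qed

lemma rfuns_zero: "(\<lambda>x\<in>snd X. 0) \<in> rfuns K X"
proof -
  have "(\<lambda>x\<in>snd X. 0) = restrict (\<lambda>x\<in>cube (fst X). 0 :: real) (snd X)"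
    using unit_polyhedra_cube[OF X] by (auto simp: fun_eq_iff)
  then show ?thesis
    by (simp only: rfuns_restrict pl_funs_const[OF K] K_closed[OF K] order_refl zero_le_one)
qed

lemma rfuns_coord:
  assumes "i < fst X"
  shows "coord_proj (snd X) i \<in> rfuns K X"
proof -
  have "coord_proj (snd X) i = restrict (\<lambda>x\<in>cube (fst X). x i) (snd X)"
    using unit_polyhedra_cube[OF X] by (auto simp: fun_eq_iff coord_proj_def)
  then show ?thesis
    by (simp only: rfuns_restrict pl_funs_coord[OF K assms])
qed

subsection \<open>Homomorphisms to the unit interval are evaluations\<close>

context
  fixes \<phi> :: "((nat \<Rightarrow> real) \<Rightarrow> real) \<Rightarrow> real"
  assumes \<phi>_zero: "\<phi> (\<lambda>x\<in>snd X. 0) = 0"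
    and \<phi>_neg: "\<And>f. f \<in> rfuns K X \<Longrightarrow> \<phi> (\<lambda>x\<in>snd X. 1 - f x) = 1 - \<phi> f"
    and \<phi>_plus: "\<And>f g. f \<in> rfuns K X \<Longrightarrow> g \<in> rfuns K X \<Longrightarrow> \<phi> (\<lambda>x\<in>snd X. min 1 (f x + g x)) = min 1 (\<phi> f + \<phi> g)"
    and \<phi>_bounds: "\<And>f. f \<in> rfuns K X \<Longrightarrow> 0 \<le> \<phi> f \<and> \<phi> f \<le> 1"
begin

text \<open>The truncated multiple is the \<open>k\<close>-fold sum of \<open>f\<close>. It serves
  to raise a function that is bounded away from \<open>0\<close> to the constant
  \<open>1\<close>.\<close>

lemma hom_multiple:
  assumes f: "f \<in> rfuns K X"
  shows "(\<lambda>x\<in>snd X. min 1 (real k * f x)) \<in> rfuns K X \<and>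
    \<phi> (\<lambda>x\<in>snd X. min 1 (real k * f x)) = min 1 (real k * \<phi> f)"
proof (induction k)
  case 0
  have "(\<lambda>x\<in>snd X. min 1 (real 0 * f x)) = (\<lambda>x\<in>snd X. 0)"
    and "min 1 (real 0 * \<phi> f) = 0"
    by (auto intro: restrict_ext)
  then show ?case
    using rfuns_zero \<phi>_zero by metis
next
  case (Suc k)
  let ?g = "\<lambda>x\<in>snd X. min 1 (real k * f x)"
  have step: "min 1 (min 1 (real k * a) + a) = min 1 (real (Suc k) * a)" if "0 \<le> a" for a :: real
    using that by (auto simp: min_def algebra_simps)
  have "(\<lambda>x\<in>snd X. min 1 (real (Suc k) * f x)) = (\<lambda>x\<in>snd X. min 1 (?g x + f x))"
    using step rfuns_bounds[OF f] by (auto simp: fun_eq_iff)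
  moreover have "min 1 (real (Suc k) * \<phi> f) = min 1 (\<phi> ?g + \<phi> f)"
    unfolding conjunct2[OF Suc] by (rule step[symmetric]) (use \<phi>_bounds[OF f] in simp)
  moreover note rfuns_plus[OF conjunct1[OF Suc] f] \<phi>_plus[OF conjunct1[OF Suc] f]
  ultimately show ?case
    by (simp only: simp_thms)
qed

text \<open>\<open>(a \<oplus> f) \<odot> b\<close> with \<open>a\<close>, \<open>b\<close> the truncations of \<open>k f + m\<close> and \<open>k f + m + 1\<close> is the
  truncation of \<open>(k + 1) f + m\<close>.\<close>

lemma hom_truncation:
  assumes f: "f \<in> rfuns K X"
  shows "(\<lambda>x\<in>snd X. max 0 (min 1 (real k * f x + of_int m))) \<in> rfuns K X \<and>
    \<phi> (\<lambda>x\<in>snd X. max 0 (min 1 (real k * f x + of_int m))) = max 0 (min 1 (real k * \<phi> f + of_int m))"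
proof (induction k arbitrary: m)
  case 0
  \<comment> \<open>A truncated integer is \<open>0\<close> or \<open>1\<close>, so only the two
    constants of the signature occur.\<close>
  have "m \<le> 0 \<or> 1 \<le> m"
    by linarith
  then have m: "max 0 (min 1 (of_int m :: real)) = 0 \<or> max 0 (min 1 (of_int m :: real)) = 1"
    by auto
  have one: "(\<lambda>x\<in>snd X. 1 :: real) = (\<lambda>x\<in>snd X. 1 - (\<lambda>x\<in>snd X. 0) x)"
    by (simp add: fun_eq_iff)
  have "(\<lambda>x\<in>snd X. 1) \<in> rfuns K X \<and> \<phi> (\<lambda>x\<in>snd X. 1) = 1"
    unfolding one using rfuns_neg[OF rfuns_zero] \<phi>_neg[OF rfuns_zero] \<phi>_zero by auto
  note one = this
  have 1: "(\<lambda>x\<in>snd X. max 0 (min 1 (real 0 * f x + of_int m))) = (\<lambda>x\<in>snd X. max 0 (min 1 (of_int m)))"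
    and 2: "max 0 (min 1 (real 0 * \<phi> f + of_int m)) = max 0 (min 1 (of_int m :: real))"
    by (auto intro: restrict_ext)
  show ?case
    unfolding 1 2 using m
  proof
    assume 3: "max 0 (min 1 (of_int m :: real)) = 0"
    show "(\<lambda>x\<in>snd X. max 0 (min 1 (of_int m))) \<in> rfuns K X \<and>
      \<phi> (\<lambda>x\<in>snd X. max 0 (min 1 (of_int m))) = max 0 (min 1 (of_int m))"
      unfolding 3 using rfuns_zero \<phi>_zero by (rule conjI)
  next
    assume 3: "max 0 (min 1 (of_int m :: real)) = 1"
    show "(\<lambda>x\<in>snd X. max 0 (min 1 (of_int m))) \<in> rfuns K X \<and>
      \<phi> (\<lambda>x\<in>snd X. max 0 (min 1 (of_int m))) = max 0 (min 1 (of_int m))"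
      unfolding 3 by (rule one)
  qed
next
  case (Suc k)
  define c where "c = (\<lambda>m. \<lambda>x\<in>snd X. max 0 (min 1 (real k * f x + of_int m)))"
  define d where "d = (\<lambda>x\<in>snd X. min 1 (c m x + f x))"
  \<comment> \<open>The complement of \<open>e\<close> is the product
    \<open>d \<odot> c (m + 1)\<close>. The use of \<open>m + 1\<close> is the reason why the
    induction leaves \<open>m\<close> arbitrary.\<close>
  define e where "e = (\<lambda>x\<in>snd X. min 1 ((\<lambda>x\<in>snd X. 1 - d x) x + (\<lambda>x\<in>snd X. 1 - c (m + 1) x) x))"
  have c: "c m \<in> rfuns K X" "\<phi> (c m) = max 0 (min 1 (real k * \<phi> f + of_int m))" for m
    unfolding c_def using Suc[of m] by blast+
  have d: "d \<in> rfuns K X" "\<phi> d = min 1 (\<phi> (c m) + \<phi> f)"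
    unfolding d_def using c(1) f by (auto intro: rfuns_plus \<phi>_plus)
  have nd: "(\<lambda>x\<in>snd X. 1 - d x) \<in> rfuns K X" "(\<lambda>x\<in>snd X. 1 - c (m + 1) x) \<in> rfuns K X"
    using d(1) c(1) by (auto intro: rfuns_neg)
  have e: "e \<in> rfuns K X" "\<phi> e = min 1 ((1 - \<phi> d) + (1 - \<phi> (c (m + 1))))"
    unfolding e_def using rfuns_plus[OF nd] \<phi>_plus[OF nd] \<phi>_neg[OF d(1)] \<phi>_neg[OF c(1)] by auto
  have step: "1 - min 1 ((1 - min 1 (max 0 (min 1 (real k * a + of_int m)) + a)) +
      (1 - max 0 (min 1 (real k * a + of_int (m + 1))))) = max 0 (min 1 (real (Suc k) * a + of_int m))"
    if "0 \<le> a \<and> a \<le> 1" for a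
  proof -
    have "real (Suc k) * a + of_int m = (real k * a + of_int m) + a"
      by (simp add: algebra_simps)
    moreover have "real k * a + of_int (m + 1) = (real k * a + of_int m) + 1"
      by simp
    moreover have "1 - min 1 ((1 - min 1 (max 0 (min 1 t) + a)) + (1 - max 0 (min 1 (t + 1)))) =
       max 0 (min 1 (t + a))" for t
      using that by (auto simp: min_def max_def)
    ultimately show ?thesis
      by metis
  qed
  have "(\<lambda>x\<in>snd X. max 0 (min 1 (real (Suc k) * f x + of_int m))) = (\<lambda>x\<in>snd X. 1 - e x)"
  proof (rule restrict_ext)
    fix x assume x: "x \<in> snd X"
    show "max 0 (min 1 (real (Suc k) * f x + of_int m)) = 1 - e x"
      unfolding step[OF rfuns_bounds[OF f x], symmetric] using x by (simp add: e_def d_def c_def)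
  qed
  moreover have "1 - \<phi> e = max 0 (min 1 (real (Suc k) * \<phi> f + of_int m))"
    unfolding step[OF \<phi>_bounds[OF f], symmetric] by (simp add: e(2) d(2) c(2))
  moreover note rfuns_neg[OF e(1)] \<phi>_neg[OF e(1)]
  ultimately show ?case
    by (simp only: simp_thms)
qed

text \<open>By compactness it suffices that finitely many elements of the kernel have a common zero.
  Their sum \<open>g\<close> is in the kernel too; if it had no zero, it would be bounded below,
  some multiple of it would be the unit, and \<open>\<phi>\<close> would map the unit both to
  \<open>0\<close> and to \<open>1\<close>.\<close>

lemma hom_kernel_common_zero:
  "\<exists>x\<in>snd X. \<forall>f\<in>rfuns K X. \<phi> f = 0 \<longrightarrow> f x = 0"
proof -
  define T where "T = (\<lambda>f :: (nat \<Rightarrow> real) \<Rightarrow> real. {x \<in> snd X. f x = 0})"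
  define ker where "ker = {f \<in> rfuns K X. \<phi> f = 0}"
  have comp: "compact (snd X)"
    using X compact_zero_set by (simp add: unit_polyhedra_iff)
  have "snd X \<inter> \<Inter>(T ` ker) \<noteq> {}"
  proof (rule compact_imp_fip[OF comp])
    show "closed S" if S: "S \<in> T ` ker" for S
    proof -
      obtain f where f: "f \<in> rfuns K X" "S = T f"
        using S by (auto simp: ker_def)
      have "closed (snd X \<inter> f -` {0})"
        using rfuns_continuous[OF f(1)] compact_imp_closed[OF comp] by (intro continuous_closed_preimage) auto
      moreover have "snd X \<inter> f -` {0} = S"
        by (auto simp: f(2) T_def)
      ultimately show ?thesis by simp
    qed
    fix \<T> assume "finite \<T>" "\<T> \<subseteq> T ` ker"
    then obtain F where F: "finite F" "F \<subseteq> ker" "\<T> = T ` F"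
      by (meson finite_subset_image)
    have "\<exists>g\<in>ker. \<forall>x\<in>snd X. g x = 0 \<longrightarrow> (\<forall>f\<in>F. f x = 0)"
      using F(1,2)
    proof (induction F)
      case empty
      then show ?case
        using rfuns_zero \<phi>_zero by (auto simp: ker_def)
    next
      case (insert f F)
      then obtain g where g: "g \<in> ker" "\<And>x. x \<in> snd X \<Longrightarrow> g x = 0 \<Longrightarrow> \<forall>f\<in>F. f x = 0"
        by auto
      have fg: "f \<in> rfuns K X" "g \<in> rfuns K X" "\<phi> f = 0" "\<phi> g = 0"
        using g(1) insert.prems by (auto simp: ker_def)
      let ?h = "\<lambda>x\<in>snd X. min 1 (f x + g x)"
      have "?h \<in> ker"
        using rfuns_plus[OF fg(1,2)] \<phi>_plus[OF fg(1,2)] fg by (simp add: ker_def)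
      moreover have "f x = 0 \<and> g x = 0" if "x \<in> snd X" "?h x = 0" for x
        using that rfuns_bounds[OF fg(1) that(1)] rfuns_bounds[OF fg(2) that(1)] by (auto simp: min_def split: if_splits)
      ultimately show ?case
        using g(2) by (intro bexI[of _ ?h]) auto
    qed
    then obtain g where g: "g \<in> ker" "\<And>x. x \<in> snd X \<Longrightarrow> g x = 0 \<Longrightarrow> \<forall>f\<in>F. f x = 0"
      by blast
    have gK: "g \<in> rfuns K X" "\<phi> g = 0"
      using g(1) by (auto simp: ker_def)
    have "\<exists>x\<in>snd X. g x = 0"
    proof (rule ccontr)
      assume "\<not> ?thesis"
      then have pos: "0 < g x" if "x \<in> snd X" for x
        using rfuns_bounds[OF gK(1) that] that by force
      \<comment> \<open>For an empty polyhedron any \<open>e\<close> will do: zero and unit of the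
        algebra then coincide, and the contradiction below excludes this case as well.\<close>
      have "\<exists>e>0. \<forall>x\<in>snd X. e \<le> g x"
      proof (cases "snd X = {}")
        case False
        then obtain x0 where "x0 \<in> snd X" "\<forall>x\<in>snd X. g x0 \<le> g x"
          using continuous_attains_inf[OF comp False rfuns_continuous[OF gK(1)]] by blast
        with pos show ?thesis by blast
      qed (auto intro: exI[of _ 1])
      then obtain e where e: "e > 0" "\<And>x. x \<in> snd X \<Longrightarrow> e \<le> g x"
        by blast
      obtain N :: nat where N: "1 < N * e"
        using reals_Archimedean3[OF e(1)] by blast
      have "1 \<le> N * g x" if "x \<in> snd X" for x
        using N mult_left_mono[OF e(2)[OF that], of "real N"] by simp
      then have one: "(\<lambda>x\<in>snd X. min 1 (real N * g x)) = (\<lambda>x\<in>snd X. 1 - (\<lambda>x\<in>snd X. 0) x)"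
        by (auto simp: fun_eq_iff min_def)
      have "\<phi> (\<lambda>x\<in>snd X. min 1 (real N * g x)) = 0"
        using hom_multiple[OF gK(1), of N] gK(2) by simp
      moreover have "\<phi> (\<lambda>x\<in>snd X. min 1 (real N * g x)) = 1"
        unfolding one using \<phi>_neg[OF rfuns_zero] \<phi>_zero by simp
      ultimately show False
        by simp
    qed
    with g(2) show "snd X \<inter> \<Inter>\<T> \<noteq> {}"
      unfolding F(3) by (fastforce simp: T_def)
  qed
  then show ?thesis
    by (auto simp: T_def ker_def)
qed

text \<open>If \<open>f x\<close> exceeded \<open>\<phi> f\<close>, a multiple would separate the
  two values by an integer, and the corresponding truncation would lie in the kernel without
  vanishing at \<open>x\<close>. The same argument for \<open>1 - f\<close> gives the reverse
  inequality.\<close>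

lemma hom_is_evaluation: "\<exists>x\<in>snd X. \<forall>f\<in>rfuns K X. \<phi> f = f x"
proof -
  obtain x where x: "x \<in> snd X" and ker: "\<And>f. f \<in> rfuns K X \<Longrightarrow> \<phi> f = 0 \<Longrightarrow> f x = 0"
    using hom_kernel_common_zero by blast
  have le: "f x \<le> \<phi> f" if f: "f \<in> rfuns K X" for f
  proof (rule ccontr)
    assume "\<not> ?thesis"
    then have less: "0 < f x - \<phi> f"
      by simp
    then obtain k :: nat where k: "1 < k * (f x - \<phi> f)"
      using reals_Archimedean3 by blast
    \<comment> \<open>The gap between \<open>k * \<phi> f\<close> and \<open>k * f x\<close> is
      larger than \<open>1\<close>, so rounding up \<open>k * \<phi> f\<close> gives an integer that
      is still below \<open>k * f x\<close>.\<close>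
    define m where "m = - \<lceil>k * \<phi> f\<rceil>"
    have "k * \<phi> f + of_int m \<le> 0" "0 < k * f x + of_int m"
      using k unfolding m_def right_diff_distrib by linarith+
    then show False
      using ker[of "\<lambda>x\<in>snd X. max 0 (min 1 (real k * f x + of_int m))"] hom_truncation[OF f, of k m] x by simp
  qed
  have "\<phi> f = f x" if f: "f \<in> rfuns K X" for f
    using le[OF f] le[OF rfuns_neg[OF f]] \<phi>_neg[OF f] x by simp
  with x show ?thesis by blast
qed

end

end

end

subsection \<open>Pullbacks along integral maps\<close>

definition pullback ::
  "real set \<Rightarrow> polyhedron \<Rightarrow> polyhedron \<Rightarrow> ((nat \<Rightarrow> real) \<Rightarrow> nat \<Rightarrow> real) \<Rightarrow>
   ((nat \<Rightarrow> real) \<Rightarrow> real) \<Rightarrow> (nat \<Rightarrow> real) \<Rightarrow> real" where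
  "pullback K X Y z = (\<lambda>f\<in>rfuns K X. compose (snd Y) f z)"

lemma pullback_apply: "f \<in> rfuns K X \<Longrightarrow> y \<in> snd Y \<Longrightarrow> pullback K X Y z f y = f (z y)"
  by (simp add: pullback_def compose_def)

context
  fixes K :: "real set"
  assumes K: "unital_subring K"
begin

text \<open>\<open>f\<close> and the components of \<open>z\<close> extend to whole cubes, where
  \<open>pl_funs_compose\<close> applies; the integral components are admissible because
  \<open>K\<close> contains \<open>\<int>\<close>.\<close>

lemma rfuns_compose:
  assumes X: "X \<in> unit_polyhedra" and Y: "Y \<in> unit_polyhedra"
    and z: "z \<in> Z_maps Y X" and f: "f \<in> rfuns K X"
  shows "compose (snd Y) f z \<in> rfuns K Y"
proof -
  obtain g where g: "g \<in> pl_funs K (fst X)" "f = restrict g (snd X)"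
    using f by (rule rfunsE)
  have "\<forall>i\<in>{..<fst X}. \<exists>h. h \<in> MV (fst Y) \<and> (\<lambda>y\<in>snd Y. z y i) = restrict h (snd Y)"
    using z unfolding Z_maps_iff by (metis lessThan_iff rfunsE)
  from bchoice[OF this] obtain h where h: "\<And>i. i < fst X \<Longrightarrow> h i \<in> MV (fst Y)"
    "\<And>i. i < fst X \<Longrightarrow> (\<lambda>y\<in>snd Y. z y i) = restrict (h i) (snd Y)"
    by auto
  have zh: "z y = (\<lambda>i. if i < fst X then h i y else 0)" if y: "y \<in> snd Y" for y
  proof
    fix i
    have "z y \<in> cube (fst X)"
      using z y unit_polyhedra_cube[OF X] by (auto simp: Z_maps_iff)
    then show "z y i = (if i < fst X then h i y else 0)"
      using fun_cong[OF h(2), of i y] y by (auto simp: cube_def)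
  qed
  have "compose (snd Y) f z = restrict (\<lambda>y\<in>cube (fst Y). g (\<lambda>i. if i < fst X then h i y else 0)) (snd Y)"
  proof (rule extensionalityI[of _ "snd Y"])
    fix y assume y: "y \<in> snd Y"
    then have "z y \<in> snd X" "y \<in> cube (fst Y)"
      using z unit_polyhedra_cube[OF Y] by (auto simp: Z_maps_iff)
    then show "compose (snd Y) f z y = restrict (\<lambda>y\<in>cube (fst Y). g (\<lambda>i. if i < fst X then h i y else 0)) (snd Y) y"
      using y g(2) by (simp add: compose_def zh[symmetric])
  qed (auto simp: compose_def)
  moreover have "(\<lambda>y\<in>cube (fst Y). g (\<lambda>i. if i < fst X then h i y else 0)) \<in> pl_funs K (fst Y)"
    using h(1) pl_funs_mono_int[OF K] by (intro pl_funs_compose[OF K g(1)]) auto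
  ultimately show ?thesis
    by (simp only: rfuns_restrict)
qed

lemma pullback_in_hom:
  assumes X: "X \<in> unit_polyhedra" and Y: "Y \<in> unit_polyhedra" and z: "z \<in> Z_maps Y X"
    and S: "S \<subseteq> K \<inter> {0..1}"
  shows "pullback K X Y z \<in> scalar_mv_hom S (falg K X) (falg K Y)"
proof -
  have zin: "z y \<in> snd X" if "y \<in> snd Y" for y
    using z that by (auto simp: Z_maps_iff)
  have "pullback K X Y z \<in> rfuns K X \<rightarrow>\<^sub>E rfuns K Y"
    using rfuns_compose[OF X Y z] by (auto simp: pullback_def)
  moreover have "pullback K X Y z (\<lambda>x\<in>snd X. 0) = (\<lambda>x\<in>snd Y. 0)"
    using rfuns_zero[OF X K] zin by (auto simp: pullback_def compose_def fun_eq_iff)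
  moreover have "pullback K X Y z (\<lambda>x\<in>snd X. 1 - f x) = (\<lambda>y\<in>snd Y. 1 - pullback K X Y z f y)"
    if "f \<in> rfuns K X" for f
    using that rfuns_neg[OF X K] zin by (auto simp: pullback_def compose_def fun_eq_iff)
  moreover have "pullback K X Y z (\<lambda>x\<in>snd X. min 1 (f x + g x)) =
     (\<lambda>y\<in>snd Y. min 1 (pullback K X Y z f y + pullback K X Y z g y))"
    if "f \<in> rfuns K X" "g \<in> rfuns K X" for f g
    using that rfuns_plus[OF X K] zin by (auto simp: pullback_def compose_def fun_eq_iff)
  moreover have "pullback K X Y z (\<lambda>x\<in>snd X. r * f x) = (\<lambda>y\<in>snd Y. r * pullback K X Y z f y)"
    if "r \<in> S" "f \<in> rfuns K X" for r f
  proof -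
    have "r \<in> K" "0 \<le> r" "r \<le> 1"
      using that(1) S by auto
    then show ?thesis
      using that(2) rfuns_scale[OF X K that(2)] zin by (auto simp: pullback_def compose_def fun_eq_iff)
  qed
  ultimately show ?thesis
    by (simp add: scalar_mv_hom_def mv_hom_def)
qed

lemma pullback_coord_proj:
  assumes X: "X \<in> unit_polyhedra" and z: "z \<in> Z_maps Y X" and i: "i < fst X"
  shows "pullback K X Y z (coord_proj (snd X) i) = (\<lambda>y\<in>snd Y. z y i)"
  using rfuns_coord[OF X K i] z
  by (auto simp: pullback_def compose_def fun_eq_iff coord_proj_def Z_maps_iff)

lemma pullback_integral:
  assumes "X \<in> unit_polyhedra" "z \<in> Z_maps Y X"
  shows "integral_on_generators X Y (pullback K X Y z)"
  using assms pullback_coord_proj[OF assms] by (simp add: integral_on_generators_iff Z_maps_iff)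

text \<open>The pullbacks of the coordinate functions are the components of the map, and coordinates
  from the dimension on vanish throughout the cube.\<close>

lemma inj_on_pullback:
  assumes X: "X \<in> unit_polyhedra"
  shows "inj_on (pullback K X Y) (Z_maps Y X)"
proof (rule inj_onI)
  fix z w assume zw: "z \<in> Z_maps Y X" "w \<in> Z_maps Y X" "pullback K X Y z = pullback K X Y w"
  show "z = w"
  proof (rule extensionalityI[of _ "snd Y"])
    fix y assume y: "y \<in> snd Y"
    show "z y = w y"
    proof
      fix i
      show "z y i = w y i"
      proof (cases "i < fst X")
        case True
        have "(\<lambda>y\<in>snd Y. z y i) y = (\<lambda>y\<in>snd Y. w y i) y"
          using pullback_coord_proj[OF X zw(1) True] pullback_coord_proj[OF X zw(2) True] zw(3) by simp
        then show ?thesis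
          using y by simp
      next
        case False
        have "z y \<in> cube (fst X)" "w y \<in> cube (fst X)"
          using zw(1,2) y unit_polyhedra_cube[OF X] by (auto simp: Z_maps_iff)
        with False show ?thesis
          by (simp add: cube_def)
      qed
    qed
  qed (use zw in \<open>auto simp: Z_maps_iff PiE_iff\<close>)
qed

text \<open>For fixed \<open>y\<close> the map sending \<open>f\<close> to
  \<open>\<sigma> f y\<close> is a homomorphism to the unit interval, hence evaluation at a point
  \<open>z y\<close>. The components of \<open>z\<close> are the images of the generators, so
  integrality on generators says that \<open>z\<close> is an integral map.\<close>

lemma hom_eq_pullback:
  assumes X: "X \<in> unit_polyhedra" and Y: "Y \<in> unit_polyhedra"
    and \<sigma>: "\<sigma> \<in> mv_hom (falg K X) (falg K Y)" and int: "integral_on_generators X Y \<sigma>"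
  shows "\<exists>z\<in>Z_maps Y X. \<sigma> = pullback K X Y z"
proof -
  have \<sigma>E: "\<sigma> \<in> rfuns K X \<rightarrow>\<^sub>E rfuns K Y"
    using \<sigma> by (simp add: mv_hom_def)
  then have \<sigma>in: "\<sigma> f \<in> rfuns K Y" if "f \<in> rfuns K X" for f
    using that by auto
  have "\<exists>x\<in>snd X. \<forall>f\<in>rfuns K X. \<sigma> f y = f x" if y: "y \<in> snd Y" for y
    using hom_is_evaluation[OF X K, of "\<lambda>f. \<sigma> f y"] \<sigma> y rfuns_bounds[OF Y \<sigma>in]
    by (simp add: mv_hom_def)
  then obtain z where z: "\<And>y. y \<in> snd Y \<Longrightarrow> z y \<in> snd X"
    "\<And>y f. y \<in> snd Y \<Longrightarrow> f \<in> rfuns K X \<Longrightarrow> \<sigma> f y = f (z y)"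
    by metis
  let ?z = "restrict z (snd Y)"
  have "?z \<in> Z_maps Y X"
    unfolding Z_maps_iff
  proof (intro conjI allI impI)
    show "?z \<in> snd Y \<rightarrow>\<^sub>E snd X"
      using z(1) by auto
    fix i assume i: "i < fst X"
    have \<sigma>i: "\<sigma> (coord_proj (snd X) i) \<in> rfuns \<int> Y"
      using int i by (simp add: integral_on_generators_iff)
    have "(\<lambda>y\<in>snd Y. ?z y i) = \<sigma> (coord_proj (snd X) i)"
    proof (rule extensionalityI[of _ "snd Y"])
      fix y assume "y \<in> snd Y"
      then show "(\<lambda>y\<in>snd Y. ?z y i) y = \<sigma> (coord_proj (snd X) i) y"
        using z(2)[OF _ rfuns_coord[OF X K i]] z(1) by (simp add: coord_proj_def)
    qed (use rfuns_extensional[OF \<sigma>i] in auto)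
    with \<sigma>i show "(\<lambda>y\<in>snd Y. ?z y i) \<in> rfuns \<int> Y"
      by simp
  qed
  moreover have "\<sigma> = pullback K X Y ?z"
  proof (rule extensionalityI[of _ "rfuns K X"])
    fix f assume f: "f \<in> rfuns K X"
    show "\<sigma> f = pullback K X Y ?z f"
    proof (rule extensionalityI[of _ "snd Y"])
      show "\<sigma> f y = pullback K X Y ?z f y" if "y \<in> snd Y" for y
        using that z(2) f by (simp add: pullback_apply)
    qed (use f rfuns_extensional[OF \<sigma>in[OF f]] in \<open>auto simp: pullback_def compose_def\<close>)
  qed (use \<sigma>E in \<open>auto simp: PiE_iff pullback_def\<close>)
  ultimately show ?thesis
    by blast
qed

lemma pullback_compose:
  assumes X: "X \<in> unit_polyhedra" and Y: "Y \<in> unit_polyhedra"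
    and z: "z \<in> Z_maps Y X" and w: "w \<in> Z_maps W Y"
  shows "compose (rfuns K X) (pullback K Y W w) (pullback K X Y z) = pullback K X W (compose (snd W) z w)"
proof (rule extensionalityI[of _ "rfuns K X"])
  fix f assume f: "f \<in> rfuns K X"
  have "w y \<in> snd Y" if "y \<in> snd W" for y
    using w that by (auto simp: Z_maps_iff)
  with f rfuns_compose[OF X Y z f]
  show "compose (rfuns K X) (pullback K Y W w) (pullback K X Y z) f = pullback K X W (compose (snd W) z w) f"
    by (auto simp: compose_def pullback_def fun_eq_iff)
qed (auto simp: compose_def pullback_def)

lemma pullback_id:
  assumes "snd X = snd Y"
  shows "pullback K X Y (\<lambda>x\<in>snd X. x) = (\<lambda>f\<in>rfuns K X. f)"
proof (rule extensionalityI[of _ "rfuns K X"])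
  fix f assume f: "f \<in> rfuns K X"
  show "pullback K X Y (\<lambda>x\<in>snd X. x) f = (\<lambda>f\<in>rfuns K X. f) f"
    using f rfuns_extensional[OF f] assms
    by (auto simp: pullback_def compose_def fun_eq_iff extensional_def)
qed (auto simp: pullback_def)

end

text \<open>The two ambient dimensions may differ: coordinates that one presentation has in excess
  are \<open>0\<close> on the common set.\<close>

lemma Z_maps_id:
  assumes X: "X \<in> unit_polyhedra" and Y: "Y \<in> unit_polyhedra" and XY: "snd X = snd Y"
  shows "(\<lambda>x\<in>snd X. x) \<in> Z_maps Y X"
  unfolding Z_maps_iff
proof (intro conjI allI impI)
  note int = unital_subring_instances(3)
  fix i
  show "(\<lambda>y\<in>snd Y. (\<lambda>x\<in>snd X. x) y i) \<in> rfuns \<int> Y"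
  proof (cases "i < fst Y")
    case True
    have "(\<lambda>y\<in>snd Y. (\<lambda>x\<in>snd X. x) y i) = coord_proj (snd Y) i"
      by (auto simp: coord_proj_def XY fun_eq_iff)
    with rfuns_coord[OF Y int True] show ?thesis by simp
  next
    case False
    then have "(\<lambda>y\<in>snd Y. (\<lambda>x\<in>snd X. x) y i) = (\<lambda>x\<in>snd Y. 0)"
      using unit_polyhedra_cube[OF Y] by (auto simp: XY fun_eq_iff cube_def)
    with rfuns_zero[OF Y int] show ?thesis by simp
  qed
qed (use XY in auto)

lemma Z_maps_compose:
  assumes Y: "Y \<in> unit_polyhedra" and W: "W \<in> unit_polyhedra"
    and z: "z \<in> Z_maps Y X" and w: "w \<in> Z_maps W Y"
  shows "compose (snd W) z w \<in> Z_maps W X"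
  unfolding Z_maps_iff
proof (intro conjI allI impI)
  have wY: "w y \<in> snd Y" if "y \<in> snd W" for y
    using w that by (auto simp: Z_maps_iff)
  then show "compose (snd W) z w \<in> snd W \<rightarrow>\<^sub>E snd X"
    using z by (auto simp: Z_maps_iff compose_def)
  fix i assume "i < fst X"
  then have "(\<lambda>y\<in>snd Y. z y i) \<in> rfuns \<int> Y"
    using z by (simp add: Z_maps_iff)
  from rfuns_compose[OF unital_subring_instances(3) Y W w this]
  have "compose (snd W) (\<lambda>y\<in>snd Y. z y i) w \<in> rfuns \<int> W" .
  moreover have "compose (snd W) (\<lambda>y\<in>snd Y. z y i) w = (\<lambda>x\<in>snd W. compose (snd W) z w x i)"
    using wY by (auto simp: compose_def fun_eq_iff)
  ultimately show "(\<lambda>x\<in>snd W. compose (snd W) z w x i) \<in> rfuns \<int> W"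
    by simp
qed

lemma is_category_RatPol: "is_category RatPol"
proof -
  have E: "z \<in> snd Y \<rightarrow>\<^sub>E snd X" if "z \<in> Z_maps Y X" for X Y z
    using that by (simp add: Z_maps_iff)
  have "compose (snd A) f (\<lambda>x\<in>snd A. x) = f" "compose (snd A) (\<lambda>x\<in>snd B. x) f = f"
    if "f \<in> Z_maps A B" for A B f
    using E[OF that] compose_Id[of f "snd A" "snd B"] Id_compose[of f "snd A" "snd B"]
    by (auto simp: PiE_iff compose_def fun_eq_iff extensional_def)
  moreover have "compose (snd A) h (compose (snd A) g f) = compose (snd A) (compose (snd B) h g) f"
    if "f \<in> Z_maps A B" for A B f g h
    using E[OF that] by (intro compose_assoc) auto
  ultimately show ?thesis
    unfolding is_category_def RatPol_def by (auto intro: Z_maps_id Z_maps_compose)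
qed

subsection \<open>The categories of function algebras\<close>

definition alg_cat :: "real set \<Rightarrow> real set \<Rightarrow>
  (((nat \<Rightarrow> real) \<Rightarrow> real) scalar_mv, ((nat \<Rightarrow> real) \<Rightarrow> real) \<Rightarrow> (nat \<Rightarrow> real) \<Rightarrow> real) cat" where
  "alg_cat K S =
     \<lparr>cat_obj = falg K ` unit_polyhedra,
      cat_hom = (\<lambda>A B. {\<sigma> \<in> scalar_mv_hom S A B.
        \<exists>X\<in>unit_polyhedra. \<exists>Y\<in>unit_polyhedra.
          A = falg K X \<and> B = falg K Y \<and> integral_on_generators X Y \<sigma>}),
      cat_id = (\<lambda>A. \<lambda>f\<in>mv_carrier A. f),
      cat_comp = (\<lambda>A B D \<tau> \<sigma>. compose (mv_carrier A) \<tau> \<sigma>)\<rparr>"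

lemma alg_cat_instances:
  "DMV_fp_c' = alg_cat \<rat> ({0..1} \<inter> \<rat>)" "RMV_fp_c' = alg_cat UNIV {0..1}"
proof -
  have "DMV_alg = falg \<rat>" "RMV_alg = falg UNIV"
    by (auto simp: DMV_alg_def RMV_alg_def falg_def rfuns_def fun_eq_iff)
  then show "DMV_fp_c' = alg_cat \<rat> ({0..1} \<inter> \<rat>)" "RMV_fp_c' = alg_cat UNIV {0..1}"
    by (simp_all add: DMV_fp_c'_def RMV_fp_c'_def alg_cat_def)
qed

text \<open>The zero and the unit of \<open>falg K X\<close> differ precisely on the polyhedron (outside it both
  take the value \<open>undefined\<close>).\<close>

lemma falg_determines_polyhedron:
  assumes "falg K X = falg K Y"
  shows "snd X = snd Y"
proof -
  have "snd X = {x. mv_neg (falg K X) (mv_zero (falg K X)) x \<noteq> mv_zero (falg K X) x}" for X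
    by (auto simp: restrict_def)
  then show ?thesis
    using assms by metis
qed

text \<open>Compose with identity maps between two presentations of the same set. This is needed
  because a morphism of function algebras is only required to be integral for some presentation of
  its source and target.\<close>

lemma Z_maps_cong:
  assumes "X \<in> unit_polyhedra" "Y \<in> unit_polyhedra" "X' \<in> unit_polyhedra" "Y' \<in> unit_polyhedra"
    and "snd X = snd X'" "snd Y = snd Y'" "z \<in> Z_maps Y X"
  shows "z \<in> Z_maps Y' X'"
proof -
  have z: "z \<in> snd Y \<rightarrow>\<^sub>E snd X"
    using assms(7) by (simp add: Z_maps_iff)
  have "compose (snd Y') z (\<lambda>y\<in>snd Y. y) \<in> Z_maps Y' X"
    using assms Z_maps_id[of Y Y'] by (intro Z_maps_compose[of Y]) auto
  moreover have "compose (snd Y') z (\<lambda>y\<in>snd Y. y) = z"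
    using z assms(6) by (auto simp: compose_def fun_eq_iff PiE_iff extensional_def)
  ultimately have "compose (snd Y') (\<lambda>x\<in>snd X'. x) z \<in> Z_maps Y' X'"
    using assms Z_maps_id[of X' X] by (intro Z_maps_compose[of X]) auto
  moreover have "compose (snd Y') (\<lambda>x\<in>snd X'. x) z = z"
    using z assms(5,6) by (auto simp: compose_def fun_eq_iff PiE_iff extensional_def)
  ultimately show ?thesis by simp
qed

context
  fixes K S :: "real set"
  assumes K: "unital_subring K" and S: "S \<subseteq> K \<inter> {0..1}"
begin

text \<open>The presentations hidden in a morphism have the same underlying sets as \<open>X\<close>
  and \<open>Y\<close>, and \<open>pullback\<close> depends on no more than these sets and the
  carrier, so the map found for them works for \<open>X\<close> and \<open>Y\<close>.\<close>

lemma alg_cat_hom: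
  assumes X: "X \<in> unit_polyhedra" and Y: "Y \<in> unit_polyhedra"
  shows "cat_hom (alg_cat K S) (falg K X) (falg K Y) = pullback K X Y ` Z_maps Y X"
proof (intro subset_antisym subsetI)
  fix \<sigma> assume "\<sigma> \<in> cat_hom (alg_cat K S) (falg K X) (falg K Y)"
  then obtain X' Y' where XY': "X' \<in> unit_polyhedra" "Y' \<in> unit_polyhedra"
    "falg K X = falg K X'" "falg K Y = falg K Y'" "integral_on_generators X' Y' \<sigma>"
    and \<sigma>: "\<sigma> \<in> mv_hom (falg K X) (falg K Y)"
    by (auto simp: alg_cat_def scalar_mv_hom_def)
  obtain z where z: "z \<in> Z_maps Y' X'" "\<sigma> = pullback K X' Y' z"
    using hom_eq_pullback[OF K XY'(1,2) _ XY'(5)] \<sigma> XY'(3,4) by auto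
  have same: "snd X' = snd X" "snd Y' = snd Y"
    using XY'(3,4) falg_determines_polyhedron by metis+
  have "rfuns K X' = rfuns K X"
    using XY'(3) falg_simps(1) by metis
  then have "\<sigma> = pullback K X Y z"
    unfolding z(2) pullback_def same by simp
  moreover have "z \<in> Z_maps Y X"
    using Z_maps_cong[OF XY'(1,2) X Y same z(1)] .
  ultimately show "\<sigma> \<in> pullback K X Y ` Z_maps Y X"
    by blast
next
  fix \<sigma> assume "\<sigma> \<in> pullback K X Y ` Z_maps Y X"
  then show "\<sigma> \<in> cat_hom (alg_cat K S) (falg K X) (falg K Y)"
    using X Y pullback_in_hom[OF K X Y _ S] pullback_integral[OF K X]
    unfolding alg_cat_def by simp blast
qed

lemma is_category_alg_cat: "is_category (alg_cat K S)"
proof -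
  have obj: "cat_obj (alg_cat K S) = falg K ` unit_polyhedra"
    and comp: "cat_comp (alg_cat K S) = (\<lambda>A B D \<tau> \<sigma>. compose (mv_carrier A) \<tau> \<sigma>)"
    and id: "cat_id (alg_cat K S) = (\<lambda>A. \<lambda>f\<in>mv_carrier A. f)"
    by (simp_all add: alg_cat_def)
  have E: "\<sigma> \<in> rfuns K X \<rightarrow>\<^sub>E rfuns K Y"
    if "\<sigma> \<in> pullback K X Y ` Z_maps Y X" "X \<in> unit_polyhedra" "Y \<in> unit_polyhedra" for X Y \<sigma>
  proof -
    have "\<sigma> \<in> scalar_mv_hom S (falg K X) (falg K Y)"
      using that(1) pullback_in_hom[OF K that(2,3) _ S] by blast
    then show ?thesis
      by (simp add: scalar_mv_hom_def mv_hom_def)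
  qed
  have unit: "compose (rfuns K X) \<sigma> (\<lambda>f\<in>rfuns K X. f) = \<sigma>" "compose (rfuns K X) (\<lambda>f\<in>rfuns K Y. f) \<sigma> = \<sigma>"
    if "\<sigma> \<in> pullback K X Y ` Z_maps Y X" "X \<in> unit_polyhedra" "Y \<in> unit_polyhedra" for X Y \<sigma>
    using E[OF that] by (auto simp: PiE_iff compose_def fun_eq_iff extensional_def)
  have assoc: "compose (rfuns K X) h (compose (rfuns K X) g \<sigma>) = compose (rfuns K X) (compose (rfuns K Y) h g) \<sigma>"
    if "\<sigma> \<in> pullback K X Y ` Z_maps Y X" "X \<in> unit_polyhedra" "Y \<in> unit_polyhedra" for X Y \<sigma> g h
    using E[OF that] by (intro compose_assoc) auto
  have closed: "compose (rfuns K X) \<tau> \<sigma> \<in> pullback K X W ` Z_maps W X"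
    if "\<sigma> \<in> pullback K X Y ` Z_maps Y X" "\<tau> \<in> pullback K Y W ` Z_maps W Y"
      "X \<in> unit_polyhedra" "Y \<in> unit_polyhedra" "W \<in> unit_polyhedra" for X Y W \<sigma> \<tau>
  proof -
    note \<sigma>\<tau> = that(1,2)
    obtain z w where zw: "z \<in> Z_maps Y X" "\<sigma> = pullback K X Y z" "w \<in> Z_maps W Y" "\<tau> = pullback K Y W w"
      using \<sigma>\<tau> by blast
    then have "compose (rfuns K X) \<tau> \<sigma> = pullback K X W (compose (snd W) z w)"
      using pullback_compose[OF K that(3,4)] by simp
    with Z_maps_compose[OF that(4,5) zw(1,3)] show ?thesis
      by simp
  qed
  have identity: "(\<lambda>f\<in>rfuns K X. f) \<in> pullback K X X ` Z_maps X X" if "X \<in> unit_polyhedra" for X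
    using pullback_id[OF K, of X X] Z_maps_id[OF that that] by (metis imageI)
  show ?thesis
    unfolding is_category_def obj comp id ball_simps(9)
    using closed unit identity by (simp add: alg_cat_hom) (intro ballI assoc, auto)
qed

text \<open>Every object of the target is by definition the algebra of some polyhedron, so essential
  surjectivity needs only identities; the bijections on hom-sets are the content of the preceding
  section.\<close>

lemma equivalence_functor_alg_cat:
  "equivalence_functor (op_cat RatPol) (alg_cat K S) \<lparr>f_obj = falg K, f_mor = pullback K\<rparr>"
proof -
  have op: "cat_obj (op_cat RatPol) = unit_polyhedra" "cat_hom (op_cat RatPol) = (\<lambda>X Y. Z_maps Y X)"
    "cat_id (op_cat RatPol) = (\<lambda>X. \<lambda>x\<in>snd X. x)"
    "cat_comp (op_cat RatPol) = (\<lambda>X Y W w z. compose (snd W) z w)"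
    by (simp_all add: op_cat_def RatPol_def)
  have alg: "cat_obj (alg_cat K S) = falg K ` unit_polyhedra"
    "cat_comp (alg_cat K S) = (\<lambda>A B D \<tau> \<sigma>. compose (mv_carrier A) \<tau> \<sigma>)"
    "cat_id (alg_cat K S) = (\<lambda>A. \<lambda>f\<in>mv_carrier A. f)"
    by (simp_all add: alg_cat_def)
  have "is_functor (op_cat RatPol) (alg_cat K S) \<lparr>f_obj = falg K, f_mor = pullback K\<rparr>"
    unfolding is_functor_def op alg
    by (simp add: alg_cat_hom pullback_id[OF K] pullback_compose[OF K])
  moreover have "bij_betw (pullback K X Y) (Z_maps Y X) (cat_hom (alg_cat K S) (falg K X) (falg K Y))"
    if "X \<in> unit_polyhedra" "Y \<in> unit_polyhedra" for X Y
    using inj_on_pullback[OF K that(1)] by (simp add: alg_cat_hom that bij_betw_def)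
  moreover have "\<exists>e. cat_iso (alg_cat K S) (falg K X) (falg K X) e" if "X \<in> unit_polyhedra" for X
    using cat_iso_id[OF is_category_alg_cat] that by (auto simp: alg)
  ultimately show ?thesis
    unfolding equivalence_functor_def op alg by (simp only: ball_simps(9) fctr.simps) blast
qed

end

section \<open>Finitely presented MV-algebras\<close>

text \<open>Suffices to compose and invert homomorphisms, and can be established for quotients
  before the identities of MV-algebras are known there.\<close>

definition mv_closed :: "('a, 'z) mv_scheme \<Rightarrow> bool" where
  "mv_closed A \<longleftrightarrow> mv_zero A \<in> mv_carrier A \<and> (\<forall>x\<in>mv_carrier A. mv_neg A x \<in> mv_carrier A) \<and>
     (\<forall>x\<in>mv_carrier A. \<forall>y\<in>mv_carrier A. mv_plus A x y \<in> mv_carrier A)"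

lemma mv_algebra_closed: "mv_algebra A \<Longrightarrow> mv_closed A"
  by (simp add: mv_algebra_def mv_closed_def)

lemma mv_hom_in: "\<sigma> \<in> mv_hom A B \<Longrightarrow> x \<in> mv_carrier A \<Longrightarrow> \<sigma> x \<in> mv_carrier B"
  by (auto simp: mv_hom_def)

lemma mv_closedD:
  assumes "mv_closed A"
  shows "mv_zero A \<in> mv_carrier A" "x \<in> mv_carrier A \<Longrightarrow> mv_neg A x \<in> mv_carrier A"
    "x \<in> mv_carrier A \<Longrightarrow> y \<in> mv_carrier A \<Longrightarrow> mv_plus A x y \<in> mv_carrier A"
  using assms by (auto simp: mv_closed_def)

lemma mv_homD:
  assumes "\<sigma> \<in> mv_hom A B"
  shows "\<sigma> (mv_zero A) = mv_zero B" "x \<in> mv_carrier A \<Longrightarrow> \<sigma> (mv_neg A x) = mv_neg B (\<sigma> x)"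
    "x \<in> mv_carrier A \<Longrightarrow> y \<in> mv_carrier A \<Longrightarrow> \<sigma> (mv_plus A x y) = mv_plus B (\<sigma> x) (\<sigma> y)"
  using assms by (auto simp: mv_hom_def)

lemma mv_homI:
  assumes "\<And>x. x \<in> mv_carrier A \<Longrightarrow> \<sigma> x \<in> mv_carrier B" "\<sigma> \<in> extensional (mv_carrier A)"
    "\<sigma> (mv_zero A) = mv_zero B" "\<And>x. x \<in> mv_carrier A \<Longrightarrow> \<sigma> (mv_neg A x) = mv_neg B (\<sigma> x)"
    "\<And>x y. x \<in> mv_carrier A \<Longrightarrow> y \<in> mv_carrier A \<Longrightarrow> \<sigma> (mv_plus A x y) = mv_plus B (\<sigma> x) (\<sigma> y)"
  shows "\<sigma> \<in> mv_hom A B"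
  using assms by (auto simp: mv_hom_def PiE_iff)

lemma mv_hom_eqI:
  assumes "\<sigma> \<in> mv_hom A B" "\<tau> \<in> mv_hom A B" "\<And>x. x \<in> mv_carrier A \<Longrightarrow> \<sigma> x = \<tau> x"
  shows "\<sigma> = \<tau>"
  using assms by (intro extensionalityI[of _ "mv_carrier A"]) (auto simp: mv_hom_def PiE_iff)

lemma mv_hom_compose:
  assumes A: "mv_closed A" and \<sigma>: "\<sigma> \<in> mv_hom A B" and \<tau>: "\<tau> \<in> mv_hom B C"
  shows "compose (mv_carrier A) \<tau> \<sigma> \<in> mv_hom A C"
  by (rule mv_homI)
    (simp_all add: compose_def mv_closedD[OF A] mv_homD[OF \<sigma>] mv_homD[OF \<tau>] mv_hom_in[OF \<sigma>] mv_hom_in[OF \<tau>])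

lemma mv_hom_id:
  assumes "mv_closed A"
  shows "(\<lambda>x\<in>mv_carrier A. x) \<in> mv_hom A A"
  using assms by (simp add: mv_hom_def mv_closed_def)

lemma mv_hom_inverse:
  assumes A: "mv_closed A" and \<sigma>: "\<sigma> \<in> mv_hom A B" and bij: "bij_betw \<sigma> (mv_carrier A) (mv_carrier B)"
  shows "restrict (inv_into (mv_carrier A) \<sigma>) (mv_carrier B) \<in> mv_hom B A" (is "?\<tau> \<in> _")
proof -
  have inj: "inj_on \<sigma> (mv_carrier A)" and surj: "\<sigma> ` mv_carrier A = mv_carrier B"
    using bij by (auto simp: bij_betw_def)
  have \<tau>: "?\<tau> (\<sigma> x) = x" if "x \<in> mv_carrier A" for x
    using that inj mv_hom_in[OF \<sigma> that] by simp
  show ?thesis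
  proof (rule mv_homI)
    show "?\<tau> (mv_zero B) = mv_zero A"
      using \<tau>[OF mv_closedD(1)[OF A]] by (simp only: mv_homD(1)[OF \<sigma>])
    fix x assume "x \<in> mv_carrier B"
    then obtain x' where x': "x' \<in> mv_carrier A" "x = \<sigma> x'"
      using surj by blast
    show "?\<tau> x \<in> mv_carrier A"
      using \<tau>[OF x'(1)] x' by (simp only:)
    show "?\<tau> (mv_neg B x) = mv_neg A (?\<tau> x)"
      using \<tau>[OF mv_closedD(2)[OF A x'(1)]] by (simp only: mv_homD(2)[OF \<sigma> x'(1)] x'(2) \<tau>[OF x'(1)])
    fix y assume "y \<in> mv_carrier B"
    then obtain y' where y': "y' \<in> mv_carrier A" "y = \<sigma> y'"
      using surj by blast
    show "?\<tau> (mv_plus B x y) = mv_plus A (?\<tau> x) (?\<tau> y)"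
      using \<tau>[OF mv_closedD(3)[OF A x'(1) y'(1)]]
      by (simp only: mv_homD(3)[OF \<sigma> x'(1) y'(1)] x'(2) y'(2) \<tau>[OF x'(1)] \<tau>[OF y'(1)])
  qed simp
qed

lemma mv_isomorphic_sym:
  assumes "mv_closed A" "mv_isomorphic A B"
  shows "mv_isomorphic B A"
proof -
  obtain \<sigma> where \<sigma>: "\<sigma> \<in> mv_hom A B" "bij_betw \<sigma> (mv_carrier A) (mv_carrier B)"
    using assms(2) by (auto simp: mv_isomorphic_def)
  have "bij_betw (restrict (inv_into (mv_carrier A) \<sigma>) (mv_carrier B)) (mv_carrier B) (mv_carrier A)"
    using bij_betw_inv_into[OF \<sigma>(2)] by (simp cong: bij_betw_cong)
  with mv_hom_inverse[OF assms(1) \<sigma>] show ?thesis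
    unfolding mv_isomorphic_def by blast
qed

lemma mv_isomorphic_trans:
  assumes "mv_closed A" "mv_isomorphic A B" "mv_isomorphic B C"
  shows "mv_isomorphic A C"
proof -
  obtain \<sigma> \<tau> where \<sigma>: "\<sigma> \<in> mv_hom A B" "bij_betw \<sigma> (mv_carrier A) (mv_carrier B)"
    and \<tau>: "\<tau> \<in> mv_hom B C" "bij_betw \<tau> (mv_carrier B) (mv_carrier C)"
    using assms(2,3) by (auto simp: mv_isomorphic_def)
  have "bij_betw (compose (mv_carrier A) \<tau> \<sigma>) (mv_carrier A) (mv_carrier C)"
    using bij_betw_trans[OF \<sigma>(2) \<tau>(2)] by (simp add: compose_def cong: bij_betw_cong)
  with mv_hom_compose[OF assms(1) \<sigma>(1) \<tau>(1)] show ?thesis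
    unfolding mv_isomorphic_def by blast
qed

lemma mv_eval_closed:
  assumes "mv_closed A" "range v \<subseteq> mv_carrier A"
  shows "mv_eval A v t \<in> mv_carrier A"
  using assms by (induction t) (auto simp: mv_closed_def)

lemma mv_eval_hom:
  assumes A: "mv_closed A" and \<sigma>: "\<sigma> \<in> mv_hom A B" and v: "range v \<subseteq> mv_carrier A"
  shows "mv_eval B (\<lambda>i. \<sigma> (v i)) t = \<sigma> (mv_eval A v t)"
  using \<sigma> mv_eval_closed[OF A v] by (induction t) (auto simp: mv_hom_def)

lemma mv_algebra_isomorphic:
  assumes A: "mv_algebra A" and iso: "mv_isomorphic A B"
  shows "mv_algebra B"
proof -
  note Acl = mv_algebra_closed[OF A]
  obtain \<sigma> where \<sigma>: "\<sigma> \<in> mv_hom A B" "bij_betw \<sigma> (mv_carrier A) (mv_carrier B)"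
    using iso by (auto simp: mv_isomorphic_def)
  have surj: "mv_carrier B = \<sigma> ` mv_carrier A"
    using \<sigma>(2) by (simp add: bij_betw_def)
  have "mv_closed B"
    unfolding mv_closed_def
  proof (intro conjI ballI)
    show "mv_zero B \<in> mv_carrier B"
      using mv_hom_in[OF \<sigma>(1), of "mv_zero A"] Acl \<sigma>(1) by (simp add: mv_closed_def mv_hom_def)
    fix x assume x: "x \<in> mv_carrier B"
    then obtain x' where x': "x' \<in> mv_carrier A" "x = \<sigma> x'"
      unfolding surj by blast
    show "mv_neg B x \<in> mv_carrier B"
      using mv_hom_in[OF \<sigma>(1), of "mv_neg A x'"] x' Acl \<sigma>(1) by (simp add: mv_closed_def mv_hom_def)
    fix y assume y: "y \<in> mv_carrier B"
    then obtain y' where y': "y' \<in> mv_carrier A" "y = \<sigma> y'"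
      unfolding surj by blast
    show "mv_plus B x y \<in> mv_carrier B"
      using mv_hom_in[OF \<sigma>(1), of "mv_plus A x' y'"] x' y' Acl \<sigma>(1) by (simp add: mv_closed_def mv_hom_def)
  qed
  moreover have "satisfies B s t" if st: "satisfies standard_mv s t" for s t
    unfolding satisfies_def
  proof (intro allI impI)
    fix v :: "nat \<Rightarrow> _" assume v: "range v \<subseteq> mv_carrier B"
    define w where "w = (\<lambda>i. inv_into (mv_carrier A) \<sigma> (v i))"
    have vi: "v i \<in> \<sigma> ` mv_carrier A" for i
      using v surj by auto
    have w: "range w \<subseteq> mv_carrier A" "v = (\<lambda>i. \<sigma> (w i))"
      using inv_into_into[OF vi] f_inv_into_f[OF vi] by (auto simp: w_def)
    have "mv_eval A w s = mv_eval A w t"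
      using A st w(1) by (simp add: mv_algebra_def satisfies_def)
    then show "mv_eval B v s = mv_eval B v t"
      unfolding w(2) mv_eval_hom[OF Acl \<sigma>(1) w(1)] by simp
  qed
  ultimately show ?thesis
    by (simp add: mv_algebra_def mv_closed_def)
qed

lemma mv_closed_falg:
  assumes "unital_subring K" "X \<in> unit_polyhedra"
  shows "mv_closed (falg K X)"
  using assms by (simp add: mv_closed_def rfuns_zero rfuns_neg rfuns_plus)

text \<open>Evaluating a term at a point of the polyhedron is evaluating it in the standard algebra,
  so identities of the unit interval hold pointwise.\<close>

lemma mv_algebra_falg:
  assumes K: "unital_subring K" and X: "X \<in> unit_polyhedra"
  shows "mv_algebra (falg K X)"
proof -
  note cl = mv_closed_falg[OF K X]
  have "satisfies (falg K X) s t" if st: "satisfies standard_mv s t" for s t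
    unfolding satisfies_def
  proof (intro allI impI)
    fix v :: "nat \<Rightarrow> _" assume v: "range v \<subseteq> mv_carrier (falg K X)"
    have eval: "mv_eval (falg K X) v t x = mv_eval standard_mv (\<lambda>i. v i x) t" if "x \<in> snd X" for t x
      using that by (induction t) (auto simp: standard_mv_def)
    have "range (\<lambda>i. v i x) \<subseteq> mv_carrier standard_mv" if "x \<in> snd X" for x
      using v rfuns_bounds[OF X _ that] by (auto simp: standard_mv_def)
    then have "mv_eval (falg K X) v s x = mv_eval (falg K X) v t x" if "x \<in> snd X" for x
      unfolding eval[OF that] using st[unfolded satisfies_def, rule_format, of "\<lambda>i. v i x"] that by simp
    then show "mv_eval (falg K X) v s = mv_eval (falg K X) v t"
      using mv_eval_closed[OF cl v] by (intro rfuns_eqI[of _ K X _ K]) simp_all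
  qed
  with cl show ?thesis
    by (simp add: mv_algebra_def mv_closed_def)
qed

subsection \<open>Quotients by principal ideals\<close>

text \<open>First isomorphism theorem. As the congruence is assumed to be the kernel of
  \<open>r\<close>, its classes are the fibres of \<open>r\<close>, and the unions that define the
  operations of \<open>mv_quotient\<close> run over equal sets.\<close>

lemma mv_quotient_isomorphic:
  assumes M: "mv_closed M" and r: "r \<in> mv_hom M B" "r ` mv_carrier M = mv_carrier B"
    and cong: "mv_cong M I = {(x, y). x \<in> mv_carrier M \<and> y \<in> mv_carrier M \<and> r x = r y}"
  shows "mv_closed (mv_quotient M I)" "mv_isomorphic (mv_quotient M I) B"
proof -
  define cls where "cls = (\<lambda>x. mv_cong M I `` {x})"
  have cls: "cls x = {y \<in> mv_carrier M. r y = r x}" if "x \<in> mv_carrier M" for x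
    using that by (auto simp: cls_def cong)
  have cls_eq: "cls x = cls y" if "x \<in> mv_carrier M" "y \<in> mv_carrier M" "r x = r y" for x y
    using that by (simp add: cls)
  let ?Q = "mv_quotient M I"
  have carrier: "mv_carrier ?Q = cls ` mv_carrier M"
    by (auto simp: mv_quotient_def quotient_def cls_def)
  have self: "x \<in> cls x" if "x \<in> mv_carrier M" for x
    using that by (simp add: cls)
  have plus: "mv_plus ?Q (cls x) (cls y) = cls (mv_plus M x y)" if xy: "x \<in> mv_carrier M" "y \<in> mv_carrier M" for x y
  proof -
    have "cls (mv_plus M x' y') = cls (mv_plus M x y)" if "x' \<in> cls x" "y' \<in> cls y" for x' y'
      using that xy M r(1) by (intro cls_eq) (auto simp: cls mv_closed_def mv_hom_def)
    then have "(\<Union>x'\<in>cls x. \<Union>y'\<in>cls y. cls (mv_plus M x' y')) = cls (mv_plus M x y)"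
      using self[OF xy(1)] self[OF xy(2)] by blast
    then show ?thesis
      by (simp add: mv_quotient_def cls_def)
  qed
  have neg: "mv_neg ?Q (cls x) = cls (mv_neg M x)" if x: "x \<in> mv_carrier M" for x
  proof -
    have "cls (mv_neg M x') = cls (mv_neg M x)" if "x' \<in> cls x" for x'
      using that x M r(1) by (intro cls_eq) (auto simp: cls mv_closed_def mv_hom_def)
    then have "(\<Union>x'\<in>cls x. cls (mv_neg M x')) = cls (mv_neg M x)"
      using self[OF x] by blast
    then show ?thesis
      by (simp add: mv_quotient_def cls_def)
  qed
  have zero: "mv_zero ?Q = cls (mv_zero M)"
    by (simp add: mv_quotient_def cls_def)
  define \<rho> where "\<rho> = restrict (\<lambda>X. the_elem (r ` X)) (mv_carrier ?Q)"
  have \<rho>: "\<rho> (cls x) = r x" if "x \<in> mv_carrier M" for x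
  proof -
    have "r ` cls x = {r x}"
      using that by (auto simp: cls)
    then show ?thesis
      using that by (simp add: \<rho>_def carrier)
  qed
  have "\<rho> \<in> mv_hom ?Q B"
    unfolding mv_hom_def
  proof (intro CollectI conjI ballI)
    show "\<rho> \<in> mv_carrier ?Q \<rightarrow>\<^sub>E mv_carrier B"
    proof (rule PiE_I)
      fix X assume "X \<in> mv_carrier ?Q"
      then show "\<rho> X \<in> mv_carrier B"
        unfolding carrier using \<rho> mv_hom_in[OF r(1)] by auto
    qed (simp add: \<rho>_def)
    show "\<rho> (mv_zero ?Q) = mv_zero B"
      using M r(1) by (simp add: zero \<rho> mv_closed_def mv_hom_def)
    fix X assume "X \<in> mv_carrier ?Q"
    then obtain x where x: "x \<in> mv_carrier M" "X = cls x"
      unfolding carrier by blast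
    show "\<rho> (mv_neg ?Q X) = mv_neg B (\<rho> X)"
      using x M r(1) by (simp add: neg \<rho> mv_closed_def mv_hom_def)
    fix Y assume "Y \<in> mv_carrier ?Q"
    then obtain y where y: "y \<in> mv_carrier M" "Y = cls y"
      unfolding carrier by blast
    show "\<rho> (mv_plus ?Q X Y) = mv_plus B (\<rho> X) (\<rho> Y)"
      using x y M r(1) by (simp add: plus \<rho> mv_closed_def mv_hom_def)
  qed
  moreover have "bij_betw \<rho> (mv_carrier ?Q) (mv_carrier B)"
  proof (rule bij_betw_imageI)
    show "inj_on \<rho> (mv_carrier ?Q)"
    proof (rule inj_onI)
      fix X Y assume "X \<in> mv_carrier ?Q" "Y \<in> mv_carrier ?Q" "\<rho> X = \<rho> Y"
      then show "X = Y"
        unfolding carrier using cls_eq \<rho> by (elim imageE) metis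
    qed
    have "\<rho> ` mv_carrier ?Q = r ` mv_carrier M"
      unfolding carrier image_image by (rule image_cong[OF refl \<rho>])
    then show "\<rho> ` mv_carrier ?Q = mv_carrier B"
      using r(2) by simp
  qed
  ultimately show "mv_isomorphic ?Q B"
    by (auto simp: mv_isomorphic_def)
  show "mv_closed ?Q"
    using M unfolding mv_closed_def carrier by (auto simp: zero neg plus)
qed

section \<open>Principal ideals and quotients of the free MV-algebra\<close>

context
  fixes n :: nat and a :: "(nat \<Rightarrow> real) \<Rightarrow> real" and M :: "((nat \<Rightarrow> real) \<Rightarrow> real) mv"
  defines M_def: "M \<equiv> function_mv (cube n) (MV n)"
begin

lemma free_mv_simps:
  "mv_carrier M = MV n"
  "mv_plus M = (\<lambda>f g. \<lambda>x\<in>cube n. min 1 (f x + g x))"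
  "mv_neg M = (\<lambda>f. \<lambda>x\<in>cube n. 1 - f x)"
  "mv_zero M = (\<lambda>x\<in>cube n. 0)"
  by (simp_all add: M_def function_mv_def)

lemma mv_closed_free_mv: "mv_closed M"
  using unital_subring_instances(3)
  by (auto simp: mv_closed_def free_mv_simps intro: pl_funs_plus pl_funs_neg pl_funs_const)

lemma mv_le_free_mv: "mv_le M f g \<longleftrightarrow> (\<forall>x\<in>cube n. f x \<le> g x)"
  by (auto simp: mv_le_def free_mv_simps fun_eq_iff min_def)

lemma mv_dist_free_mv:
  assumes "f \<in> MV n" "g \<in> MV n"
  shows "mv_dist M f g = (\<lambda>x\<in>cube n. \<bar>f x - g x\<bar>)"
proof (rule extensionalityI[of _ "cube n"])
  fix x assume x: "x \<in> cube n"
  show "mv_dist M f g x = (\<lambda>x\<in>cube n. \<bar>f x - g x\<bar>) x"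
    using x pl_funs_bounds[OF assms(1) x] pl_funs_bounds[OF assms(2) x]
    by (auto simp: mv_dist_def mv_minus_def free_mv_simps min_def)
qed (auto simp: mv_dist_def free_mv_simps)

text \<open>The right-hand side is an ideal that contains \<open>a\<close>. Conversely, each of its
  members lies below some \<open>k\<close>-fold sum of \<open>a\<close>, and such sums belong to
  every ideal that contains \<open>a\<close>.\<close>

lemma principal_mv_ideal_free_mv:
  assumes a: "a \<in> MV n"
  shows "principal_mv_ideal M a = {f \<in> MV n. \<forall>x\<in>cube n. a x = 0 \<longrightarrow> f x = 0}" (is "_ = ?J")
proof
  note int = unital_subring_instances(3)
  have "mv_ideal M ?J"
    unfolding mv_ideal_def
  proof (intro conjI ballI impI)
    fix f g assume fg: "f \<in> ?J" "g \<in> ?J"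
    then show "mv_plus M f g \<in> ?J"
      using pl_funs_plus[OF int, of f n g] by (auto simp: free_mv_simps)
  next
    fix f g assume fg: "f \<in> mv_carrier M" "g \<in> ?J" "mv_le M f g"
    have "f x = 0" if "x \<in> cube n" "a x = 0" for x
      using fg that pl_funs_bounds[of f _ n x] by (force simp: mv_le_free_mv free_mv_simps)
    with fg(1) show "f \<in> ?J"
      by (simp add: free_mv_simps)
  qed (use mv_closed_free_mv in \<open>auto simp: mv_closed_def free_mv_simps\<close>)
  then show "principal_mv_ideal M a \<subseteq> ?J"
    unfolding principal_mv_ideal_def using a by blast
  show "?J \<subseteq> principal_mv_ideal M a"
    unfolding principal_mv_ideal_def
  proof (intro subsetI InterI)
    fix f I assume f: "f \<in> ?J" and "I \<in> {I. mv_ideal M I \<and> a \<in> I}"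
    then have I: "mv_ideal M I" "a \<in> I"
      by auto
    have rat: "MV n \<subseteq> DMV n"
      by (rule pl_funs_mono_int[OF unital_subring_instances(2)])
    have "f \<in> DMV n" "a \<in> DMV n"
      using f a rat by auto
    from zero_set_subset_imp_le_multiple[OF this]
    obtain k :: nat where k: "\<And>x. x \<in> cube n \<Longrightarrow> f x \<le> k * a x"
      using f by auto
    have multiple: "(\<lambda>x\<in>cube n. min 1 (real j * a x)) \<in> I" for j
    proof (induction j)
      case 0
      have "(\<lambda>x\<in>cube n. min 1 (real 0 * a x)) = mv_zero M"
        unfolding free_mv_simps by (rule restrict_ext) simp
      then show ?case
        using I(1) by (simp only: mv_ideal_def)
    next
      case (Suc j)
      have step: "min 1 (min 1 (real j * t) + t) = min 1 (real (Suc j) * t)" if "0 \<le> t" for t :: real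
        using that by (auto simp: min_def algebra_simps)
      have "(\<lambda>x\<in>cube n. min 1 (real (Suc j) * a x)) = mv_plus M (\<lambda>x\<in>cube n. min 1 (real j * a x)) a"
        unfolding free_mv_simps
      proof (rule restrict_ext)
        fix x assume x: "x \<in> cube n"
        show "min 1 (real (Suc j) * a x) = min 1 ((\<lambda>x\<in>cube n. min 1 (real j * a x)) x + a x)"
          using step[of "a x"] pl_funs_bounds[OF a x] x by (simp only: restrict_apply')
      qed
      then show ?case
        using I Suc unfolding mv_ideal_def by metis
    qed
    have "mv_le M f (\<lambda>x\<in>cube n. min 1 (real k * a x))"
      using k pl_funs_bounds[of f \<int> n] f by (simp add: mv_le_free_mv)
    then show "f \<in> I"
      using I(1) multiple[of k] f unfolding mv_ideal_def free_mv_simps by blast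
  qed
qed

text \<open>Restriction to the zero set of \<open>a\<close> is a surjective homomorphism, and two
  functions have the same restriction exactly when their distance vanishes there, that is, lies in
  the ideal of \<open>a\<close>.\<close>

lemma free_mv_quotient_isomorphic:
  assumes a: "a \<in> MV n"
  shows "mv_closed (mv_quotient M (principal_mv_ideal M a))"
    "mv_isomorphic (mv_quotient M (principal_mv_ideal M a)) (falg \<int> (n, {x \<in> cube n. a x = 0}))"
proof -
  let ?P = "{x \<in> cube n. a x = 0}"
  define r :: "((nat \<Rightarrow> real) \<Rightarrow> real) \<Rightarrow> (nat \<Rightarrow> real) \<Rightarrow> real" where "r = (\<lambda>f\<in>MV n. restrict f ?P)"
  have im: "r ` mv_carrier M = mv_carrier (falg \<int> (n, ?P))"
    by (simp add: free_mv_simps r_def rfuns_def restrictions_def)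
  have hom: "r \<in> mv_hom M (falg \<int> (n, ?P))"
    unfolding mv_hom_def
  proof (intro CollectI conjI ballI)
    note cl = mv_closed_free_mv[unfolded mv_closed_def free_mv_simps]
    show "r \<in> mv_carrier M \<rightarrow>\<^sub>E mv_carrier (falg \<int> (n, ?P))"
      unfolding im[symmetric] by (auto simp: r_def free_mv_simps)
    show "r (mv_zero M) = mv_zero (falg \<int> (n, ?P))"
      using cl by (auto simp: r_def free_mv_simps fun_eq_iff)
    fix f assume f: "f \<in> mv_carrier M"
    then show "r (mv_neg M f) = mv_neg (falg \<int> (n, ?P)) (r f)"
      using cl by (auto simp: r_def free_mv_simps fun_eq_iff)
    fix g assume g: "g \<in> mv_carrier M"
    then show "r (mv_plus M f g) = mv_plus (falg \<int> (n, ?P)) (r f) (r g)"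
      using cl f by (auto simp: r_def free_mv_simps fun_eq_iff)
  qed
  have "mv_dist M f g \<in> principal_mv_ideal M a \<longleftrightarrow> r f = r g" if fg: "f \<in> MV n" "g \<in> MV n" for f g
  proof -
    have "mv_dist M f g \<in> MV n"
      using mv_closedD[OF mv_closed_free_mv] fg unfolding mv_dist_def mv_minus_def free_mv_simps(1) by metis
    then have "mv_dist M f g \<in> principal_mv_ideal M a \<longleftrightarrow> (\<forall>x\<in>cube n. a x = 0 \<longrightarrow> f x = g x)"
      unfolding principal_mv_ideal_free_mv[OF a] mv_dist_free_mv[OF fg] by simp
    also have "\<dots> \<longleftrightarrow> r f = r g"
      using fg by (auto simp: r_def fun_eq_iff)
    finally show ?thesis .
  qed
  then have "mv_cong M (principal_mv_ideal M a) =
      {(f, g). f \<in> mv_carrier M \<and> g \<in> mv_carrier M \<and> r f = r g}"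
    by (auto simp: mv_cong_def free_mv_simps)
  from mv_quotient_isomorphic[OF mv_closed_free_mv hom im this]
  show "mv_closed (mv_quotient M (principal_mv_ideal M a))"
    "mv_isomorphic (mv_quotient M (principal_mv_ideal M a)) (falg \<int> (n, ?P))" .
qed

end

lemma unit_polyhedra_zero_set:
  assumes "a \<in> MV n"
  shows "(n, {x \<in> cube n. a x = 0}) \<in> unit_polyhedra"
  using assms by (auto simp: unit_polyhedra_iff zero_sets_def)

lemma finitely_presented_imp_isomorphic_falg:
  assumes "finitely_presented B"
  shows "\<exists>X\<in>unit_polyhedra. mv_isomorphic B (falg \<int> X)"
proof -
  obtain n a where a: "a \<in> MV n" and iso: "mv_isomorphic B
      (mv_quotient (function_mv (cube n) (MV n)) (principal_mv_ideal (function_mv (cube n) (MV n)) a))"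
    and "mv_algebra B"
    using assms by (auto simp: finitely_presented_def)
  then have "mv_isomorphic B (falg \<int> (n, {x \<in> cube n. a x = 0}))"
    using mv_isomorphic_trans[OF mv_algebra_closed iso free_mv_quotient_isomorphic(2)[OF a]] by simp
  with unit_polyhedra_zero_set[OF a] show ?thesis
    by blast
qed

lemma isomorphic_falg_imp_finitely_presented:
  assumes X: "X \<in> unit_polyhedra" and iso: "mv_isomorphic (falg \<int> X) B"
  shows "finitely_presented B"
proof -
  note int = unital_subring_instances(3)
  obtain a where a: "a \<in> MV (fst X)" "snd X = {x \<in> cube (fst X). a x = 0}"
    using X by (auto simp: unit_polyhedra_iff zero_sets_def)
  let ?M = "function_mv (cube (fst X)) (MV (fst X))"
  let ?Q = "mv_quotient ?M (principal_mv_ideal ?M a)"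
  have Bcl: "mv_closed B"
    using mv_algebra_isomorphic[OF mv_algebra_falg[OF int X] iso] by (rule mv_algebra_closed)
  have "mv_isomorphic ?Q (falg \<int> X)"
    using free_mv_quotient_isomorphic(2)[OF a(1)] by (simp add: a(2)[symmetric])
  moreover have "mv_closed ?Q"
    by (rule free_mv_quotient_isomorphic(1)[OF a(1)])
  ultimately have "mv_isomorphic (falg \<int> X) ?Q"
    by (rule mv_isomorphic_sym[rotated])
  then have "mv_isomorphic B ?Q"
    using mv_isomorphic_trans[OF Bcl mv_isomorphic_sym[OF mv_closed_falg[OF int X] iso]] by blast
  then show ?thesis
    unfolding finitely_presented_def
    using mv_algebra_isomorphic[OF mv_algebra_falg[OF int X] iso] a(1) by blast
qed

subsection \<open>Copies of the function algebras on an infinite type\<close>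

definition transport :: "('a \<Rightarrow> 'u) \<Rightarrow> ('a, 'z) mv_scheme \<Rightarrow> 'u mv" where
  "transport h A =
     (let C = mv_carrier A; g = inv_into C h in
      \<lparr>mv_carrier = h ` C, mv_plus = (\<lambda>u v. h (mv_plus A (g u) (g v))),
       mv_neg = (\<lambda>u. h (mv_neg A (g u))), mv_zero = h (mv_zero A)\<rparr>)"

lemma transport_isomorphism:
  assumes A: "mv_closed A" and inj: "inj_on h (mv_carrier A)"
  shows "restrict h (mv_carrier A) \<in> mv_hom A (transport h A)"
    "bij_betw (restrict h (mv_carrier A)) (mv_carrier A) (mv_carrier (transport h A))"
proof -
  show "restrict h (mv_carrier A) \<in> mv_hom A (transport h A)"
    by (rule mv_homI) (simp_all add: transport_def Let_def mv_closedD[OF A] inj)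
  show "bij_betw (restrict h (mv_carrier A)) (mv_carrier A) (mv_carrier (transport h A))"
    using inj by (simp add: transport_def Let_def bij_betw_def)
qed

lemma ex_embedding_rfuns:
  assumes "infinite (UNIV :: 'u set)"
  shows "\<exists>h :: ((nat \<Rightarrow> real) \<Rightarrow> real) \<Rightarrow> 'u. inj_on h (rfuns \<int> X)"
proof -
  obtain g :: "nat \<Rightarrow> 'u" where g: "inj g"
    using infinite_countable_subset[OF assms] by blast
  have "countable (rfuns \<int> X)"
    unfolding rfuns_def restrictions_def by (intro countable_image countable_MV)
  then obtain f :: "((nat \<Rightarrow> real) \<Rightarrow> real) \<Rightarrow> nat" where f: "inj_on f (rfuns \<int> X)"
    by (auto simp: countable_def)
  have "inj_on (g \<circ> f) (rfuns \<int> X)"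
    using f g by (auto intro: comp_inj_on inj_on_subset)
  then show ?thesis
    by blast
qed

lemma is_category_MV_fp: "is_category (MV_fp :: ('u mv, 'u \<Rightarrow> 'u) cat)"
proof -
  have cl: "mv_closed A" if "finitely_presented A" for A :: "'u mv"
    using that by (simp add: finitely_presented_def mv_algebra_closed)
  have unit: "compose (mv_carrier A) \<sigma> (\<lambda>x\<in>mv_carrier A. x) = \<sigma>"
    "compose (mv_carrier A) (\<lambda>x\<in>mv_carrier B. x) \<sigma> = \<sigma>" if "\<sigma> \<in> mv_hom A B" for A B :: "'u mv" and \<sigma>
    using that mv_hom_in[OF that] by (auto simp: mv_hom_def PiE_iff compose_def fun_eq_iff extensional_def)
  have assoc: "compose (mv_carrier A) h (compose (mv_carrier A) g \<sigma>) =
      compose (mv_carrier A) (compose (mv_carrier B) h g) \<sigma>"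
    if "\<sigma> \<in> mv_hom A B" for A B :: "'u mv" and \<sigma> g h
    using mv_hom_in[OF that] by (intro compose_assoc) auto
  show ?thesis
    unfolding is_category_def MV_fp_def using cl unit
    by (simp add: mv_hom_id mv_hom_compose) (intro allI impI ballI assoc)
qed

lemma mv_isomorphic_imp_cat_iso:
  fixes A B :: "'u mv"
  assumes "mv_closed A" "mv_isomorphic A B"
  shows "\<exists>e. cat_iso (MV_fp :: ('u mv, 'u \<Rightarrow> 'u) cat) A B e"
proof -
  obtain \<sigma> where \<sigma>: "\<sigma> \<in> mv_hom A B" "bij_betw \<sigma> (mv_carrier A) (mv_carrier B)"
    using assms(2) by (auto simp: mv_isomorphic_def)
  let ?\<tau> = "restrict (inv_into (mv_carrier A) \<sigma>) (mv_carrier B)"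
  have "compose (mv_carrier A) ?\<tau> \<sigma> = (\<lambda>x\<in>mv_carrier A. x)"
    using \<sigma> mv_hom_in[OF \<sigma>(1)] by (auto simp: compose_def fun_eq_iff bij_betw_def)
  moreover have "compose (mv_carrier B) \<sigma> ?\<tau> = (\<lambda>x\<in>mv_carrier B. x)"
    using \<sigma>(2) f_inv_into_f[of _ \<sigma> "mv_carrier A"] by (auto simp: compose_def fun_eq_iff bij_betw_def)
  ultimately have "cat_iso (MV_fp :: ('u mv, 'u \<Rightarrow> 'u) cat) A B \<sigma>"
    unfolding cat_iso_def MV_fp_def using \<sigma>(1) mv_hom_inverse[OF assms(1) \<sigma>] by auto
  then show ?thesis by blast
qed

text \<open>Each algebra over \<open>\<int>\<close> is copied into \<open>'u\<close> by an
  isomorphism \<open>e X\<close>, and pullbacks are conjugated by these isomorphisms. Fullness,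
  faithfulness and essential surjectivity are then inherited from the function algebras.\<close>

lemma ex_equivalence_functor_MV_fp:
  assumes "infinite (UNIV :: 'u set)"
  shows "\<exists>G. equivalence_functor (op_cat RatPol) (MV_fp :: ('u mv, 'u \<Rightarrow> 'u) cat) G"
proof -
  note int = unital_subring_instances(3)
  obtain h :: "polyhedron \<Rightarrow> ((nat \<Rightarrow> real) \<Rightarrow> real) \<Rightarrow> 'u" where h: "\<And>X. inj_on (h X) (rfuns \<int> X)"
    using ex_embedding_rfuns[OF assms] by metis
  define A where "A = (\<lambda>X. transport (h X) (falg \<int> X))"
  define e where "e = (\<lambda>X. restrict (h X) (rfuns \<int> X))"
  define e' where "e' = (\<lambda>X. restrict (inv_into (rfuns \<int> X) (e X)) (mv_carrier (A X)))"
  note Fcl = mv_closed_falg[OF int]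
  have e: "e X \<in> mv_hom (falg \<int> X) (A X)" and bij: "bij_betw (e X) (rfuns \<int> X) (mv_carrier (A X))"
    if X: "X \<in> unit_polyhedra" for X
    using transport_isomorphism[OF Fcl[OF X], of "h X"] h[of X] by (simp_all add: A_def e_def)
  have iso: "mv_isomorphic (falg \<int> X) (A X)" if "X \<in> unit_polyhedra" for X
    using e[OF that] bij[OF that] unfolding mv_isomorphic_def falg_simps(1) by blast
  have fp: "finitely_presented (A X)" if "X \<in> unit_polyhedra" for X
    using isomorphic_falg_imp_finitely_presented[OF that iso[OF that]] .
  have Acl: "mv_closed (A X)" if "X \<in> unit_polyhedra" for X
    using fp[OF that] by (simp add: finitely_presented_def mv_algebra_closed)
  have e': "e' X \<in> mv_hom (A X) (falg \<int> X)" if X: "X \<in> unit_polyhedra" for X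
    using mv_hom_inverse[OF Fcl[OF X] e[OF X]] bij[OF X] by (simp add: e'_def)
  have e'e: "e' X (e X f) = f" if "X \<in> unit_polyhedra" "f \<in> rfuns \<int> X" for X f
    using bij[OF that(1)] that(2) by (auto simp: e'_def bij_betw_def)
  have ee': "e X (e' X u) = u" if "X \<in> unit_polyhedra" "u \<in> mv_carrier (A X)" for X u
    using bij[OF that(1)] that(2) by (auto simp: e'_def bij_betw_def f_inv_into_f)
  have e_in: "e X f \<in> mv_carrier (A X)" if "X \<in> unit_polyhedra" "f \<in> rfuns \<int> X" for X f
    using mv_hom_in[OF e[OF that(1)]] that(2) by simp
  have e'_in: "e' X u \<in> rfuns \<int> X" if "X \<in> unit_polyhedra" "u \<in> mv_carrier (A X)" for X u
    using mv_hom_in[OF e'[OF that(1)] that(2)] by simp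
  \<comment> \<open>With the empty set of scalars, \<open>scalar_mv_hom\<close> is
    \<open>mv_hom\<close>.\<close>
  have pull: "pullback \<int> X Y z \<in> mv_hom (falg \<int> X) (falg \<int> Y)"
    if "X \<in> unit_polyhedra" "Y \<in> unit_polyhedra" "z \<in> Z_maps Y X" for X Y z
    using pullback_in_hom[OF int that, of "{}"] by (simp add: scalar_mv_hom_def)
  have pull_in: "pullback \<int> X Y z f \<in> rfuns \<int> Y"
    if "X \<in> unit_polyhedra" "Y \<in> unit_polyhedra" "z \<in> Z_maps Y X" "f \<in> rfuns \<int> X" for X Y z f
    using mv_hom_in[OF pull[OF that(1-3)], of f] that(4) by simp
  define m where "m = (\<lambda>X Y z. \<lambda>u\<in>mv_carrier (A X). e Y (pullback \<int> X Y z (e' X u)))"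
  have m_hom: "m X Y z \<in> mv_hom (A X) (A Y)"
    if "X \<in> unit_polyhedra" "Y \<in> unit_polyhedra" "z \<in> Z_maps Y X" for X Y z
  proof -
    have "compose (mv_carrier (A X)) (e Y) (compose (mv_carrier (A X)) (pullback \<int> X Y z) (e' X)) \<in> mv_hom (A X) (A Y)"
      using mv_hom_compose[OF Acl[OF that(1)] mv_hom_compose[OF Acl[OF that(1)] e'[OF that(1)] pull[OF that]] e[OF that(2)]] .
    moreover have "compose (mv_carrier (A X)) (e Y) (compose (mv_carrier (A X)) (pullback \<int> X Y z) (e' X)) = m X Y z"
      by (auto simp: m_def compose_def fun_eq_iff)
    ultimately show ?thesis by simp
  qed
  have m_id: "m X X (\<lambda>x\<in>snd X. x) = (\<lambda>u\<in>mv_carrier (A X). u)" if "X \<in> unit_polyhedra" for X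
    unfolding m_def pullback_id[OF int refl]
    by (rule restrict_ext) (simp add: e'_in[OF that] ee'[OF that])
  have m_comp: "m X W (compose (snd W) z w) = compose (mv_carrier (A X)) (m Y W w) (m X Y z)"
    if XYW: "X \<in> unit_polyhedra" "Y \<in> unit_polyhedra" "W \<in> unit_polyhedra"
      and z: "z \<in> Z_maps Y X" and w: "w \<in> Z_maps W Y" for X Y W z w
  proof (rule extensionalityI[of _ "mv_carrier (A X)"])
    fix u assume u: "u \<in> mv_carrier (A X)"
    note f = e'_in[OF XYW(1) u]
    note g = pull_in[OF XYW(1,2) z f]
    have "pullback \<int> X W (compose (snd W) z w) (e' X u) = pullback \<int> Y W w (pullback \<int> X Y z (e' X u))"
      using fun_cong[OF pullback_compose[OF int XYW(1,2) z w], of "e' X u"] f by (simp add: compose_def)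
    then show "m X W (compose (snd W) z w) u = compose (mv_carrier (A X)) (m Y W w) (m X Y z) u"
      using u e_in[OF XYW(2) g] e'e[OF XYW(2) g] by (simp add: m_def compose_def)
  qed (simp_all add: m_def compose_def)
  have m_bij: "bij_betw (m X Y) (Z_maps Y X) (mv_hom (A X) (A Y))"
    if XY: "X \<in> unit_polyhedra" "Y \<in> unit_polyhedra" for X Y
  proof (rule bij_betw_imageI)
    show "inj_on (m X Y) (Z_maps Y X)"
    proof (rule inj_onI)
      fix z w assume zw: "z \<in> Z_maps Y X" "w \<in> Z_maps Y X" "m X Y z = m X Y w"
      have "pullback \<int> X Y z = pullback \<int> X Y w"
      proof (rule mv_hom_eqI[OF pull[OF XY zw(1)] pull[OF XY zw(2)]])
        fix f assume "f \<in> mv_carrier (falg \<int> X)"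
        then have f: "f \<in> rfuns \<int> X" by simp
        have "e Y (pullback \<int> X Y z f) = e Y (pullback \<int> X Y w f)"
          using fun_cong[OF zw(3), of "e X f"] e_in[OF XY(1) f] e'e[OF XY(1) f] by (simp add: m_def)
        then show "pullback \<int> X Y z f = pullback \<int> X Y w f"
          using e'e[OF XY(2)] pull_in[OF XY zw(1) f] pull_in[OF XY zw(2) f] by metis
      qed
      then show "z = w"
        using inj_onD[OF inj_on_pullback[OF int XY(1)] _ zw(1,2)] by simp
    qed
    show "m X Y ` Z_maps Y X = mv_hom (A X) (A Y)"
    proof (intro subset_antisym subsetI)
      fix \<tau> assume \<tau>: "\<tau> \<in> mv_hom (A X) (A Y)"
      define \<sigma> where "\<sigma> = compose (rfuns \<int> X) (e' Y) (compose (rfuns \<int> X) \<tau> (e X))"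
      have \<sigma>: "\<sigma> \<in> mv_hom (falg \<int> X) (falg \<int> Y)"
        using mv_hom_compose[OF Fcl[OF XY(1)] mv_hom_compose[OF Fcl[OF XY(1)] e[OF XY(1)] \<tau>] e'[OF XY(2)]]
        by (simp add: \<sigma>_def)
      \<comment> \<open>Over \<open>\<int>\<close> this is automatic: all values of
        \<open>\<sigma>\<close> are integral functions.\<close>
      have "integral_on_generators X Y \<sigma>"
        using mv_hom_in[OF \<sigma>] rfuns_coord[OF XY(1) int] by (simp add: integral_on_generators_iff)
      then obtain z where z: "z \<in> Z_maps Y X" "\<sigma> = pullback \<int> X Y z"
        using hom_eq_pullback[OF int XY \<sigma>] by blast
      have "\<tau> = m X Y z"
      proof (rule mv_hom_eqI[OF \<tau> m_hom[OF XY z(1)]])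
        fix u assume u: "u \<in> mv_carrier (A X)"
        have "pullback \<int> X Y z (e' X u) = e' Y (\<tau> u)"
          using e'_in[OF XY(1) u] ee'[OF XY(1) u] by (simp add: z(2)[symmetric] \<sigma>_def compose_def)
        then show "\<tau> u = m X Y z u"
          using u ee'[OF XY(2) mv_hom_in[OF \<tau> u]] by (simp add: m_def)
      qed
      with z(1) show "\<tau> \<in> m X Y ` Z_maps Y X"
        by blast
    qed (use m_hom[OF XY] in auto)
  qed
  have es: "\<exists>X\<in>unit_polyhedra. \<exists>i. cat_iso MV_fp (A X) B i" if "finitely_presented B" for B :: "'u mv"
  proof -
    note fpB = that
    have Bcl: "mv_closed B"
      using that by (simp add: finitely_presented_def mv_algebra_closed)
    obtain X where X: "X \<in> unit_polyhedra" "mv_isomorphic B (falg \<int> X)"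
      using finitely_presented_imp_isomorphic_falg[OF fpB] by blast
    have "mv_isomorphic (A X) B"
      using mv_isomorphic_sym[OF Bcl mv_isomorphic_trans[OF Bcl X(2) iso[OF X(1)]]] .
    from mv_isomorphic_imp_cat_iso[OF Acl[OF X(1)] this] X(1) show ?thesis
      by blast
  qed
  have op: "cat_obj (op_cat RatPol) = unit_polyhedra" "cat_hom (op_cat RatPol) = (\<lambda>X Y. Z_maps Y X)"
    "cat_id (op_cat RatPol) = (\<lambda>X. \<lambda>x\<in>snd X. x)"
    "cat_comp (op_cat RatPol) = (\<lambda>X Y W w z. compose (snd W) z w)"
    by (simp_all add: op_cat_def RatPol_def)
  have fp_cat: "cat_obj MV_fp = {B :: 'u mv. finitely_presented B}" "cat_hom MV_fp = (mv_hom :: 'u mv \<Rightarrow> 'u mv \<Rightarrow> _)"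
    "cat_id MV_fp = (\<lambda>B :: 'u mv. \<lambda>x\<in>mv_carrier B. x)"
    "cat_comp MV_fp = (\<lambda>(B :: 'u mv) C D g f. compose (mv_carrier B) g f)"
    by (simp_all add: MV_fp_def)
  have "is_functor (op_cat RatPol) (MV_fp :: ('u mv, 'u \<Rightarrow> 'u) cat) \<lparr>f_obj = A, f_mor = m\<rparr>"
    unfolding is_functor_def op fp_cat by (simp add: fp m_hom m_id m_comp)
  then have "equivalence_functor (op_cat RatPol) (MV_fp :: ('u mv, 'u \<Rightarrow> 'u) cat) \<lparr>f_obj = A, f_mor = m\<rparr>"
    unfolding equivalence_functor_def op using m_bij es by (simp add: fp_cat)
  then show ?thesis by blast
qed

theorem mainTheorem8:
  assumes "infinite (UNIV :: 'u set)"
  shows "equivalent_categories DMV_fp_c' RMV_fp_c' \<and>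
         equivalent_categories DMV_fp_c' (MV_fp :: ('u mv, 'u \<Rightarrow> 'u) cat) \<and>
         equivalent_categories DMV_fp_c' (op_cat RatPol) \<and>
         equivalent_categories RMV_fp_c' (MV_fp :: ('u mv, 'u \<Rightarrow> 'u) cat) \<and>
         equivalent_categories RMV_fp_c' (op_cat RatPol) \<and>
         equivalent_categories (MV_fp :: ('u mv, 'u \<Rightarrow> 'u) cat) (op_cat RatPol)"
proof -
  note P = is_category_op[OF is_category_RatPol]
  obtain G where G: "equivalence_functor (op_cat RatPol) (MV_fp :: ('u mv, 'u \<Rightarrow> 'u) cat) G"
    using ex_equivalence_functor_MV_fp[OF assms] by blast
  have S: "{0..1} \<inter> \<rat> \<subseteq> \<rat> \<inter> {0..1 :: real}" "{0..1} \<subseteq> UNIV \<inter> {0..1 :: real}"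
    by auto
  note D = is_category_alg_cat[OF unital_subring_instances(2) S(1)]
    equivalence_functor_alg_cat[OF unital_subring_instances(2) S(1)]
  note R = is_category_alg_cat[OF unital_subring_instances(1) S(2)]
    equivalence_functor_alg_cat[OF unital_subring_instances(1) S(2)]
  note M = is_category_MV_fp G
  \<comment> \<open>The identity is the second leg of the span for the pairs in which
    \<open>op_cat RatPol\<close> itself occurs.\<close>
  note I = P equivalence_functor_id[OF P]
  show ?thesis
    unfolding alg_cat_instances
    using equivalent_categories_span[OF P D(1) R(1) D(2) R(2)]
      equivalent_categories_span[OF P D(1) M(1) D(2) M(2)]
      equivalent_categories_span[OF P D(1) I(1) D(2) I(2)]
      equivalent_categories_span[OF P R(1) M(1) R(2) M(2)]
      equivalent_categories_span[OF P R(1) I(1) R(2) I(2)]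
      equivalent_categories_span[OF P M(1) I(1) M(2) I(2)]
    by (intro conjI)
qed

end
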